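(* Let $\beta$ be a generalised multinacci number. Then the local dimension function $d(\nu_\beta,(\omega,x))$ (with respect to the metric $\rho$ on $X$) is constant $\nu_\beta$-a.e. and equal to $$d\big(\nu_\beta,(\omega,x)\big)=\frac{\log\lceil\beta\rceil}{\log\beta}+\frac{\log2}{\log\beta}\big(1-\mu_\beta(S)\big).$$
   Context: **Generalised multinacci numbers.** For $\beta>1$ let $I=[0,\frac{\lfloor\beta\rfloor}{\beta-1}]$. The greedy map $T_\beta:I\to I$ is $T_\beta x=\beta x-a_1(x)$, where $a_1(x)=k$ if $x\in[\frac k\beta,\frac{k+1}\beta)$ for some $k\in\{0,\dots,\lfloor\beta\rfloor-1\}$, and $a_1(x)=\lfloor\beta\rfloor$ if $x\in[\frac{\lfloor\beta\rfloor}\beta,\frac{\lfloor\beta\rfloor}{\beta-1}]$. With $a_n(x)=a_1(T_\beta^{n-1}x)$ one has $x=\sum_{n\ge1}a_n(x)\beta^{-n}$, the greedy $\beta$-expansion of $x$. The number $\beta$ is a generalised multinacci number if the greedy expansion of $1$ is finite, $1=\frac{a_1}{\beta}+\cdots+\frac{a_n}{\beta^n}$, with $n\ge2$ and $a_j\ge1$ for all $1\le j\le n$. **Random $\beta$-transformation.** Let $T_kx=\beta x-k$ for $0\le k\le\lfloor\beta\rfloor$, and $E_0=[0,\frac1\beta)$, $E_{\lfloor\beta\rfloor}=\big(\frac{\lfloor\beta\rfloor}{\beta(\beta-1)}+\frac{\lfloor\beta\rfloor-1}{\beta},\frac{\lfloor\beta\rfloor}{\beta-1}\big]$, $E_k=\big(\frac{\lfloor\beta\rfloor}{\beta(\beta-1)}+\frac{k-1}\beta,\frac{k+1}\beta\big)$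 for $1\le k\le\lfloor\beta\rfloor-1$, $S_k=\big[\frac k\beta,\frac{\lfloor\beta\rfloor}{\beta(\beta-1)}+\frac{k-1}\beta\big]$ for $1\le k\le\lfloor\beta\rfloor$. Put $S=\bigcup_kS_k$ and $\Omega=\{0,1\}^{\mathbb N}$, with left shift $\sigma$. Define $K:\Omega\times I\to\Omega\times I$ by $K(\omega,x)=(\omega,T_kx)$ if $x\in E_k$, and $K(\omega,x)=(\sigma\omega,T_{k-1+\omega_1}x)$ if $x\in S_k$. Let $\pi(\omega,x)=x$. **The measures $\nu_\beta$ and $\mu_\beta$.** Let $b_1(\omega,x)=k$ if $x\in E_k$, or if $x\in S_k$ and $\omega_1=1$; let $b_1(\omega,x)=k-1$ if $x\in S_k$ and $\omega_1=0$. Let $b_n(\omega,x)=b_1(K^{n-1}(\omega,x))$ and $\phi(\omega,x)=(b_n(\omega,x))_{n\ge1}\in\{0,\dots,\lfloor\beta\rfloor\}^{\mathbb N}$. Let $Z$ be the set of $(\omega,x)$ such that $\pi(K^n(\omega,x))\in S$ for infinitely many $n$; $\phi$ is a bimeasurable bijection from $Z$ onto its image. With $m$ the uniform Bernoulli measure on $\{0,\dots,\lfloor\beta\rfloor\}^{\mathbb N}$ (each digit has probability $1/(\lfloor\beta\rfloor+1)$), $\nu_\beta=m\circ\phi$, i.e. $\nu_\beta(A)=m(\phi(A\cap Z))$; it is a $K$-invariant probability measure with $\nu_\beta(Z)=1$. The symmetric Bernoulli convolution is $\mu_\beta=\nu_\beta\circ\pi^{-1}$ on $I$. **Coding and metric.**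 For $\beta$ generalised multinacci the set $$F=\Big\{\pi(K^n(\omega,1)),\ \pi\big(K^n(\omega,\tfrac{\lfloor\beta\rfloor}{\beta-1}-1)\big):n\ge0,\ \omega\in\Omega\Big\}\cup\Big\{\tfrac k\beta,\ \tfrac{\lfloor\beta\rfloor}{\beta(\beta-1)}+\tfrac k\beta:0\le k\le\lfloor\beta\rfloor\Big\}$$ is finite (known). Let $C_1,\dots,C_L$ be the open intervals between consecutive points of $F$, numbered from left to right. Let $X=(\Omega\times I)\setminus\bigcup_{n\ge0}K^{-n}(\Omega\times F)$; then $\nu_\beta(X)=1$. For $(\omega,x)\in X$ and $j\ge1$ let $\alpha_j(\omega,x)=k$ if $\pi(K^{j-1}(\omega,x))\in C_k$. The metric $\rho$ on $X$ is $$\rho\big((\omega,x),(\omega',x')\big)=\beta^{-\min\{k\ge0:\ \omega_{k+1}\ne\omega'_{k+1}\text{ or }\alpha_{k+1}(\omega,x)\ne\alpha_{k+1}(\omega',x')\}}$$ for distinct points (and $0$ for equal points). **Local dimension.** For a probability measure $\mu$ on a metric space, with $B(z,r)$ the open ball of radius $r$ around $z$, $d(\mu,z)=\lim_{r\downarrow0}\frac{\log\mu(B(z,r))}{\log r}$, when this limit exists. *)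

theory Defs
  imports "HOL-Probability.Probability"
begin

text \<open>
  The sequence space \<open>\<Omega>\<close> over \<open>{0, 1}\<close> is the type \<open>nat \<Rightarrow> bool\<close>, with \<open>True\<close> for the
  symbol 1. Sequences are indexed from 0, so \<open>\<omega> k\<close> is the (k+1)-st coordinate in the usual
  numbering; the functions \<open>greedy_digits\<close>, \<open>rand_digits\<close> and \<open>alpha\<close> are indexed from 1.
\<close>

definition fl :: "real \<Rightarrow> nat" where
  "fl \<beta> = nat \<lfloor>\<beta>\<rfloor>"

definition I :: "real \<Rightarrow> real set" where
  "I \<beta> = {0 .. fl \<beta> / (\<beta> - 1)}"

definition greedy_digit :: "real \<Rightarrow> real \<Rightarrow> nat" where
  "greedy_digit \<beta> x =
     (if x \<in> {fl \<beta> / \<beta> .. fl \<beta> / (\<beta> - 1)} then fl \<beta>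
      else (THE k. k < fl \<beta> \<and> x \<in> {k / \<beta> ..< (k + 1) / \<beta>}))"

definition greedy_map :: "real \<Rightarrow> real \<Rightarrow> real" where
  "greedy_map \<beta> x = \<beta> * x - greedy_digit \<beta> x"

definition greedy_digits :: "real \<Rightarrow> real \<Rightarrow> nat \<Rightarrow> nat" where
  "greedy_digits \<beta> x n = greedy_digit \<beta> ((greedy_map \<beta> ^^ (n - 1)) x)"

definition generalised_multinacci :: "real \<Rightarrow> bool" where
  "generalised_multinacci \<beta> \<longleftrightarrow> \<beta> > 1 \<and>
     (\<exists>n\<ge>2. (\<forall>j\<in>{1..n}. greedy_digits \<beta> 1 j \<ge> 1) \<and>
            (\<forall>j>n. greedy_digits \<beta> 1 j = 0) \<and>
            1 = (\<Sum>j=1..n. greedy_digits \<beta> 1 j / \<beta> ^ j))"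

definition T :: "real \<Rightarrow> nat \<Rightarrow> real \<Rightarrow> real" where
  "T \<beta> k x = \<beta> * x - k"

definition E :: "real \<Rightarrow> nat \<Rightarrow> real set" where
  "E \<beta> k =
     (if k = 0 then {0 ..< 1 / \<beta>}
      else if k = fl \<beta> then
        {fl \<beta> / (\<beta> * (\<beta> - 1)) + (real (fl \<beta>) - 1) / \<beta> <.. fl \<beta> / (\<beta> - 1)}
      else {fl \<beta> / (\<beta> * (\<beta> - 1)) + (real k - 1) / \<beta> <..< (real k + 1) / \<beta>})"

definition S_part :: "real \<Rightarrow> nat \<Rightarrow> real set" where
  "S_part \<beta> k = {k / \<beta> .. fl \<beta> / (\<beta> * (\<beta> - 1)) + (real k - 1) / \<beta>}"

definition S :: "real \<Rightarrow> real set" where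
  "S \<beta> = (\<Union>k\<in>{1..fl \<beta>}. S_part \<beta> k)"

text \<open>
  For \<open>\<beta>\<close> generalised multinacci the sets \<open>E \<beta> k\<close> and
  \<open>S_part \<beta> k\<close> partition \<open>I \<beta>\<close>, so exactly one \<open>k\<close> qualifies below when \<open>x \<in> I \<beta>\<close>.
\<close>

definition rand_digit :: "real \<Rightarrow> (nat \<Rightarrow> bool) \<times> real \<Rightarrow> nat" where
  "rand_digit \<beta> = (\<lambda>(\<omega>, x).
     if x \<in> S \<beta> then (THE k. k \<in> {1..fl \<beta>} \<and> x \<in> S_part \<beta> k) - 1 + of_bool (\<omega> 0)
     else (THE k. k \<le> fl \<beta> \<and> x \<in> E \<beta> k))"

text \<open>
  \<open>K\<close> acts on the second coordinate by \<open>T \<beta> k\<close> on \<open>E \<beta> k\<close> and by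
  \<open>T \<beta> (k - 1 + of_bool (\<omega> 0))\<close> on \<open>S_part \<beta> k\<close>: the index is always the random digit.
\<close>

definition K :: "real \<Rightarrow> (nat \<Rightarrow> bool) \<times> real \<Rightarrow> (nat \<Rightarrow> bool) \<times> real" where
  "K \<beta> = (\<lambda>(\<omega>, x).
     (if x \<in> S \<beta> then \<omega> \<circ> Suc else \<omega>, T \<beta> (rand_digit \<beta> (\<omega>, x)) x))"

definition rand_digits :: "real \<Rightarrow> (nat \<Rightarrow> bool) \<times> real \<Rightarrow> nat \<Rightarrow> nat" where
  "rand_digits \<beta> p n = rand_digit \<beta> ((K \<beta> ^^ (n - 1)) p)"

definition phi :: "real \<Rightarrow> (nat \<Rightarrow> bool) \<times> real \<Rightarrow> (nat \<Rightarrow> nat)" where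
  "phi \<beta> p = (\<lambda>n. rand_digits \<beta> p (n + 1))"

definition Z :: "real \<Rightarrow> ((nat \<Rightarrow> bool) \<times> real) set" where
  "Z \<beta> = {p \<in> UNIV \<times> I \<beta>. infinite {n. snd ((K \<beta> ^^ n) p) \<in> S \<beta>}}"

text \<open>The measurable space \<open>\<Omega> \<times> I\<close>; only its space and sigma-algebra are used.\<close>

definition Omega_I :: "real \<Rightarrow> ((nat \<Rightarrow> bool) \<times> real) measure" where
  "Omega_I \<beta> = (\<Pi>\<^sub>M i\<in>UNIV. count_space UNIV) \<Otimes>\<^sub>M restrict_space borel (I \<beta>)"

definition uniform_bernoulli :: "real \<Rightarrow> (nat \<Rightarrow> nat) measure" where
  "uniform_bernoulli \<beta> = (\<Pi>\<^sub>M i\<in>UNIV. uniform_count_measure {0..fl \<beta>})"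

text \<open>
  For \<open>\<beta>\<close> generalised multinacci, \<open>phi \<beta>\<close> is a bimeasurable bijection from \<open>Z \<beta>\<close> onto its
  image, so the set function below is a measure.
\<close>

definition nu :: "real \<Rightarrow> ((nat \<Rightarrow> bool) \<times> real) measure" where
  "nu \<beta> = measure_of (space (Omega_I \<beta>)) (sets (Omega_I \<beta>))
            (\<lambda>A. emeasure (uniform_bernoulli \<beta>) (phi \<beta> ` (A \<inter> Z \<beta>)))"

definition mu :: "real \<Rightarrow> real measure" where
  "mu \<beta> = distr (nu \<beta>) (restrict_space borel (I \<beta>)) snd"

definition F :: "real \<Rightarrow> real set" where
  "F \<beta> =
     {snd ((K \<beta> ^^ n) (\<omega>, 1)) | n \<omega>. True} \<union>
     {snd ((K \<beta> ^^ n) (\<omega>, fl \<beta> / (\<beta> - 1) - 1)) | n \<omega>. True} \<union>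
     {k / \<beta> | k :: nat. k \<le> fl \<beta>} \<union>
     {fl \<beta> / (\<beta> * (\<beta> - 1)) + k / \<beta> | k :: nat. k \<le> fl \<beta>}"

text \<open>The \<open>k\<close>-th interval is meaningful for \<open>1 \<le> k \<le> card (F \<beta>) - 1\<close>.\<close>

definition C :: "real \<Rightarrow> nat \<Rightarrow> real set" where
  "C \<beta> k = {sorted_list_of_set (F \<beta>) ! (k - 1) <..< sorted_list_of_set (F \<beta>) ! k}"

definition X :: "real \<Rightarrow> ((nat \<Rightarrow> bool) \<times> real) set" where
  "X \<beta> = (UNIV \<times> I \<beta>) - (\<Union>n. (K \<beta> ^^ n) -` (UNIV \<times> F \<beta>))"

definition alpha :: "real \<Rightarrow> nat \<Rightarrow> (nat \<Rightarrow> bool) \<times> real \<Rightarrow> nat" where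
  "alpha \<beta> j p =
     (THE k. k \<in> {1..card (F \<beta>) - 1} \<and> snd ((K \<beta> ^^ (j - 1)) p) \<in> C \<beta> k)"

definition rho :: "real \<Rightarrow> (nat \<Rightarrow> bool) \<times> real \<Rightarrow> (nat \<Rightarrow> bool) \<times> real \<Rightarrow> real" where
  "rho \<beta> p q =
     (if p = q then 0
      else \<beta> powr - real (LEAST k. fst p k \<noteq> fst q k \<or> alpha \<beta> (k + 1) p \<noteq> alpha \<beta> (k + 1) q))"

text \<open>
  \<open>has_local_dim \<mu> M d z D\<close>: the local dimension at \<open>z\<close> of the measure \<open>\<mu>\<close> on the metric
  space \<open>(M, d)\<close> exists and equals the real number \<open>D\<close>. Positivity of the measure of balls is
  implicit in a finite limit of \<open>log \<mu>(B(z,r)) / log r\<close>; it must be spelled out because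
  \<open>ln 0 = 0\<close> in HOL.
\<close>

definition has_local_dim ::
  "'a measure \<Rightarrow> 'a set \<Rightarrow> ('a \<Rightarrow> 'a \<Rightarrow> real) \<Rightarrow> 'a \<Rightarrow> real \<Rightarrow> bool" where
  "has_local_dim \<mu> M d z D \<longleftrightarrow>
     (\<forall>r>0. measure \<mu> (Metric_space.mball M d z r) > 0) \<and>
     ((\<lambda>r. ln (measure \<mu> (Metric_space.mball M d z r)) / ln r) \<longlongrightarrow> D) (at_right 0)"

end

theory Submission
  imports Defs
begin

text \<open>
  The map \<open>phi\<close> carries \<open>nu \<beta>\<close> to the uniform Bernoulli measure on digit sequences.
  Since \<open>R = \<lfloor>\<beta>\<rfloor> / (\<beta> - 1)\<close> satisfies \<open>R - 1 \<le> 1 / \<beta>\<close>, the orbits of \<open>1\<close> and \<open>R - 1\<close> meet \<open>S \<beta>\<close> only in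
  endpoints of the intervals \<open>S_part \<beta> k\<close>. Hence \<open>F \<beta>\<close> is finite, it cuts \<open>I \<beta>\<close> into a Markov partition,
  and every \<open>S_part \<beta> k\<close> is one single cell, which its two branches map onto \<open>[0, R - 1]\<close> and \<open>[1, R]\<close>.
  These two intervals have the same mass by the symmetry \<open>b i \<mapsto> \<lfloor>\<beta>\<rfloor> - b i\<close> of the digits. So the coin
  tosses are fair and independent of the cell of the starting point, although they are not
  independent of the point itself.

  A ball of \<open>rho\<close> prescribes the first \<open>n\<close> coin tosses and the first \<open>n\<close> cells. If \<open>v\<close> of the first
  \<open>n - 1\<close> points of the orbit lie in \<open>S \<beta>\<close>, this amounts to prescribing \<open>n - 1\<close> digits, the cell of the
  last point and \<open>n - v\<close> further tosses. Its mass is therefore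
  \<open>(\<lfloor>\<beta>\<rfloor> + 1) ^ - (n - 1) * 2 ^ - (n - v)\<close> times the mass of a cell, which takes only finitely many
  values. Finally \<open>v / n\<close> tends to \<open>mu \<beta> (S \<beta>)\<close> almost everywhere: the indicator of \<open>S \<beta>\<close> is squeezed
  between functions of finitely many digits, for which Hoeffding's inequality gives the strong law,
  and the error vanishes because \<open>mu \<beta>\<close> has no atoms.
\<close>

subsection \<open>Admissible digits and the set \<open>F\<close>\<close>

text \<open>The bound \<open>R - 1 \<le> 1 / \<beta>\<close> comes from the second greedy digit of
  \<open>1\<close> being at least 1, which gives
  \<open>\<beta>\<^sup>2 \<ge> N * \<beta> + 1\<close>; positivity of the further digits pushes
  every later nonzero point of the orbit beyond \<open>1 / \<beta>\<close>. The obstacle is that a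
  ball fixes \<open>n\<close> tosses although only the visits to \<open>S \<beta>\<close> consume
  them. The surplus tosses belong to an unbounded future, so their law given the last cell is
  needed. It is obtained only for unions of cells, a class that the branches of the map preserve, by
  induction on the number of tosses and, inside it, on the waiting time for the first visit. All
  probabilities are computed on digit sequences: \<open>nu \<beta>\<close> becomes the push-forward
  of the product measure under the inverse \<open>psi\<close> of \<open>phi\<close>, so independence
  of digits replaces any ergodic theorem for \<open>K\<close>. The dimension formula then reads as a
  rate: each step costs \<open>ln (N + 1)\<close> with
  \<open>N + 1 = \<lceil>\<beta>\<rceil>\<close>, each toss not already encoded in a digit costs
  \<open>ln 2\<close>, and \<open>ln \<beta>\<close> converts length into radius.\<close>

lemma fl_bounds:
  assumes "\<beta> > 1"
  shows "1 \<le> fl \<beta>" "real (fl \<beta>) \<le> \<beta>" "\<beta> < real (fl \<beta>) + 1"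
  using assms by (auto simp: fl_def le_nat_iff)

text \<open>The exceptional last interval of the definition is harmless on \<open>[0, 1]\<close>:
  there \<open>\<beta> * x \<le> \<beta> < \<lfloor>\<beta>\<rfloor> + 1\<close>, so the digit is a
  plain floor and the greedy orbit of \<open>1\<close> stays in \<open>[0, 1]\<close>.\<close>

lemma greedy_digit_unit:
  assumes "\<beta> > 1" "0 \<le> x" "x \<le> 1"
  shows "real (greedy_digit \<beta> x) \<le> \<beta> * x" "\<beta> * x < real (greedy_digit \<beta> x) + 1"
proof -
  note fl = fl_bounds[OF assms(1)]
  have R: "1 < fl \<beta> / (\<beta> - 1)"
    using assms fl by (simp add: field_simps)
  have "real (greedy_digit \<beta> x) \<le> \<beta> * x \<and> \<beta> * x < real (greedy_digit \<beta> x) + 1"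
  proof (cases "x \<in> {fl \<beta> / \<beta> .. fl \<beta> / (\<beta> - 1)}")
    case True
    then have "greedy_digit \<beta> x = fl \<beta>" "real (fl \<beta>) \<le> \<beta> * x"
      using assms by (auto simp: greedy_digit_def field_simps)
    moreover have "\<beta> * x \<le> \<beta>"
      using assms by simp
    ultimately show ?thesis
      using fl by linarith
  next
    case False
    then have "x < fl \<beta> / \<beta>"
      using assms(3) R by auto
    then have less: "\<beta> * x < fl \<beta>"
      using assms by (simp add: field_simps)
    define k where "k = nat \<lfloor>\<beta> * x\<rfloor>"
    have k: "real k \<le> \<beta> * x" "\<beta> * x < real k + 1"
      using assms by (auto simp: k_def)
    have cell: "x \<in> {real j / \<beta> ..< (real j + 1) / \<beta>} \<longleftrightarrow> real j \<le> \<beta> * x \<and> \<beta> * x < real j + 1" for j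
      using assms by (auto simp: field_simps)
    have "(THE k. k < fl \<beta> \<and> x \<in> {real k / \<beta> ..< (real k + 1) / \<beta>}) = k"
    proof (rule the_equality)
      show "k < fl \<beta> \<and> x \<in> {real k / \<beta> ..< (real k + 1) / \<beta>}"
        unfolding cell using k less by linarith
    next
      fix j assume "j < fl \<beta> \<and> x \<in> {real j / \<beta> ..< (real j + 1) / \<beta>}"
      then show "j = k"
        unfolding cell using k by linarith
    qed
    then have "greedy_digit \<beta> x = k"
      unfolding greedy_digit_def if_not_P[OF False] by (simp add: add.commute)
    then show ?thesis
      using k by simp
  qed
  then show "real (greedy_digit \<beta> x) \<le> \<beta> * x" "\<beta> * x < real (greedy_digit \<beta> x) + 1"
    by auto
qed

locale multinacci =
  fixes \<beta> :: real
  assumes multinacci: "generalised_multinacci \<beta>"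
begin

definition N :: nat where "N = fl \<beta>"
definition R :: real where "R = real N / (\<beta> - 1)"

lemma beta_gt_1: "\<beta> > 1"
  using multinacci by (simp add: generalised_multinacci_def)

lemma N_ge_1: "1 \<le> N" and N_le_beta: "real N \<le> \<beta>" and beta_less: "\<beta> < real N + 1"
  using fl_bounds[OF beta_gt_1] by (auto simp: N_def)

text \<open>The greedy expansion as an orbit \<open>x\<close> with digits \<open>a\<close>, both
  counted from 0. After \<open>m\<close> digits the remainder is \<open>x m / \<beta> ^ m\<close>;
  finiteness of the expansion makes it vanish at \<open>m = n\<close>, and the orbit then stays at
  0.\<close>

lemma orbit_of_one:
  obtains n :: nat and x :: "nat \<Rightarrow> real" and a :: "nat \<Rightarrow> nat"
  where "n \<ge> 2" "x 0 = 1" "\<And>j. x (Suc j) = \<beta> * x j - a j" "\<And>j. j < n \<Longrightarrow> a j \<ge> 1"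
    "\<And>j. j \<ge> n \<Longrightarrow> x j = 0" "\<And>j. 0 \<le> x j" "\<And>j. x (Suc j) < 1" "a 0 = N"
proof -
  obtain n where n: "n \<ge> 2" "\<forall>j\<in>{1..n}. greedy_digits \<beta> 1 j \<ge> 1"
    "\<forall>j>n. greedy_digits \<beta> 1 j = 0" "1 = (\<Sum>j=1..n. greedy_digits \<beta> 1 j / \<beta> ^ j)"
    using multinacci by (auto simp: generalised_multinacci_def)
  define x where "x j = (greedy_map \<beta> ^^ j) 1" for j
  define a where "a j = greedy_digits \<beta> 1 (Suc j)" for j
  have rec: "x (Suc j) = \<beta> * x j - a j" for j
    by (simp add: x_def a_def greedy_map_def greedy_digits_def)
  have range: "0 \<le> x j \<and> x j \<le> 1" for j
  proof (induction j)
    case (Suc j)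
    then show ?case
      using greedy_digit_unit[OF beta_gt_1, of "x j"]
      by (simp add: x_def greedy_map_def)
  qed (simp add: x_def)
  have less: "x (Suc j) < 1" for j
    using greedy_digit_unit[OF beta_gt_1, of "x j"] range[of j]
    by (simp add: x_def greedy_map_def)
  have "1 = (\<Sum>j=1..m. greedy_digits \<beta> 1 j / \<beta> ^ j) + x m / \<beta> ^ m" for m
  proof (induction m)
    case 0
    then show ?case by (simp add: x_def)
  next
    case (Suc m)
    have "greedy_digits \<beta> 1 (Suc m) / \<beta> ^ Suc m + x (Suc m) / \<beta> ^ Suc m = x m / \<beta> ^ m"
      using beta_gt_1 by (simp add: rec a_def field_simps)
    then show ?case
      using Suc by simp
  qed
  from this[of n] n(4) have "x n = 0"
    using beta_gt_1 by simp
  have zero: "x j = 0" if "j \<ge> n" for j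
    using that
  proof (induction j rule: dec_induct)
    case base
    show ?case by fact
  next
    case (step j)
    then have "a j = 0"
      using n(3) by (simp add: a_def)
    then show ?case
      using step by (simp add: rec)
  qed
  have a: "a j \<ge> 1" if "j < n" for j
    using n(2) that by (auto simp: a_def)
  have "1 \<in> {N / \<beta> .. N / (\<beta> - 1)}"
    using N_le_beta beta_less beta_gt_1 by (simp add: field_simps)
  then have "a 0 = N"
    by (simp add: a_def greedy_digits_def greedy_digit_def N_def)
  show thesis
    by (rule that[of n x a]) (use n(1) rec a zero range less \<open>a 0 = N\<close> in \<open>auto simp: x_def\<close>)
qed

text \<open>The second greedy digit satisfies
  \<open>1 \<le> a 1 \<le> \<beta> * (\<beta> - N)\<close>, the upper bound because the orbit point
  \<open>x 2\<close> is nonnegative.\<close>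

lemma beta_sq: "N * \<beta> + 1 \<le> \<beta>\<^sup>2"
proof -
  obtain n x a where o: "n \<ge> 2" "x 0 = 1" "\<And>j. x (Suc j) = \<beta> * x j - real (a j)"
    "\<And>j. j < n \<Longrightarrow> a j \<ge> (1::nat)" "\<And>j. j \<ge> n \<Longrightarrow> x j = 0" "\<And>j. 0 \<le> x j" "\<And>j. x (Suc j) < 1"
    "a 0 = N"
    by (rule orbit_of_one) blast
  have "0 \<le> x (Suc (Suc 0))"
    by (rule o)
  then have "real (a 1) \<le> \<beta> * (\<beta> - N)"
    by (simp add: o)
  moreover have "1 \<le> a 1"
    using o(1,4) by simp
  ultimately show ?thesis
    by (simp add: power2_eq_square algebra_simps)
qed

text \<open>In the coordinate \<open>\<beta> * x\<close> the switch regions are the intervals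
  \<open>[k, k - 1 + R]\<close>: \<open>1 < R\<close> makes them nondegenerate and
  \<open>R < 2\<close> makes them disjoint. The last equation says that \<open>R\<close> is fixed by
  the branch with digit \<open>N\<close>.\<close>

lemma R_gt_1: "1 < R" and R_le: "R \<le> 1 + 1 / \<beta>" and R_less_2: "R < 2" and beta_R: "\<beta> * R = N + R"
proof -
  show 1: "1 < R" and 2: "R \<le> 1 + 1 / \<beta>"
    using beta_gt_1 beta_less beta_sq by (auto simp: R_def field_simps power2_eq_square)
  have "1 / \<beta> < 1"
    using beta_gt_1 by simp
  then show "R < 2"
    using 2 by linarith
  show "\<beta> * R = N + R"
    using beta_gt_1 by (simp add: R_def field_simps)
qed

lemma mem_I: "x \<in> I \<beta> \<longleftrightarrow> 0 \<le> x \<and> x \<le> R"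
  by (auto simp: I_def R_def N_def)

lemma mem_I': "x \<in> I \<beta> \<longleftrightarrow> 0 \<le> \<beta> * x \<and> \<beta> * x \<le> N + R"
  using beta_gt_1 by (simp add: mem_I beta_R[symmetric] zero_le_mult_iff)

lemma R_frac: "fl \<beta> / (\<beta> * (\<beta> - 1)) + c / \<beta> = (c + R) / \<beta>"
  using beta_gt_1 by (simp add: R_def N_def field_simps)

lemma mem_S_part: "x \<in> S_part \<beta> k \<longleftrightarrow> k \<le> \<beta> * x \<and> \<beta> * x \<le> real k - 1 + R"
  unfolding S_part_def R_frac using beta_gt_1 by (auto simp: field_simps)

lemma mem_S: "x \<in> S \<beta> \<longleftrightarrow> (\<exists>k\<in>{1..N}. k \<le> \<beta> * x \<and> \<beta> * x \<le> real k - 1 + R)"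
  by (simp add: S_def N_def mem_S_part)

lemma mem_E:
  assumes "k \<le> N"
  shows "x \<in> E \<beta> k \<longleftrightarrow> (k = 0 \<or> real k - 1 + R < \<beta> * x) \<and> (k = N \<or> \<beta> * x < k + 1) \<and> x \<in> I \<beta>"
proof -
  have R: "fl \<beta> / (\<beta> - 1) = R" and N: "fl \<beta> = N"
    by (simp_all add: R_def N_def)
  have l: "c / \<beta> < x \<longleftrightarrow> c < \<beta> * x" "x < c / \<beta> \<longleftrightarrow> \<beta> * x < c" for c
    using beta_gt_1 by (simp_all add: field_simps)
  have i: "0 \<le> x \<longleftrightarrow> 0 \<le> \<beta> * x" "x \<le> R \<longleftrightarrow> \<beta> * x \<le> N + R"
    using beta_gt_1 by (simp_all add: zero_le_mult_iff beta_R[symmetric])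
  have I: "x \<in> I \<beta> \<longleftrightarrow> 0 \<le> x \<and> x \<le> R"
    by (rule mem_I)
  have NR: "1 \<le> real N" "1 < R"
    using N_ge_1 R_gt_1 by simp_all
  consider "k = 0" | "k = N" "k \<noteq> 0" | "k \<noteq> 0" "k \<noteq> N"
    by linarith
  then show ?thesis
  proof cases
    case 1
    then have "x \<in> E \<beta> k \<longleftrightarrow> 0 \<le> \<beta> * x \<and> \<beta> * x < 1"
      by (simp add: E_def l i)
    then show ?thesis
      unfolding I i using 1 NR by auto
  next
    case 2
    then have "x \<in> E \<beta> k \<longleftrightarrow> real N - 1 + R < \<beta> * x \<and> \<beta> * x \<le> N + R"
      by (simp add: E_def N R[unfolded N] R_frac[unfolded N] l flip: i)
    then show ?thesis
      unfolding I i using 2 NR by auto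
  next
    case 3
    then have "x \<in> E \<beta> k \<longleftrightarrow> real k - 1 + R < \<beta> * x \<and> \<beta> * x < real k + 1"
      by (simp add: E_def N R[unfolded N] R_frac[unfolded N] l)
    moreover have "1 \<le> real k" "real k + 1 \<le> N"
      using 3 assms by auto
    ultimately show ?thesis
      unfolding I i using 3 NR by auto
  qed
qed

lemma I_cases:
  assumes "x \<in> I \<beta>"
  obtains (S) k where "k \<in> {1..N}" "x \<in> S_part \<beta> k" | (E) k where "k \<le> N" "x \<in> E \<beta> k"
proof -
  \<comment> \<open>The cap at \<open>N\<close> matters near the right end, where
    \<open>\<beta> * x\<close> goes up to \<open>N + R\<close>, beyond \<open>N + 1\<close>.\<close>
  define k where "k = min N (nat \<lfloor>\<beta> * x\<rfloor>)"
  have x: "0 \<le> \<beta> * x" "\<beta> * x \<le> N + R"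
    using assms by (auto simp: mem_I')
  have "real k \<le> \<beta> * x" "k = N \<or> \<beta> * x < k + 1" "k \<le> N"
    using x by (auto simp: k_def min_def le_nat_iff) linarith+
  moreover have "k = 0 \<or> k \<in> {1..N}" using \<open>k \<le> N\<close> by auto
  ultimately show thesis
    using that(1)[of k] that(2)[of k] assms mem_S_part[of x k] mem_E[of k x] by fastforce
qed

lemma S_part_subset_I: "k \<in> {1..N} \<Longrightarrow> x \<in> S_part \<beta> k \<Longrightarrow> x \<in> I \<beta>"
  by (auto simp: mem_S_part mem_I')

lemma S_subset_I: "S \<beta> \<subseteq> I \<beta>"
  using S_part_subset_I by (auto simp: S_def N_def)

lemma E_notin_S: "k \<le> N \<Longrightarrow> x \<in> E \<beta> k \<Longrightarrow> x \<notin> S \<beta>"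
proof
  assume k: "k \<le> N" "x \<in> E \<beta> k" "x \<in> S \<beta>"
  then obtain j where j: "j \<in> {1..N}" "j \<le> \<beta> * x" "\<beta> * x \<le> real j - 1 + R"
    by (auto simp: mem_S)
  have "j \<le> k"
    using k j by (cases "k = N") (auto simp: mem_E)
  moreover have "k < j"
  proof -
    have "real k < real j"
      using k j calculation by (auto simp: mem_E)
    then show ?thesis by simp
  qed
  ultimately show False by simp
qed

lemma rand_digit_S:
  assumes "k \<in> {1..N}" "x \<in> S_part \<beta> k"
  shows "rand_digit \<beta> (\<omega>, x) = k - 1 + of_bool (\<omega> 0)"
proof -
  have "x \<in> S \<beta>"
    using assms by (auto simp: S_def N_def)
  moreover have "(THE k. k \<in> {1..fl \<beta>} \<and> x \<in> S_part \<beta> k) = k"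
  proof (rule the_equality)
    fix j assume "j \<in> {1..fl \<beta>} \<and> x \<in> S_part \<beta> j"
    then show "j = k"
      using assms(2) R_less_2 by (auto simp: mem_S_part)
  qed (use assms in \<open>auto simp: N_def\<close>)
  ultimately show ?thesis
    by (simp add: rand_digit_def)
qed

lemma rand_digit_E:
  assumes "k \<le> N" "x \<in> E \<beta> k"
  shows "rand_digit \<beta> (\<omega>, x) = k"
proof -
  have "(THE k. k \<le> fl \<beta> \<and> x \<in> E \<beta> k) = k"
  proof (rule the_equality)
    fix j assume j: "j \<le> fl \<beta> \<and> x \<in> E \<beta> j"
    show "j = k"
    proof (rule ccontr)
      assume "j \<noteq> k"
      then consider "j < k" | "k < j" by linarith
      then show False
        by cases (use j assms R_gt_1 in \<open>auto simp: mem_E N_def[symmetric]\<close>)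
    qed
  qed (use assms in \<open>auto simp: N_def\<close>)
  then show ?thesis
    using E_notin_S[OF assms] by (simp add: rand_digit_def)
qed

text \<open>From here on, \<open>T \<beta> d x \<in> I \<beta>\<close> expresses that the digit
  \<open>d\<close> is admissible at \<open>x\<close>: a window of length \<open>R\<close> for
  \<open>\<beta> * x\<close>.\<close>

lemma T_mem_I: "T \<beta> k x \<in> I \<beta> \<longleftrightarrow> k \<le> \<beta> * x \<and> \<beta> * x \<le> k + R"
  by (auto simp: T_def mem_I)

lemma T_mem_I_imp: "k \<le> N \<Longrightarrow> T \<beta> k x \<in> I \<beta> \<Longrightarrow> x \<in> I \<beta>"
  unfolding T_mem_I mem_I'[of x] by (simp add: order_trans[OF of_nat_0_le_iff])

lemma rand_digit_le:
  assumes "x \<in> I \<beta>"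
  shows "rand_digit \<beta> (\<omega>, x) \<le> N"
  using assms
proof (cases rule: I_cases)
  case (S k)
  then show ?thesis by (auto simp: rand_digit_S)
next
  case (E k)
  then show ?thesis by (auto simp: rand_digit_E)
qed

lemma T_rand_digit_mem_I:
  assumes "x \<in> I \<beta>"
  shows "T \<beta> (rand_digit \<beta> (\<omega>, x)) x \<in> I \<beta>"
  using assms
proof (cases rule: I_cases)
  case (S k)
  then show ?thesis
    using R_gt_1 by (auto simp: rand_digit_S mem_S_part T_mem_I)
next
  case (E k)
  then show ?thesis
    using R_gt_1 N_ge_1 by (auto simp: rand_digit_E mem_E T_mem_I mem_I'[of x])
qed

text \<open>The strict inequalities bounding \<open>E \<beta> k\<close> keep
  \<open>\<beta> * x\<close> out of the windows of all other digits, so outside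
  \<open>S \<beta>\<close> there is no choice and no toss is read.\<close>

lemma admissible_digit_notin_S:
  assumes "d \<le> N" "T \<beta> d x \<in> I \<beta>" "x \<notin> S \<beta>"
  shows "rand_digit \<beta> (\<omega>, x) = d"
  using T_mem_I_imp[OF assms(1,2)]
proof (cases rule: I_cases)
  case (S k)
  then show ?thesis using assms by (auto simp: S_def N_def)
next
  case (E k)
  have "k = d"
  proof (rule ccontr)
    assume "k \<noteq> d"
    then consider "k < d" | "d < k" by linarith
    then show False
    proof cases
      case 1
      then have "\<beta> * x < k + 1"
        using E assms by (auto simp: mem_E)
      then show False using assms 1 by (auto simp: T_mem_I)
    next
      case 2
      then have "real k - 1 + R < \<beta> * x"
        using E by (auto simp: mem_E)
      then show False using assms 2 by (auto simp: T_mem_I)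
    qed
  qed
  then show ?thesis
    using rand_digit_E[OF E] by simp
qed

text \<open>On \<open>S_part \<beta> k\<close> only \<open>k\<close> and \<open>k - 1\<close> are
  admissible, as \<open>R < 2\<close>, and the toss 1 selects \<open>k\<close>. Since
  \<open>x\<close> lies in no other switch region, \<open>x \<in> S_part \<beta> d\<close> reads the
  toss back from the digit, also when \<open>d = 0\<close>.\<close>

lemma admissible_digit_S:
  assumes "d \<le> N" "T \<beta> d x \<in> I \<beta>" "x \<in> S \<beta>"
  shows "rand_digit \<beta> (\<omega>, x) = d \<longleftrightarrow> \<omega> 0 = (x \<in> S_part \<beta> d)"
proof -
  obtain k where k: "k \<in> {1..N}" "x \<in> S_part \<beta> k"
    using assms by (auto simp: S_def N_def)
  then have "k \<le> \<beta> * x" "\<beta> * x \<le> real k - 1 + R" "d \<le> \<beta> * x" "\<beta> * x \<le> d + R"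
    using assms(2) by (auto simp: mem_S_part T_mem_I)
  then have "d = k \<or> d = k - 1"
    using R_less_2 by linarith
  moreover have "x \<notin> S_part \<beta> (k - 1)"
    using k R_less_2 by (auto simp: mem_S_part)
  ultimately show ?thesis
    using k by (auto simp: rand_digit_S)
qed

lemma snd_K: "snd (K \<beta> p) = T \<beta> (rand_digit \<beta> p) (snd p)"
  by (cases p) (simp add: K_def)

lemma K_eq: "K \<beta> (\<omega>, x) = (if x \<in> S \<beta> then \<omega> \<circ> Suc else \<omega>, T \<beta> (rand_digit \<beta> (\<omega>, x)) x)"
  by (simp add: K_def)

lemma snd_K_funpow_mem_I: "snd p \<in> I \<beta> \<Longrightarrow> snd ((K \<beta> ^^ n) p) \<in> I \<beta>"
proof (induction n)
  case (Suc n)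
  then show ?case
    using T_rand_digit_mem_I[of "snd ((K \<beta> ^^ n) p)" "fst ((K \<beta> ^^ n) p)"]
    by (simp add: snd_K)
qed simp

text \<open>Only finitely many coordinates of \<open>\<omega>\<close> have been read after \<open>n\<close> steps, so the remaining
  ones can be prescribed.\<close>

lemma K_funpow_replace:
  "\<exists>\<omega>'. (K \<beta> ^^ n) (\<omega>', x) = (\<eta>, snd ((K \<beta> ^^ n) (\<omega>, x)))"
proof (induction n arbitrary: \<eta>)
  case 0
  then show ?case by simp
next
  case (Suc n)
  obtain \<omega>1 y where y: "(K \<beta> ^^ n) (\<omega>, x) = (\<omega>1, y)"
    by fastforce
  define \<eta>' where "\<eta>' = (if y \<in> S \<beta> then case_nat (\<omega>1 0) \<eta> else \<eta>)"
  obtain \<omega>' where \<omega>': "(K \<beta> ^^ n) (\<omega>', x) = (\<eta>', y)"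
    using Suc[of \<eta>'] y by auto
  have "K \<beta> (\<eta>', y) = (\<eta>, snd (K \<beta> (\<omega>1, y)))"
    by (auto simp: K_def \<eta>'_def rand_digit_def)
  then show ?case
    using \<omega>' y by (intro exI[of _ \<omega>']) simp
qed

text \<open>The next unread toss can be prescribed so that \<open>d\<close> is chosen; hence the set
  of points reached from \<open>x\<close> over all toss sequences is closed under every admissible
  branch. Only coordinate 0 of the constant sequence used here matters.\<close>

lemma orbit_step:
  assumes "z = snd ((K \<beta> ^^ n) (\<omega>, x))" "d \<le> N" "T \<beta> d z \<in> I \<beta>"
  shows "\<exists>n \<omega>. T \<beta> d z = snd ((K \<beta> ^^ n) (\<omega>, x))"
proof -
  obtain \<omega>' where "(K \<beta> ^^ n) (\<omega>', x) = (\<lambda>_. z \<in> S_part \<beta> d, z)"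
    using K_funpow_replace assms(1) by blast
  moreover have "rand_digit \<beta> (\<lambda>_. z \<in> S_part \<beta> d, z) = d"
    using admissible_digit_notin_S[OF assms(2,3)] admissible_digit_S[OF assms(2,3)]
    by (cases "z \<in> S \<beta>") auto
  ultimately show ?thesis
    by (intro exI[of _ "Suc n"] exI[of _ \<omega>']) (simp add: snd_K)
qed

section \<open>Invariance and finiteness of \<open>F\<close>, and its position relative to
  \<open>S\<close>\<close>

lemma F_cases:
  assumes "c \<in> F \<beta>"
  obtains (one) n \<omega> where "c = snd ((K \<beta> ^^ n) (\<omega>, 1))"
  | (refl) n \<omega> where "c = snd ((K \<beta> ^^ n) (\<omega>, R - 1))"
  | (left) k where "\<beta> * c = real k" "k \<le> N"
  | (right) k where "\<beta> * c = real k + R" "k \<le> N"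
  using assms beta_gt_1 unfolding F_def R_frac
  by (auto simp: R_def[symmetric] N_def[symmetric] field_simps)

lemma F_I:
  "snd ((K \<beta> ^^ n) (\<omega>, 1)) \<in> F \<beta>" "snd ((K \<beta> ^^ n) (\<omega>, R - 1)) \<in> F \<beta>"
  "k \<le> N \<Longrightarrow> k / \<beta> \<in> F \<beta>" "k \<le> N \<Longrightarrow> (k + R) / \<beta> \<in> F \<beta>"
  unfolding F_def R_frac unfolding R_def[symmetric] N_def[symmetric] by blast+

lemma special_in_F: "0 \<in> F \<beta>" "R \<in> F \<beta>" "1 \<in> F \<beta>" "R - 1 \<in> F \<beta>"
proof -
  show "0 \<in> F \<beta>" using F_I(3)[of 0] by simp
  show "R \<in> F \<beta>" using F_I(4)[of N] beta_gt_1 by (simp add: beta_R[symmetric])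
  show "1 \<in> F \<beta>" using F_I(1)[of 0] by simp
  show "R - 1 \<in> F \<beta>" using F_I(2)[of 0] by simp
qed

text \<open>The two orbit families are closed by \<open>orbit_step\<close>. An admissible branch
  sends a left endpoint \<open>k / \<beta>\<close> to 0 or 1 and a right endpoint
  \<open>(k + R) / \<beta>\<close> to \<open>R\<close> or \<open>R - 1\<close>, all of which are in
  \<open>F \<beta>\<close>. This is the source of the Markov property.\<close>

lemma F_invariant:
  assumes "c \<in> F \<beta>" "d \<le> N" "T \<beta> d c \<in> I \<beta>"
  shows "T \<beta> d c \<in> F \<beta>"
  using assms(1)
proof (cases rule: F_cases)
  case (one n \<omega>)
  then show ?thesis using orbit_step[OF one assms(2,3)] F_I by metis
next
  case (refl n \<omega>)
  then show ?thesis using orbit_step[OF refl assms(2,3)] F_I by metis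
next
  case (left k)
  then have "d \<le> k" "real k \<le> d + R"
    using assms(3) by (auto simp: T_mem_I)
  then have "k = d \<or> k = d + 1"
    using R_less_2 by linarith
  then show ?thesis
    using special_in_F left by (auto simp: T_def)
next
  case (right k)
  then have "d \<le> real k + R" "real k \<le> d"
    using assms(3) by (auto simp: T_mem_I)
  then have "k = d \<or> d = k + 1"
    using R_less_2 by linarith
  then show ?thesis
    using special_in_F right by (auto simp: T_def)
qed

text \<open>A nonzero orbit point after the first is followed by a digit at least 1, hence is at
  least \<open>1 / \<beta> \<ge> R - 1\<close>. So the fractional part of \<open>\<beta> * z\<close>
  avoids the open interval from 0 to \<open>R - 1\<close>, which is what being inside a switch
  region would require.\<close>

lemma greedy_orbit:
  obtains G :: "real set" where "finite G" "0 \<in> G" "1 \<in> G" "G \<subseteq> {0..1}"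
    "\<And>z. z \<in> G \<Longrightarrow> \<exists>a :: nat. \<exists>y \<in> G. \<beta> * z = a + y \<and> y < 1 \<and> (y = 0 \<or> R - 1 \<le> y)"
proof -
  obtain n x a where o: "n \<ge> 2" "x 0 = 1" "\<And>j. x (Suc j) = \<beta> * x j - real (a j)"
    "\<And>j. j < n \<Longrightarrow> a j \<ge> (1::nat)" "\<And>j. j \<ge> n \<Longrightarrow> x j = 0" "\<And>j. 0 \<le> x j" "\<And>j. x (Suc j) < 1"
    by (rule orbit_of_one) blast
  show thesis
  proof (rule that[of "range x"])
    have "range x \<subseteq> insert 0 (x ` {..<n})"
    proof
      fix y assume "y \<in> range x"
      then obtain j where "y = x j" by blast
      then show "y \<in> insert 0 (x ` {..<n})"
        using o(5)[of j] by (cases "j < n") auto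
    qed
    then show "finite (range x)"
      by (rule finite_subset) simp
    show "0 \<in> range x" "1 \<in> range x"
      using o(5)[of n] o(2) by (auto intro: range_eqI[of 0 x n] range_eqI[of 1 x 0])
    have "x j \<le> 1" for j
      using o(2,7) less_imp_le by (cases j) auto
    then show "range x \<subseteq> {0..1}"
      using o(6) by auto
  next
    fix z assume "z \<in> range x"
    then obtain j where z: "z = x j" by auto
    have "x (Suc j) = 0 \<or> R - 1 \<le> x (Suc j)"
    proof (cases "Suc j < n")
      case True
      then have "1 \<le> real (a (Suc j))" "0 \<le> x (Suc (Suc j))"
        using o(4)[of "Suc j"] o(6)[of "Suc (Suc j)"] by simp_all
      then have "1 \<le> \<beta> * x (Suc j)"
        using o(3)[of "Suc j"] by linarith
      then have "1 / \<beta> \<le> x (Suc j)"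
        using beta_gt_1 by (simp add: field_simps)
      then show ?thesis
        using R_le by simp
    qed (use o(5) in auto)
    then show "\<exists>a :: nat. \<exists>y \<in> range x. \<beta> * z = a + y \<and> y < 1 \<and> (y = 0 \<or> R - 1 \<le> y)"
      using o(3)[of j] o(7)[of j]
      by (intro exI[of _ "a j"] bexI[of _ "x (Suc j)"] rangeI) (simp_all add: z)
  qed
qed

text \<open>The reflection of \<open>I \<beta>\<close> exchanges the digits \<open>d\<close> and
  \<open>N - d\<close>; it carries statements about the orbit of \<open>1\<close> over to that of
  \<open>R - 1\<close>.\<close>

lemma T_reflect: "d \<le> N \<Longrightarrow> T \<beta> d (R - z) = R - T \<beta> (N - d) z"
  using beta_R by (simp add: T_def algebra_simps)

text \<open>The greedy orbit \<open>G\<close> together with its reflection, the set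
  \<open>H\<close>, is already closed under all admissible branches and not only the greedy one, so
  it contains both random orbits.\<close>

lemma F_finite: "finite (F \<beta>)"
  and F_not_in_interior: "c \<in> F \<beta> \<Longrightarrow> k \<in> {1..N} \<Longrightarrow> k < \<beta> * c \<Longrightarrow> \<beta> * c < real k - 1 + R \<Longrightarrow> False"
proof -
  obtain G :: "real set" where G: "finite G" "0 \<in> G" "1 \<in> G" "G \<subseteq> {0..1}"
    "\<And>z. z \<in> G \<Longrightarrow> \<exists>a :: nat. \<exists>y \<in> G. \<beta> * z = a + y \<and> y < 1 \<and> (y = 0 \<or> R - 1 \<le> y)"
    by (rule greedy_orbit) blast
  define H where "H = G \<union> (\<lambda>z. R - z) ` G"
  have step: "T \<beta> d z \<in> H" if z: "z \<in> G" and d: "T \<beta> d z \<in> I \<beta>" for z d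
  proof -
    obtain a :: nat and y :: real where y: "y \<in> G" "\<beta> * z = a + y" "y < 1" "y = 0 \<or> R - 1 \<le> y"
      using G(5)[OF z] by blast
    have "0 \<le> y" using y(1) G(4) by auto
    moreover have "d \<le> a + y" "a + y \<le> d + R"
      using d y(2) by (auto simp: T_mem_I)
    \<comment> \<open>For \<open>a = d\<close> the greedy branch is taken. For
      \<open>a = d + 1\<close> the value is \<open>y + 1 \<le> R\<close>, which forces
      \<open>y = 0\<close> or \<open>y = R - 1\<close>: the lower branch is open only at endpoints
      of a switch region and leads to 1 or \<open>R\<close>.\<close>
    ultimately have "a = d \<or> a = d + 1"
      using y(3) R_less_2 by linarith
    then have "T \<beta> d z = y \<or> T \<beta> d z = y + 1 \<and> y + 1 \<le> R"
      using d y(2) by (auto simp: T_def mem_I)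
    then have "T \<beta> d z = y \<or> T \<beta> d z = 1 \<or> T \<beta> d z = R - 0"
      using y(4) by auto
    moreover have "R - 0 \<in> (\<lambda>z. R - z) ` G"
      using G(2) by (rule imageI)
    ultimately show ?thesis
      using y(1) G(3) by (auto simp: H_def)
  qed
  have step': "T \<beta> d z \<in> H" if z: "z \<in> H" and d: "T \<beta> d z \<in> I \<beta>" "d \<le> N" for z d
  proof (cases "z \<in> G")
    case False
    then obtain w where w: "w \<in> G" "z = R - w"
      using z by (auto simp: H_def)
    have "T \<beta> (N - d) w \<in> I \<beta>"
      using d w T_reflect[OF d(2), of w] by (auto simp: mem_I)
    from step[OF w(1) this] show ?thesis
      using w T_reflect[OF d(2), of w] by (auto simp: H_def)
  qed (use step d in auto)
  have HI: "H \<subseteq> I \<beta>"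
    using G(4) R_gt_1 by (auto simp: H_def mem_I)
  have orbit: "snd ((K \<beta> ^^ n) (\<omega>, z)) \<in> H" if "z \<in> H" for n \<omega> z
  proof (induction n)
    case (Suc n)
    obtain \<eta> w where w: "(K \<beta> ^^ n) (\<omega>, z) = (\<eta>, w)" by fastforce
    then have "w \<in> H" "w \<in> I \<beta>"
      using Suc HI by auto
    then show ?case
      using w step'[of w "rand_digit \<beta> (\<eta>, w)"] T_rand_digit_mem_I rand_digit_le
      by (simp add: snd_K)
  qed (use that in simp)
  have 1: "1 \<in> H" "R - 1 \<in> H"
    using G(3) by (auto simp: H_def)
  have F: "c \<in> H \<or> (\<exists>k\<le>N. \<beta> * c = real k) \<or> (\<exists>k\<le>N. \<beta> * c = real k + R)" if "c \<in> F \<beta>" for c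
    using that
  proof (cases rule: F_cases)
    case (one n \<omega>)
    then show ?thesis using orbit 1 by simp
  next
    case (refl n \<omega>)
    then show ?thesis using orbit 1 by simp
  qed auto
  have "F \<beta> \<subseteq> H \<union> (\<lambda>k. real k / \<beta>) ` {..N} \<union> (\<lambda>k. (real k + R) / \<beta>) ` {..N}"
    using F beta_gt_1 by (fastforce simp: field_simps)
  moreover have "finite H"
    using G(1) by (simp add: H_def)
  ultimately show "finite (F \<beta>)"
    by (auto intro: finite_subset)
  have inG: False if z: "z \<in> G" and k: "k < \<beta> * z" "\<beta> * z < real k - 1 + R" for z and k :: nat
  proof -
    obtain a :: nat and y :: real where y: "y \<in> G" "\<beta> * z = a + y" "y < 1" "y = 0 \<or> R - 1 \<le> y"
      using G(5)[OF z] by blast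
    show False
      using y(2-4) k R_less_2 by (cases "a \<ge> k") auto
  qed
  show False if c: "c \<in> F \<beta>" "k \<in> {1..N}" "k < \<beta> * c" "\<beta> * c < real k - 1 + R"
  proof -
    have "c \<notin> G"
      using inG c by blast
    moreover have "c \<noteq> R - z" if "z \<in> G" for z
    proof
      assume "c = R - z"
      then have "\<beta> * c = N + R - \<beta> * z"
        by (simp add: right_diff_distrib beta_R)
      \<comment> \<open>The reflection carries the switch region of index \<open>k\<close> to the
        one of index \<open>N - k + 1\<close>.\<close>
      moreover have "real (N - k + 1) = real N - real k + 1"
        using c(2) by simp
      ultimately have "real (N - k + 1) < \<beta> * z" "\<beta> * z < real (N - k + 1) - 1 + R"
        using c(3,4) by linarith+
      then show False
        using inG[OF that] by blast
    qed
    ultimately have "c \<notin> H"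
      by (auto simp: H_def)
    then obtain j :: nat where "\<beta> * c = j \<or> \<beta> * c = j + R"
      using F[OF c(1)] by blast
    then show False
    proof
      assume "\<beta> * c = j + R"
      then have "real j + 1 < k"
        using c(4) by linarith
      then have "j + 2 \<le> k"
        by linarith
      then have "real j + 2 \<le> k"
        by linarith
      then show False
        using \<open>\<beta> * c = j + R\<close> c(3) R_less_2 by linarith
    next
      assume "\<beta> * c = j"
      then have "real k < real j" "real j < real (k + 1)"
        using c(3,4) R_less_2 by linarith+
      then show False
        by simp
    qed
  qed
qed

text \<open>Comparing with all cut points avoids the sorted list behind \<open>C\<close> and gives
  an equivalence relation on all reals. Its bounded classes are half-open intervals
  \<open>(c, c']\<close>; off \<open>F \<beta>\<close> they are the intervals
  \<open>C \<beta> k\<close>.\<close>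

definition same_cell :: "real \<Rightarrow> real \<Rightarrow> bool" where
  "same_cell x y \<longleftrightarrow> (\<forall>c\<in>F \<beta>. c < x \<longleftrightarrow> c < y)"

lemma same_cell_refl: "same_cell x x"
  and same_cell_sym: "same_cell x y \<Longrightarrow> same_cell y x"
  and same_cell_trans: "same_cell x y \<Longrightarrow> same_cell y z \<Longrightarrow> same_cell x z"
  by (auto simp: same_cell_def)

text \<open>The sets of cut points below \<open>x\<close> and below \<open>y\<close> are nested, so
  equal cardinality makes them equal. This gives every cell a natural number as index.\<close>

lemma same_cell_iff_card:
  "same_cell x y \<longleftrightarrow> card {c \<in> F \<beta>. c < x} = card {c \<in> F \<beta>. c < y}"
proof
  assume *: "card {c \<in> F \<beta>. c < x} = card {c \<in> F \<beta>. c < y}"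
  have "{c \<in> F \<beta>. c < x} = {c \<in> F \<beta>. c < y}"
  proof (cases "x \<le> y")
    case True
    then show ?thesis
      using F_finite * by (intro card_subset_eq) auto
  next
    case False
    then show ?thesis
      using F_finite * by (intro card_subset_eq[symmetric]) auto
  qed
  then show "same_cell x y"
    by (auto simp: same_cell_def)
next
  assume "same_cell x y"
  then have "{c \<in> F \<beta>. c < x} = {c \<in> F \<beta>. c < y}"
    by (auto simp: same_cell_def)
  then show "card {c \<in> F \<beta>. c < x} = card {c \<in> F \<beta>. c < y}"
    by simp
qed

text \<open>Connects \<open>alpha\<close> with the count of cut points: in the sorted list exactly
  the first \<open>m\<close> entries are below \<open>y\<close>. That \<open>0\<close> and
  \<open>R\<close> are cut points keeps \<open>m\<close> in the range demanded by the
  description.\<close>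

lemma cell_index:
  assumes "y \<in> I \<beta>" "y \<notin> F \<beta>"
  shows "(THE k. k \<in> {1..card (F \<beta>) - 1} \<and> y \<in> C \<beta> k) = card {c \<in> F \<beta>. c < y}"
proof -
  define xs where "xs = sorted_list_of_set (F \<beta>)"
  have xs: "sorted xs" "distinct xs" "set xs = F \<beta>" "length xs = card (F \<beta>)"
    using F_finite by (auto simp: xs_def)
  define m where "m = length (takeWhile (\<lambda>c. c < y) xs)"
  have below: "xs ! i < y" if "i < m" for i
    using that unfolding m_def by (metis nth_mem set_takeWhileD takeWhile_nth)
  have above: "y < xs ! i" if "m \<le> i" "i < length xs" for i
  proof -
    have "\<not> xs ! m < y"
      using that unfolding m_def by (intro nth_length_takeWhile) auto
    moreover have "xs ! m \<le> xs ! i"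
      using that xs(1) by (simp add: sorted_nth_mono)
    moreover have "xs ! i \<noteq> y"
      using that assms(2) xs(3) nth_mem by metis
    ultimately show ?thesis by simp
  qed
  have "set (takeWhile (\<lambda>c. c < y) xs) = {c \<in> F \<beta>. c < y}"
  proof
    show "set (takeWhile (\<lambda>c. c < y) xs) \<subseteq> {c \<in> F \<beta>. c < y}"
      using xs(3) by (auto dest: set_takeWhileD)
    show "{c \<in> F \<beta>. c < y} \<subseteq> set (takeWhile (\<lambda>c. c < y) xs)"
    proof
      fix c assume "c \<in> {c \<in> F \<beta>. c < y}"
      then obtain i where i: "i < length xs" "xs ! i = c" "c < y"
        using xs(3) by (metis (mono_tags, lifting) in_set_conv_nth mem_Collect_eq)
      then have "i < m"
        using above[of i] by (cases "i < m") auto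
      then show "c \<in> set (takeWhile (\<lambda>c. c < y) xs)"
        unfolding m_def using i(2) by (metis nth_mem takeWhile_nth)
    qed
  qed
  then have m: "m = card {c \<in> F \<beta>. c < y}"
    using xs(2) distinct_card[of "takeWhile (\<lambda>c. c < y) xs"] by (simp add: m_def)
  have "0 < y" "y < R"
    using assms special_in_F by (auto simp: mem_I less_le)
  have "0 < m"
    unfolding m using F_finite special_in_F(1) \<open>0 < y\<close> by (auto simp: card_gt_0_iff)
  have "m < card (F \<beta>)"
  proof -
    have "R \<notin> {c \<in> F \<beta>. c < y}"
      using \<open>y < R\<close> by simp
    then have "{c \<in> F \<beta>. c < y} \<subset> F \<beta>"
      using special_in_F(2) by blast
    then show ?thesis
      unfolding m by (rule psubset_card_mono[OF F_finite])
  qed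
  have C: "y \<in> C \<beta> k \<longleftrightarrow> xs ! (k - 1) < y \<and> y < xs ! k" for k
    by (simp add: C_def xs_def)
  have "(THE k. k \<in> {1..card (F \<beta>) - 1} \<and> y \<in> C \<beta> k) = m"
  proof (rule the_equality)
    show "m \<in> {1..card (F \<beta>) - 1} \<and> y \<in> C \<beta> m"
      using \<open>0 < m\<close> \<open>m < card (F \<beta>)\<close> below[of "m - 1"] above[of m] xs(4)
      by (simp add: C)
  next
    fix k assume "k \<in> {1..card (F \<beta>) - 1} \<and> y \<in> C \<beta> k"
    then have k: "1 \<le> k" "k < length xs" "xs ! (k - 1) < y" "y < xs ! k"
      using \<open>m < card (F \<beta>)\<close> xs(4) by (auto simp: C)
    have "k - 1 < m"
      using above[of "k - 1"] k less_imp_diff_less[OF k(2), of 1] by (cases "k - 1 < m") auto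
    moreover have "m \<le> k"
      using below[of k] k by (cases "k < m") auto
    ultimately show "k = m"
      by linarith
  qed
  then show ?thesis
    by (simp add: m)
qed

text \<open>Markov property: a point of \<open>F \<beta>\<close> separating \<open>x\<close> and
  \<open>y\<close> would be mapped between their images, hence into \<open>I \<beta>\<close>, hence
  by \<open>F_invariant\<close> to a point of \<open>F \<beta>\<close> separating the
  images.\<close>

lemma same_cell_preimage:
  assumes "d \<le> N" "T \<beta> d x \<in> I \<beta>" "T \<beta> d y \<in> I \<beta>" "same_cell (T \<beta> d x) (T \<beta> d y)"
  shows "same_cell x y"
proof -
  have *: "c < y" if "c \<in> F \<beta>" "c < x" "T \<beta> d x \<in> I \<beta>" "T \<beta> d y \<in> I \<beta>"
    "same_cell (T \<beta> d x) (T \<beta> d y)" for c x y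
  proof (rule ccontr)
    have mono: "T \<beta> d u \<le> T \<beta> d v \<longleftrightarrow> u \<le> v" "T \<beta> d u < T \<beta> d v \<longleftrightarrow> u < v" for u v
      using beta_gt_1 by (auto simp: T_def)
    assume "\<not> c < y"
    then have le: "T \<beta> d y \<le> T \<beta> d c" "T \<beta> d c < T \<beta> d x"
      using that by (auto simp: mono)
    then have "T \<beta> d c \<in> I \<beta>"
      using that by (auto simp: mem_I)
    then have "T \<beta> d c \<in> F \<beta>"
      using F_invariant assms(1) that(1) by blast
    then show False
      using that(5) le by (auto simp: same_cell_def)
  qed
  show ?thesis
    unfolding same_cell_def using *[OF _ _ assms(2-4)] *[OF _ _ assms(3,2) same_cell_sym[OF assms(4)]]
    by blast
qed

text \<open>The thresholds \<open>k / \<beta>\<close> and \<open>(k + R) / \<beta>\<close> are cut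
  points, and off \<open>F \<beta>\<close> weak and strict comparison with them coincide.\<close>

lemma same_cell_compare:
  assumes "same_cell x y" "x \<notin> F \<beta>" "y \<notin> F \<beta>" "k \<le> N"
  shows "k \<le> \<beta> * x \<longleftrightarrow> k \<le> \<beta> * y" "\<beta> * x \<le> k + R \<longleftrightarrow> \<beta> * y \<le> k + R"
proof -
  have *: "c \<le> \<beta> * z \<longleftrightarrow> c / \<beta> < z" "\<beta> * z \<le> c \<longleftrightarrow> \<not> c / \<beta> < z" if "z \<notin> F \<beta>" "c / \<beta> \<in> F \<beta>" for c z
  proof -
    have "c / \<beta> \<noteq> z" using that by auto
    then show "c \<le> \<beta> * z \<longleftrightarrow> c / \<beta> < z" "\<beta> * z \<le> c \<longleftrightarrow> \<not> c / \<beta> < z"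
      using beta_gt_1 by (auto simp: field_simps)
  qed
  show "k \<le> \<beta> * x \<longleftrightarrow> k \<le> \<beta> * y" "\<beta> * x \<le> k + R \<longleftrightarrow> \<beta> * y \<le> k + R"
    using * F_I(3,4)[OF assms(4)] assms(1-3) by (auto simp: same_cell_def)
qed

lemma same_cell_S_part:
  assumes "same_cell x y" "x \<notin> F \<beta>" "y \<notin> F \<beta>" "k \<in> {1..N}"
  shows "x \<in> S_part \<beta> k \<longleftrightarrow> y \<in> S_part \<beta> k"
  using same_cell_compare(1)[OF assms(1-3), of k] same_cell_compare(2)[OF assms(1-3), of "k - 1"] assms(4)
  by (auto simp: mem_S_part)

lemma same_cell_S:
  assumes "same_cell x y" "x \<notin> F \<beta>" "y \<notin> F \<beta>"
  shows "x \<in> S \<beta> \<longleftrightarrow> y \<in> S \<beta>"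
  using same_cell_S_part[OF assms] by (auto simp: S_def N_def)

text \<open>A separating cut point would lie strictly inside the switch region, against
  \<open>F_not_in_interior\<close>.\<close>

lemma same_cell_S_partI:
  assumes "x \<notin> F \<beta>" "y \<notin> F \<beta>" "k \<in> {1..N}" "x \<in> S_part \<beta> k" "y \<in> S_part \<beta> k"
  shows "same_cell x y"
proof -
  have *: "c < v" if c: "c \<in> F \<beta>" "c < u" and u: "u \<in> S_part \<beta> k" "v \<in> S_part \<beta> k" "v \<notin> F \<beta>" for c u v
  proof (rule ccontr)
    assume "\<not> c < v"
    then have "v < c" using c(1) u(3) by (metis linorder_neqE)
    then have "\<beta> * v < \<beta> * c" "\<beta> * c < \<beta> * u"
      using c(2) beta_gt_1 by auto
    then show False
      using F_not_in_interior[OF c(1) assms(3)] u by (auto simp: mem_S_part)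
  qed
  show ?thesis
    unfolding same_cell_def using *[OF _ _ assms(4,5,2)] *[OF _ _ assms(5,4,1)] by blast
qed

text \<open>Which digits are admissible depends only on the cell; in \<open>S \<beta>\<close> the
  first toss decides between the two of them.\<close>

lemma same_cell_rand_digit:
  assumes "same_cell x y" "x \<in> I \<beta>" "y \<in> I \<beta>" "x \<notin> F \<beta>" "y \<notin> F \<beta>" "x \<in> S \<beta> \<Longrightarrow> \<omega> 0 = \<eta> 0"
  shows "rand_digit \<beta> (\<omega>, x) = rand_digit \<beta> (\<eta>, y)"
  using assms(2)
proof (cases rule: I_cases)
  case (S k)
  then have "x \<in> S \<beta>" "y \<in> S_part \<beta> k"
    using same_cell_S_part[OF assms(1,4,5), of k] by (auto simp: S_def N_def)
  then show ?thesis
    using S assms(6) by (simp add: rand_digit_S)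
next
  case (E k)
  have "real k \<le> \<beta> * x" "\<beta> * x \<le> k + R"
    using T_rand_digit_mem_I[OF assms(2), of \<omega>] rand_digit_E[OF E] by (auto simp: T_mem_I)
  then have "T \<beta> k y \<in> I \<beta>"
    using same_cell_compare[OF assms(1,4,5) E(1)] by (auto simp: T_mem_I)
  moreover have "y \<notin> S \<beta>"
    using same_cell_S[OF assms(1,4,5)] E_notin_S[OF E] by simp
  ultimately show ?thesis
    using admissible_digit_notin_S[OF E(1)] rand_digit_E[OF E] by metis
qed

end

subsection \<open>Coding by digit sequences\<close>

definition seq_drop :: "nat \<Rightarrow> (nat \<Rightarrow> 'a) \<Rightarrow> nat \<Rightarrow> 'a" where
  "seq_drop n b = (\<lambda>i. b (i + n))"

lemma seq_drop_0 [simp]: "seq_drop 0 b = b"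
  and seq_drop_Suc: "seq_drop (Suc n) b = seq_drop n (b \<circ> Suc)"
  and seq_drop_Suc': "seq_drop (Suc n) b = seq_drop n b \<circ> Suc"
  and seq_drop_apply: "seq_drop n b i = b (i + n)"
  by (simp_all add: seq_drop_def fun_eq_iff add.assoc)

context multinacci
begin

definition digit_seqs :: "(nat \<Rightarrow> nat) set" where
  "digit_seqs = {b. \<forall>i. b i \<le> N}"

definition val :: "(nat \<Rightarrow> nat) \<Rightarrow> real" where
  "val b = (\<Sum>i. b i / \<beta> ^ Suc i)"

lemma digit_seqs_Suc: "b \<in> digit_seqs \<Longrightarrow> b \<circ> Suc \<in> digit_seqs"
  and digit_seqs_drop: "b \<in> digit_seqs \<Longrightarrow> seq_drop n b \<in> digit_seqs"
  and digit_seqs_le: "b \<in> digit_seqs \<Longrightarrow> b i \<le> N"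
  by (auto simp: digit_seqs_def seq_drop_def)

lemma sums_R: "(\<lambda>i. N / \<beta> ^ Suc i) sums R"
proof -
  have "(\<lambda>i. (1 / \<beta>) ^ i) sums (1 / (1 - 1 / \<beta>))"
    using beta_gt_1 by (intro geometric_sums) simp
  from sums_mult[OF this, of "N / \<beta>"]
  have "(\<lambda>i. N / \<beta> ^ Suc i) sums (N / \<beta> * (1 / (1 - 1 / \<beta>)))"
    by (simp add: power_divide)
  moreover have "N / \<beta> * (1 / (1 - 1 / \<beta>)) = R"
    using beta_gt_1 by (simp add: R_def field_simps)
  ultimately show ?thesis
    by simp
qed

lemma summable_digits: "b \<in> digit_seqs \<Longrightarrow> summable (\<lambda>i. b i / \<beta> ^ Suc i)"
  using beta_gt_1 digit_seqs_le
  by (intro summable_comparison_test'[OF sums_summable[OF sums_R], of 0]) (auto simp: divide_right_mono)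

lemma val_mem_I: "b \<in> digit_seqs \<Longrightarrow> val b \<in> I \<beta>"
proof -
  assume b: "b \<in> digit_seqs"
  have "0 \<le> val b"
    unfolding val_def using summable_digits[OF b] beta_gt_1 by (intro suminf_nonneg) auto
  moreover have "val b \<le> R"
    unfolding val_def sums_unique[OF sums_R]
    using summable_digits[OF b] sums_summable[OF sums_R] beta_gt_1 digit_seqs_le[OF b]
    by (intro suminf_le) (auto simp: divide_right_mono)
  ultimately show ?thesis
    by (simp add: mem_I)
qed

lemma T_val: "b \<in> digit_seqs \<Longrightarrow> T \<beta> (b 0) (val b) = val (b \<circ> Suc)"
proof -
  assume b: "b \<in> digit_seqs"
  have "val b = b 0 / \<beta> + (\<Sum>i. b (Suc i) / \<beta> ^ Suc (Suc i))"
    unfolding val_def using suminf_split_head[OF summable_digits[OF b]] by simp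
  also have "(\<Sum>i. b (Suc i) / \<beta> ^ Suc (Suc i)) = (1 / \<beta>) * (\<Sum>i. b (Suc i) / \<beta> ^ Suc i)"
    using summable_digits[OF digit_seqs_Suc[OF b]] by (subst suminf_mult[symmetric]) (auto simp: field_simps)
  finally have "val b = b 0 / \<beta> + 1 / \<beta> * val (b \<circ> Suc)"
    by (simp add: val_def)
  then have "\<beta> * val b = b 0 + val (b \<circ> Suc)"
    using beta_gt_1 by (simp add: field_simps)
  then show ?thesis
    by (simp add: T_def)
qed

lemma T_val_mem_I: "b \<in> digit_seqs \<Longrightarrow> T \<beta> (b 0) (val b) \<in> I \<beta>"
  by (simp add: T_val val_mem_I digit_seqs_Suc)

definition visits :: "(nat \<Rightarrow> nat) \<Rightarrow> nat set" where
  "visits b = {n. val (seq_drop n b) \<in> S \<beta>}"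

definition first_visit :: "(nat \<Rightarrow> nat) \<Rightarrow> nat" where
  "first_visit b = (LEAST n. n \<in> visits b)"

text \<open>The coin tosses are recovered from the digits: at a visit to \<open>S \<beta>\<close> the toss tells which
  of the two admissible digits is chosen.\<close>

primrec coin :: "nat \<Rightarrow> (nat \<Rightarrow> nat) \<Rightarrow> bool" where
  "coin 0 b = (val (seq_drop (first_visit b) b) \<in> S_part \<beta> (b (first_visit b)))"
| "coin (Suc j) b = coin j (seq_drop (Suc (first_visit b)) b)"

declare coin.simps [simp del]

text \<open>The inverse of \<open>phi \<beta>\<close>. Its tosses are meaningful only for sequences
  with infinitely many visits, since otherwise \<open>LEAST\<close> in \<open>first_visit\<close>
  eventually has nothing to select.\<close>

definition psi :: "(nat \<Rightarrow> nat) \<Rightarrow> (nat \<Rightarrow> bool) \<times> real" where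
  "psi b = (\<lambda>j. coin j b, val b)"

text \<open>The image of \<open>Z \<beta>\<close> under \<open>phi \<beta>\<close>, as
  \<open>phi_image\<close> shows.\<close>

definition recurrent_seqs :: "(nat \<Rightarrow> nat) set" where
  "recurrent_seqs = {b \<in> digit_seqs. infinite (visits b)}"

lemma visits_Suc: "Suc n \<in> visits b \<longleftrightarrow> n \<in> visits (b \<circ> Suc)"
  and visits_0: "0 \<in> visits b \<longleftrightarrow> val b \<in> S \<beta>"
  by (simp_all add: visits_def seq_drop_Suc)

lemma infinite_visits_Suc: "infinite (visits (b \<circ> Suc)) \<longleftrightarrow> infinite (visits b)"
proof -
  have "visits (b \<circ> Suc) = Suc -` visits b"
    by (auto simp: visits_Suc)
  moreover have "visits b \<subseteq> insert 0 (Suc ` (Suc -` visits b))"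
  proof
    fix n assume "n \<in> visits b"
    then show "n \<in> insert 0 (Suc ` (Suc -` visits b))"
      by (cases n) auto
  qed
  ultimately show ?thesis
    by (metis finite_imageI finite_insert finite_subset finite_vimageI inj_Suc)
qed

lemma recurrent_seqs_Suc: "b \<in> recurrent_seqs \<Longrightarrow> b \<circ> Suc \<in> recurrent_seqs"
  by (simp add: recurrent_seqs_def digit_seqs_Suc infinite_visits_Suc)

lemma recurrent_seqs_drop: "b \<in> recurrent_seqs \<Longrightarrow> seq_drop n b \<in> recurrent_seqs"
  by (induction n) (auto simp: seq_drop_Suc' recurrent_seqs_Suc)

lemma recurrent_digit_seqs: "b \<in> recurrent_seqs \<Longrightarrow> b \<in> digit_seqs"
  and recurrent_visits_ne: "b \<in> recurrent_seqs \<Longrightarrow> visits b \<noteq> {}"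
  by (auto simp: recurrent_seqs_def)

lemma first_visit_S: "val b \<in> S \<beta> \<Longrightarrow> first_visit b = 0"
  by (simp add: first_visit_def visits_0)

lemma first_visit_not_S:
  assumes "val b \<notin> S \<beta>" "visits b \<noteq> {}"
  shows "first_visit b = Suc (first_visit (b \<circ> Suc))"
proof -
  obtain n where "n \<in> visits b" using assms by auto
  then show ?thesis
    unfolding first_visit_def
    by (subst Least_Suc[of _ n]) (use assms in \<open>auto simp: visits_Suc visits_0\<close>)
qed

lemma coin_0_S: "val b \<in> S \<beta> \<Longrightarrow> coin 0 b = (val b \<in> S_part \<beta> (b 0))"
  and coin_Suc_S: "val b \<in> S \<beta> \<Longrightarrow> coin (Suc j) b = coin j (b \<circ> Suc)"
  by (simp_all add: coin.simps first_visit_S seq_drop_Suc)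

lemma coin_not_S: "val b \<notin> S \<beta> \<Longrightarrow> visits b \<noteq> {} \<Longrightarrow> coin j b = coin j (b \<circ> Suc)"
  by (cases j) (simp_all add: coin.simps first_visit_not_S seq_drop_Suc)

text \<open>The digit \<open>b 0\<close> is always admissible at \<open>val b\<close>. In
  \<open>S \<beta>\<close> the recovered toss selects it, and elsewhere it is the only
  candidate.\<close>

lemma rand_digit_psi:
  assumes "b \<in> digit_seqs"
  shows "rand_digit \<beta> (psi b) = b 0"
  using admissible_digit_S[OF digit_seqs_le[OF assms] T_val_mem_I[OF assms]]
    admissible_digit_notin_S[OF digit_seqs_le[OF assms] T_val_mem_I[OF assms]]
  by (cases "val b \<in> S \<beta>") (simp_all add: psi_def coin_0_S)

text \<open>\<open>K\<close> consumes a toss exactly at a visit to \<open>S \<beta>\<close>, and the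
  recursion of \<open>coin\<close> drops its first toss in the same case.\<close>

lemma K_psi:
  assumes "b \<in> recurrent_seqs"
  shows "K \<beta> (psi b) = psi (b \<circ> Suc)"
proof -
  have "K \<beta> (psi b) = (if val b \<in> S \<beta> then (\<lambda>j. coin j b) \<circ> Suc else (\<lambda>j. coin j b), val (b \<circ> Suc))"
    using rand_digit_psi[OF recurrent_digit_seqs[OF assms]] T_val[OF recurrent_digit_seqs[OF assms]]
    by (simp add: psi_def K_eq)
  then show ?thesis
    using recurrent_visits_ne[OF assms] by (auto simp: psi_def fun_eq_iff coin_Suc_S coin_not_S)
qed

lemma K_funpow_psi: "b \<in> recurrent_seqs \<Longrightarrow> (K \<beta> ^^ n) (psi b) = psi (seq_drop n b)"
  by (induction n) (simp_all add: K_psi recurrent_seqs_drop seq_drop_Suc')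

lemma phi_psi: "b \<in> recurrent_seqs \<Longrightarrow> phi \<beta> (psi b) = b"
  by (simp add: phi_def rand_digits_def K_funpow_psi rand_digit_psi recurrent_digit_seqs
      recurrent_seqs_drop seq_drop_apply)

lemma psi_mem_Z: "b \<in> recurrent_seqs \<Longrightarrow> psi b \<in> Z \<beta>"
  by (simp add: Z_def K_funpow_psi)
    (simp add: psi_def val_mem_I recurrent_seqs_def visits_def)

section \<open>The digit coding and its inverse\<close>

lemma phi_K: "phi \<beta> (K \<beta> p) = phi \<beta> p \<circ> Suc"
  by (simp add: phi_def rand_digits_def fun_eq_iff funpow_swap1)

lemma phi_drop: "phi \<beta> ((K \<beta> ^^ n) p) = seq_drop n (phi \<beta> p)"
  by (induction n) (simp_all add: phi_K seq_drop_Suc')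

lemma phi_0: "phi \<beta> p 0 = rand_digit \<beta> p"
  by (simp add: phi_def rand_digits_def)

lemma phi_digit_seqs: "snd p \<in> I \<beta> \<Longrightarrow> phi \<beta> p \<in> digit_seqs"
  using rand_digit_le[OF snd_K_funpow_mem_I]
  by (auto simp: digit_seqs_def phi_def rand_digits_def) (metis prod.collapse)

text \<open>Unrolling the recursion of the orbit leaves the remainder
  \<open>x n / \<beta> ^ n\<close>, which vanishes because the orbit stays in the bounded interval
  \<open>I \<beta>\<close>.\<close>

lemma val_phi:
  assumes "snd p \<in> I \<beta>"
  shows "val (phi \<beta> p) = snd p"
proof -
  define x where "x n = snd ((K \<beta> ^^ n) p)" for n
  define b where "b = phi \<beta> p"
  have rec: "x (Suc n) = \<beta> * x n - b n" for n
    by (simp add: x_def snd_K T_def b_def phi_def rand_digits_def)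
  have partial: "(\<Sum>i<n. b i / \<beta> ^ Suc i) = x 0 - x n / \<beta> ^ n" for n
  proof (induction n)
    case (Suc n)
    have "b n / \<beta> ^ Suc n = x n / \<beta> ^ n - x (Suc n) / \<beta> ^ Suc n"
      using beta_gt_1 by (simp add: rec field_simps)
    then show ?case
      using Suc by simp
  qed simp
  have "(\<lambda>n. x n / \<beta> ^ n) \<longlonglongrightarrow> 0"
  proof (rule tendsto_rabs_zero_cancel, rule tendsto_sandwich)
    show "\<forall>\<^sub>F n in sequentially. 0 \<le> \<bar>x n / \<beta> ^ n\<bar>" by simp
    show "(\<lambda>n. R * (1 / \<beta>) ^ n) \<longlonglongrightarrow> 0"
      using beta_gt_1 by (intro tendsto_mult_right_zero LIMSEQ_realpow_zero) auto
    have "\<bar>x n\<bar> \<le> R" for n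
      using snd_K_funpow_mem_I[OF assms, of n] by (simp add: x_def mem_I)
    then show "\<forall>\<^sub>F n in sequentially. \<bar>x n / \<beta> ^ n\<bar> \<le> R * (1 / \<beta>) ^ n"
      using beta_gt_1 by (simp add: power_divide divide_right_mono)
  qed simp
  then have "(\<lambda>n. \<Sum>i<n. b i / \<beta> ^ Suc i) \<longlonglongrightarrow> x 0 - 0"
    unfolding partial by (intro tendsto_intros)
  then have "(\<lambda>i. b i / \<beta> ^ Suc i) sums x 0"
    by (simp add: sums_def)
  then show ?thesis
    by (simp add: val_def b_def[symmetric] sums_unique[symmetric] x_def)
qed

lemma visits_phi:
  assumes "snd p \<in> I \<beta>"
  shows "visits (phi \<beta> p) = {n. snd ((K \<beta> ^^ n) p) \<in> S \<beta>}"
  by (simp add: visits_def phi_drop[symmetric] val_phi snd_K_funpow_mem_I assms)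

lemma phi_recurrent: "p \<in> Z \<beta> \<Longrightarrow> phi \<beta> p \<in> recurrent_seqs"
  by (auto simp: Z_def recurrent_seqs_def phi_digit_seqs visits_phi)

lemma Z_mem_I: "p \<in> Z \<beta> \<Longrightarrow> snd p \<in> I \<beta>"
  by (auto simp: Z_def)

lemma K_mem_Z: "p \<in> Z \<beta> \<Longrightarrow> K \<beta> p \<in> Z \<beta>"
proof -
  assume p: "p \<in> Z \<beta>"
  then have "infinite (visits (phi \<beta> (K \<beta> p)))" "snd (K \<beta> p) \<in> I \<beta>"
    using phi_recurrent[OF p] snd_K_funpow_mem_I[of p 1]
    by (auto simp: phi_K infinite_visits_Suc recurrent_seqs_def Z_mem_I)
  then show ?thesis
    by (cases "K \<beta> p") (auto simp: visits_phi Z_def)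
qed

lemma
  assumes "p \<in> Z \<beta>" "snd p \<notin> S \<beta>"
  shows coin_phi_not_S: "coin j (phi \<beta> p) = coin j (phi \<beta> (K \<beta> p))"
    and first_visit_phi_not_S: "first_visit (phi \<beta> p) = Suc (first_visit (phi \<beta> (K \<beta> p)))"
    and fst_K_not_S: "fst (K \<beta> p) = fst p"
proof -
  have "val (phi \<beta> p) \<notin> S \<beta>"
    using assms(2) by (simp add: val_phi[OF Z_mem_I[OF assms(1)]])
  note v = this recurrent_visits_ne[OF phi_recurrent[OF assms(1)]]
  show "coin j (phi \<beta> p) = coin j (phi \<beta> (K \<beta> p))"
    unfolding phi_K by (rule coin_not_S[OF v])
  show "first_visit (phi \<beta> p) = Suc (first_visit (phi \<beta> (K \<beta> p)))"
    unfolding phi_K by (rule first_visit_not_S[OF v])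
  show "fst (K \<beta> p) = fst p"
    using assms(2) by (cases p) (simp add: K_eq)
qed

text \<open>Two inductions: the outer one on the index of the toss, the inner one on the waiting
  time until the first visit, during which neither side changes.\<close>

lemma coin_phi: "p \<in> Z \<beta> \<Longrightarrow> coin j (phi \<beta> p) = fst p j"
proof (induction j arbitrary: p)
  note not_S = coin_phi_not_S first_visit_phi_not_S fst_K_not_S
  {
    case 0
    have "coin 0 (phi \<beta> p) = fst p 0" if "p \<in> Z \<beta>" "first_visit (phi \<beta> p) = n" for n p
      using that
    proof (induction n arbitrary: p)
      case (0 p)
      have S: "snd p \<in> S \<beta>"
        using not_S(2)[OF 0(1)] 0(2) by auto
      obtain \<omega> x where px: "p = (\<omega>, x)" by fastforce
      have "x \<in> I \<beta>" using Z_mem_I[OF 0(1)] px by simp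
      then show ?case
        using S admissible_digit_S[OF rand_digit_le[of x \<omega>] T_rand_digit_mem_I[of x \<omega>], of \<omega>]
          coin_0_S[of "phi \<beta> p"] val_phi[OF Z_mem_I[OF 0(1)]]
        by (simp add: phi_0 px)
    next
      case (Suc n p)
      have "snd p \<notin> S \<beta>"
        using first_visit_S[of "phi \<beta> p"] Suc.prems by (auto simp: val_phi Z_mem_I)
      then show ?case
        using Suc.IH[OF K_mem_Z[OF Suc.prems(1)]] Suc.prems not_S[OF Suc.prems(1)]
        by simp
    qed
    then show ?case
      using 0 by blast
  next
    case (Suc j)
    have "coin (Suc j) (phi \<beta> p) = fst p (Suc j)" if "p \<in> Z \<beta>" "first_visit (phi \<beta> p) = n" for n p
      using that
    proof (induction n arbitrary: p)
      case (0 p)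
      have S: "snd p \<in> S \<beta>"
        using not_S(2)[OF 0(1)] 0(2) by auto
      then have "coin (Suc j) (phi \<beta> p) = coin j (phi \<beta> (K \<beta> p))"
        unfolding phi_K by (intro coin_Suc_S) (simp add: val_phi[OF Z_mem_I[OF 0(1)]])
      also have "\<dots> = fst (K \<beta> p) j"
        by (rule Suc.IH[OF K_mem_Z[OF 0(1)]])
      finally show ?case
        using S by (cases p) (simp add: K_eq)
    next
      case (Suc n p)
      have "snd p \<notin> S \<beta>"
        using first_visit_S[of "phi \<beta> p"] Suc.prems by (auto simp: val_phi Z_mem_I)
      then show ?case
        using Suc.IH(1)[OF K_mem_Z[OF Suc.prems(1)]] Suc.prems not_S[OF Suc.prems(1)]
        by simp
    qed
    then show ?case
      using Suc.prems by blast
  }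
qed

lemma psi_phi: "p \<in> Z \<beta> \<Longrightarrow> psi (phi \<beta> p) = p"
  by (simp add: psi_def coin_phi val_phi Z_mem_I)

text \<open>Turns the direct image in the definition of \<open>nu\<close> into a preimage under
  \<open>psi\<close>, for which measurability is easy.\<close>

lemma phi_image: "phi \<beta> ` (A \<inter> Z \<beta>) = {b \<in> recurrent_seqs. psi b \<in> A}"
proof
  show "phi \<beta> ` (A \<inter> Z \<beta>) \<subseteq> {b \<in> recurrent_seqs. psi b \<in> A}"
    using phi_recurrent psi_phi by fastforce
  show "{b \<in> recurrent_seqs. psi b \<in> A} \<subseteq> phi \<beta> ` (A \<inter> Z \<beta>)"
  proof
    fix b assume "b \<in> {b \<in> recurrent_seqs. psi b \<in> A}"
    then show "b \<in> phi \<beta> ` (A \<inter> Z \<beta>)"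
      using phi_psi[of b] psi_mem_Z[of b] by (intro image_eqI[of _ _ "psi b"]) auto
  qed
qed

end

subsection \<open>The Bernoulli measure on digit sequences\<close>

lemma borel_S_part [measurable]: "S_part \<beta> k \<in> sets borel"
  by (simp add: S_part_def)

lemma borel_S [measurable]: "S \<beta> \<in> sets borel"
  unfolding S_def by measurable

context multinacci
begin

abbreviation P :: "(nat \<Rightarrow> nat) measure" where
  "P \<equiv> uniform_bernoulli \<beta>"

lemma sequence_space_digits: "sequence_space (uniform_count_measure {0..N})"
proof -
  interpret prob_space "uniform_count_measure {0..N}"
    by (rule prob_space_uniform_count_measure) auto
  show ?thesis
    by unfold_locales
qed

lemma P_eq: "P = (\<Pi>\<^sub>M i\<in>UNIV. uniform_count_measure {0..N})"
  by (simp add: uniform_bernoulli_def N_def)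

sublocale P: prob_space P
proof -
  interpret sequence_space "uniform_count_measure {0..N}"
    by (rule sequence_space_digits)
  show "prob_space P"
    unfolding P_eq by unfold_locales
qed

lemma space_P: "space P = digit_seqs"
  by (auto simp: P_eq space_PiM digit_seqs_def space_uniform_count_measure PiE_iff)

lemma measurable_digit_U: "(\<lambda>b. b i) \<in> measurable P (uniform_count_measure {0..N})"
  unfolding P_eq by (rule measurable_component_singleton) simp

lemma measurable_digit [measurable]: "(\<lambda>b. b i) \<in> measurable P (count_space UNIV)"
proof -
  have "(\<lambda>x. x) \<in> measurable (uniform_count_measure {0..N}) (count_space UNIV)"
    by (simp add: measurable_cong_sets[OF sets_uniform_count_measure_count_space refl])
  from measurable_compose[OF measurable_digit_U this] show ?thesis .
qed

lemma measurable_reindex: "(\<lambda>b. (\<lambda>i. b (f i))) \<in> measurable P P"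
  unfolding P_eq
  by (rule measurable_PiM_single')
    (auto intro: measurable_component_singleton simp: space_PiM PiE_iff)

lemma measurable_Suc [measurable]: "(\<lambda>b. b \<circ> Suc) \<in> measurable P P"
  using measurable_reindex[of Suc] by (simp add: comp_def)

lemma measurable_seq_drop [measurable]: "seq_drop n \<in> measurable P P"
  using measurable_reindex[of "\<lambda>i. i + n"] by (simp add: seq_drop_def[abs_def])

lemma measurable_val [measurable]: "val \<in> borel_measurable P"
  unfolding val_def by measurable

lemma pred_visits [measurable]: "Measurable.pred P (\<lambda>b. n \<in> visits b)"
  unfolding visits_def by measurable

lemma measurable_first_visit [measurable]: "first_visit \<in> measurable P (count_space UNIV)"
  unfolding first_visit_def by measurable

text \<open>The position at which the toss is read is itself random, so measurability is shown for
  each fixed position and glued over the countably many values of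
  \<open>first_visit\<close>.\<close>

lemma pred_coin [measurable]: "Measurable.pred P (coin j)"
proof (induction j)
  case 0
  have *: "Measurable.pred P (\<lambda>b. val (seq_drop n b) \<in> S_part \<beta> (b n))" for n
  proof -
    have "Measurable.pred P (\<lambda>b. val (seq_drop n b) \<in> S_part \<beta> k)" for k
      by measurable
    then show ?thesis
      by (rule measurable_compose_countable[where g = "\<lambda>b. b n"]) measurable
  qed
  show ?case
    unfolding coin.simps
    by (rule measurable_compose_countable[OF * measurable_first_visit])
next
  case (Suc j)
  have "Measurable.pred P (\<lambda>b. coin j (seq_drop (Suc n) b))" for n
    using measurable_compose[OF measurable_seq_drop Suc] by simp
  then show ?case
    unfolding coin.simps
    by (rule measurable_compose_countable[OF _ measurable_first_visit])
qed

lemma measurable_psi [measurable]: "psi \<in> measurable P (Omega_I \<beta>)"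
  unfolding psi_def Omega_I_def
proof (rule measurable_Pair)
  show "(\<lambda>b j. coin j b) \<in> measurable P (\<Pi>\<^sub>M i\<in>UNIV. count_space UNIV)"
    by (rule measurable_PiM_single') auto
  show "val \<in> measurable P (restrict_space borel (I \<beta>))"
    by (rule measurable_restrict_space2) (auto simp: space_P val_mem_I)
qed

lemma distr_cons:
  "distr (uniform_count_measure {0..N} \<Otimes>\<^sub>M P) P (\<lambda>(d, b). case_nat d b) = P"
  unfolding P_eq by (rule sequence_space.PiM_iter[OF sequence_space_digits])

text \<open>Prepending a digit carries the product of the uniform measure and \<open>P\<close> to
  \<open>P\<close>, and the event becomes a rectangle. All recursions for probabilities below start
  here.\<close>

lemma measure_first_digit:
  assumes d: "d \<le> N" and Q[measurable]: "Measurable.pred P Q"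
  shows "measure P {b \<in> space P. b 0 = d \<and> Q (b \<circ> Suc)} = measure P {b \<in> space P. Q b} / (N + 1)"
proof -
  let ?U = "uniform_count_measure {0..N}"
  interpret U: prob_space ?U
    by (rule prob_space_uniform_count_measure) auto
  define A where "A = {b \<in> space P. b 0 = d \<and> Q (b \<circ> Suc)}"
  have A: "A \<in> sets P"
    unfolding A_def by measurable
  have meas: "(\<lambda>(d, b). case_nat d b) \<in> measurable (?U \<Otimes>\<^sub>M P) P"
    unfolding P_eq split_beta' by (rule measurable_case_nat') measurable
  have "measure P A = measure (distr (?U \<Otimes>\<^sub>M P) P (\<lambda>(d, b). case_nat d b)) A"
    by (simp only: distr_cons)
  also have "\<dots> = measure (?U \<Otimes>\<^sub>M P) ((\<lambda>(d, b). case_nat d b) -` A \<inter> space (?U \<Otimes>\<^sub>M P))"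
    by (rule measure_distr[OF meas A])
  also have "(\<lambda>(d, b). case_nat d b) -` A \<inter> space (?U \<Otimes>\<^sub>M P) = {d} \<times> {b \<in> space P. Q b}"
    using d by (auto simp: A_def space_pair_measure space_uniform_count_measure space_P comp_def
        digit_seqs_def split: nat.split)
  also have "measure (?U \<Otimes>\<^sub>M P) \<dots> = measure ?U {d} * measure P {b \<in> space P. Q b}"
    unfolding measure_def
    by (subst P.emeasure_pair_measure_Times)
      (use d in \<open>auto simp: sets_uniform_count_measure enn2real_mult\<close>)
  also have "measure ?U {d} = 1 / (N + 1)"
    using d by (subst measure_uniform_count_measure) auto
  finally show ?thesis
    by (simp add: A_def)
qed

lemma measure_split_first_digit:
  assumes [measurable]: "Measurable.pred P Q"
  shows "measure P {b \<in> space P. Q b} = (\<Sum>d\<le>N. measure P {b \<in> space P. b 0 = d \<and> Q b})"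
proof -
  have "{b \<in> space P. Q b} = (\<Union>d\<in>{..N}. {b \<in> space P. b 0 = d \<and> Q b})"
    by (auto simp: space_P digit_seqs_le)
  then show ?thesis
    by (simp only:) (intro P.finite_measure_finite_Union, auto simp: disjoint_family_on_def)
qed

lemma distr_seq_drop: "distr P P (seq_drop n) = P"
proof -
  have "distr (Pi\<^sub>M UNIV (\<lambda>i. uniform_count_measure {0..N})) (\<Pi>\<^sub>M i\<in>UNIV. uniform_count_measure {0..N})
      (\<lambda>\<omega>. \<lambda>i\<in>UNIV. \<omega> (i + n)) = (\<Pi>\<^sub>M i\<in>UNIV. uniform_count_measure {0..N})"
    by (rule distr_PiM_reindex) (auto intro: prob_space_uniform_count_measure)
  then show ?thesis
    by (simp add: P_eq seq_drop_def[abs_def] restrict_def)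
qed

end

subsection \<open>Averages along the shift\<close>

text \<open>The Hoeffding bounds \<open>2 * exp (-2 * e\<^sup>2) ^ n\<close> are summable, so by
  Borel-Cantelli almost surely only finitely many deviations exceed \<open>e\<close>; countably many
  values of \<open>e\<close> suffice.\<close>

lemma (in prob_space) strong_law_bounded:
  fixes Y :: "nat \<Rightarrow> 'a \<Rightarrow> real"
  assumes indep: "indep_vars (\<lambda>_. borel) Y UNIV"
    and range: "\<And>i x. x \<in> space M \<Longrightarrow> Y i x \<in> {0..1}"
    and mean: "\<And>i. expectation (Y i) = p"
  shows "AE x in M. (\<lambda>n. (\<Sum>i<n. Y i x) / n) \<longlonglongrightarrow> p"
proof -
  have meas [measurable]: "random_variable borel (Y i)" for i
    using indep by (auto simp: indep_vars_def)
  have dev: "AE x in M. \<forall>\<^sub>F n in sequentially. \<bar>(\<Sum>i<n. Y i x) / n - p\<bar> < e" if e: "e > 0" for e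
  proof -
    define A where "A n = {x \<in> space M. \<bar>(\<Sum>i<n. Y i x) - n * p\<bar> \<ge> e * n}" for n
    have A [measurable]: "A n \<in> sets M" for n
      unfolding A_def by measurable
    have bound: "prob (A n) \<le> 2 * exp (-2 * e\<^sup>2) ^ n" if "n > 0" for n
    proof -
      interpret Hoeffding_ineq M "{..<n}" Y "\<lambda>_. 0" "\<lambda>_. 1" "\<Sum>i<n. expectation (Y i)"
        by unfold_locales (use range in \<open>auto intro: indep_vars_subset[OF indep]\<close>)
      have "prob {x\<in>space M. \<bar>(\<Sum>i<n. Y i x) - (\<Sum>i<n. expectation (Y i))\<bar> \<ge> e * n}
          \<le> 2 * exp (-2 * (e * n)\<^sup>2 / (\<Sum>i<n. (1 - 0)\<^sup>2))"
        by (rule Hoeffding_ineq_abs_ge) (use e that in auto)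
      moreover have "-2 * (e * n)\<^sup>2 / (\<Sum>i<n. (1 - 0)\<^sup>2) = n * (-2 * e\<^sup>2)"
        using that by (simp add: power2_eq_square)
      ultimately show ?thesis
        by (simp only: A_def mean exp_of_nat_mult sum_constant card_lessThan)
    qed
    have "AE x in M. \<forall>\<^sub>F n in sequentially. x \<in> space M - A n"
    proof (rule borel_cantelli_AE1)
      show "summable (\<lambda>n. measure M (A n))"
      proof (rule summable_comparison_test')
        show "summable (\<lambda>n. 2 * exp (-2 * e\<^sup>2) ^ n)"
          using e by (intro summable_mult summable_geometric) auto
        show "norm (prob (A n)) \<le> 2 * exp (-2 * e\<^sup>2) ^ n" if "n \<ge> 1" for n
          using bound[of n] that by simp
      qed
    qed (auto simp: emeasure_eq_measure)
    then show ?thesis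
    proof eventually_elim
      case (elim x)
      then show ?case
        using eventually_gt_at_top[of 0]
      proof eventually_elim
        case (elim n)
        then have "\<bar>(\<Sum>i<n. Y i x) - n * p\<bar> < e * n"
          by (auto simp: A_def)
        moreover have "(\<Sum>i<n. Y i x) / n - p = ((\<Sum>i<n. Y i x) - n * p) / n"
          using elim by (simp add: field_simps)
        ultimately show ?case
          using elim by (simp add: field_simps)
      qed
    qed
  qed
  have "AE x in M. \<forall>k :: nat. \<forall>\<^sub>F n in sequentially. \<bar>(\<Sum>i<n. Y i x) / n - p\<bar> < inverse (Suc k)"
    unfolding AE_all_countable using dev by auto
  then show ?thesis
  proof eventually_elim
    case (elim x)
    show ?case
    proof (rule tendstoI)
      fix e :: real assume "e > 0"
      then obtain k where "inverse (real (Suc k)) < e"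
        using reals_Archimedean by blast
      with elim[rule_format, of k]
      show "\<forall>\<^sub>F n in sequentially. dist ((\<Sum>i<n. Y i x) / n) p < e"
        by (auto simp: dist_real_def elim!: eventually_mono)
    qed
  qed
qed

text \<open>Up to the next multiple of \<open>l\<close> at most \<open>l\<close> terms are missing,
  each at most 1, and \<open>l / n\<close> tends to 0.\<close>

lemma average_along_multiples:
  fixes f :: "nat \<Rightarrow> real"
  assumes l: "l > 0" and f: "\<And>i. f i \<in> {0..1}"
    and lim: "(\<lambda>q. (\<Sum>i<q * l. f i) / (q * l)) \<longlonglongrightarrow> p"
  shows "(\<lambda>n. (\<Sum>i<n. f i) / n) \<longlonglongrightarrow> p"
proof -
  define s where "s n = (\<Sum>i<n. f i)" for n
  define m where "m n = (n div l) * l" for n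
  have m: "m n \<le> n" "n \<le> m n + l" for n
  proof -
    have "n = m n + n mod l"
      by (simp add: m_def)
    then show "m n \<le> n" "n \<le> m n + l"
      using mod_less_divisor[OF l, of n] by linarith+
  qed
  have s: "0 \<le> s n - s (m n)" "s n - s (m n) \<le> l" for n
  proof -
    have "s n = s (m n) + (\<Sum>i=m n..<n. f i)"
      unfolding s_def using m(1)[of n] by (simp add: lessThan_atLeast0 sum.atLeastLessThan_concat)
    moreover have "(\<Sum>i=m n..<n. f i) \<le> (\<Sum>i=m n..<n. 1)"
      using f by (intro sum_mono) auto
    moreover have "0 \<le> (\<Sum>i=m n..<n. f i)"
      using f by (intro sum_nonneg) auto
    moreover have "real (n - m n) \<le> l"
      using m[of n] by linarith
    ultimately show "0 \<le> s n - s (m n)" "s n - s (m n) \<le> l"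
      by auto
  qed
  have inv: "(\<lambda>n. real l / n) \<longlonglongrightarrow> 0"
    by (rule lim_const_over_n)
  have "filterlim (\<lambda>n. n div l) sequentially sequentially"
  proof (rule filterlim_at_top_mono)
    show "filterlim (\<lambda>n. n div l) sequentially sequentially"
      unfolding filterlim_at_top eventually_sequentially
      using l by (metis div_le_mono nonzero_mult_div_cancel_right not_gr_zero)
  qed auto
  from filterlim_compose[OF lim this]
  have 1: "(\<lambda>n. s (m n) / m n) \<longlonglongrightarrow> p"
    by (simp add: s_def m_def)
  have 2: "(\<lambda>n. m n / n) \<longlonglongrightarrow> 1"
  proof (rule tendsto_sandwich)
    show "(\<lambda>n. 1 - real l / n) \<longlonglongrightarrow> 1"
      using tendsto_diff[OF tendsto_const inv, of 1] by simp
    show "\<forall>\<^sub>F n in sequentially. 1 - real l / n \<le> m n / n"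
      using eventually_gt_at_top[of 0]
    proof eventually_elim
      case (elim n)
      have "real n \<le> m n + l"
        using m(2)[of n] by linarith
      then have "(real n - l) / n \<le> m n / n"
        by (intro divide_right_mono) auto
      then show ?case
        using elim by (simp add: diff_divide_distrib)
    qed
    show "\<forall>\<^sub>F n in sequentially. m n / n \<le> 1"
      using m(1) by (intro always_eventually allI) (auto simp: divide_le_eq_1)
  qed simp
  have 3: "(\<lambda>n. (s n - s (m n)) / n) \<longlonglongrightarrow> 0"
  proof (rule tendsto_sandwich[OF _ _ tendsto_const inv])
    show "\<forall>\<^sub>F n in sequentially. 0 \<le> (s n - s (m n)) / n"
      using s(1) by (intro always_eventually allI divide_nonneg_nonneg) auto
    show "\<forall>\<^sub>F n in sequentially. (s n - s (m n)) / n \<le> real l / n"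
      using s(2) by (intro always_eventually allI divide_right_mono) auto
  qed
  have "(\<lambda>n. s (m n) / m n * (m n / n) + (s n - s (m n)) / n) \<longlonglongrightarrow> p * 1 + 0"
    by (intro tendsto_intros 1 2 3)
  moreover have "s (m n) / m n * (m n / n) + (s n - s (m n)) / n = s n / n" for n
  proof (cases "m n = 0")
    case True
    then show ?thesis by (simp add: s_def)
  next
    case False
    then show ?thesis by (simp add: diff_divide_distrib)
  qed
  ultimately show ?thesis
    by (simp add: s_def)
qed

context multinacci
begin

lemma indep_digits: "P.indep_vars (\<lambda>_. uniform_count_measure {0..N}) (\<lambda>i b. b i) (UNIV :: nat set)"
proof (subst P.indep_vars_iff_distr_eq_PiM')
  have 1: "distr P (uniform_count_measure {0..N}) (\<lambda>b. b i) = uniform_count_measure {0..N}" for i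
    unfolding P_eq by (rule distr_PiM_component) (auto intro: prob_space_uniform_count_measure)
  have "distr P P (\<lambda>b. b) = P"
    by (rule distr_id2) simp
  then show "distr P (\<Pi>\<^sub>M i\<in>UNIV. uniform_count_measure {0..N}) (\<lambda>b. \<lambda>i\<in>UNIV. b i) =
      (\<Pi>\<^sub>M i\<in>UNIV. distr P (uniform_count_measure {0..N}) (\<lambda>b. b i))"
    unfolding 1 by (simp add: P_eq[symmetric] restrict_def)
qed (use measurable_digit_U in auto)

text \<open>Shifts of \<open>G\<close> overlap and are not independent, but along each residue class
  modulo \<open>k > l\<close> they read disjoint blocks of digits, so the strong law applies to
  every class separately.\<close>

lemma average_cylinder_function:
  fixes G :: "(nat \<Rightarrow> nat) \<Rightarrow> real"
  assumes meas [measurable]: "G \<in> borel_measurable P"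
    and range: "\<And>b. b \<in> digit_seqs \<Longrightarrow> G b \<in> {0..1}"
    and dep: "\<And>b b'. (\<And>i. i < l \<Longrightarrow> b i = b' i) \<Longrightarrow> G b = G b'"
  shows "AE b in P. (\<lambda>n. (\<Sum>i<n. G (seq_drop i b)) / n) \<longlonglongrightarrow> P.expectation G"
proof -
  \<comment> \<open>Not \<open>l\<close> itself, so that the modulus is positive also for
    \<open>l = 0\<close>.\<close>
  define k where "k = Suc l"
  have k: "k > 0" "l \<le> k"
    by (simp_all add: k_def)
  have "AE b in P. (\<lambda>n. (\<Sum>j<n. G (seq_drop (j * k + r) b)) / n) \<longlonglongrightarrow> P.expectation G" for r :: nat
  proof (rule P.strong_law_bounded[where Y = "\<lambda>j b. G (seq_drop (j * k + r) b)"])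
    let ?U = "\<lambda>_ :: nat. uniform_count_measure {0..N}"
    define B where "B j = {j * k + r ..< j * k + r + k}" for j
    \<comment> \<open>Writes the shifted \<open>G\<close> as a function of its block alone. The
      filler digit 0 is legal, and by \<open>dep\<close> it does not change the value.\<close>
    define Y where "Y j v = G (\<lambda>i. if i < l then v (j * k + r + i) else 0)" for j v
    have "P.indep_vars (\<lambda>j. Pi\<^sub>M (B j) ?U) (\<lambda>j b. restrict (\<lambda>i. b i) (B j)) UNIV"
    proof (rule P.indep_vars_restrict[OF indep_digits])
      show "disjoint_family_on B UNIV"
      proof (unfold disjoint_family_on_def, intro ballI impI)
        fix i j :: nat
        assume "i \<noteq> j"
        have "(x - r) div k = j" if "x \<in> B j" for x j
          using that k(1) unfolding B_def by (intro div_nat_eqI) (auto simp: algebra_simps)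
        then show "B i \<inter> B j = {}"
          using \<open>i \<noteq> j\<close> by blast
      qed
    qed auto
    then have "P.indep_vars (\<lambda>_. borel) (\<lambda>j b. Y j (restrict (\<lambda>i. b i) (B j))) UNIV"
    proof (rule P.indep_vars_compose2[where Y = Y])
      fix j
      have "(\<lambda>v i. if i < l then v (j * k + r + i) else 0) \<in> measurable (Pi\<^sub>M (B j) ?U) P"
        unfolding P_eq
      proof (rule measurable_PiM_single')
        fix i
        show "(\<lambda>v. if i < l then v (j * k + r + i) else 0) \<in> measurable (Pi\<^sub>M (B j) ?U) (uniform_count_measure {0..N})"
        proof (cases "i < l")
          case True
          then show ?thesis
            using k(2) by (auto simp: B_def intro!: measurable_component_singleton)
        qed (auto simp: space_uniform_count_measure)
      next
        show "(\<lambda>v i. if i < l then v (j * k + r + i) else 0)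
            \<in> space (Pi\<^sub>M (B j) ?U) \<rightarrow> (\<Pi>\<^sub>E i\<in>UNIV. space (uniform_count_measure {0..N}))"
          using k(2) by (auto simp: B_def space_uniform_count_measure space_PiM PiE_iff)
      qed
      from measurable_compose[OF this meas]
      show "Y j \<in> borel_measurable (Pi\<^sub>M (B j) ?U)"
        unfolding Y_def .
    qed
    moreover have "Y j (restrict (\<lambda>i. b i) (B j)) = G (seq_drop (j * k + r) b)" for j b
      unfolding Y_def by (rule dep) (use k in \<open>auto simp: B_def seq_drop_apply ac_simps\<close>)
    ultimately show "P.indep_vars (\<lambda>_. borel) (\<lambda>j b. G (seq_drop (j * k + r) b)) UNIV"
      by simp
  next
    fix j b assume "b \<in> space P"
    then show "G (seq_drop (j * k + r) b) \<in> {0..1}"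
      by (intro range digit_seqs_drop) (simp add: space_P)
  next
    fix j
    show "P.expectation (\<lambda>b. G (seq_drop (j * k + r) b)) = P.expectation G"
      by (subst integral_distr[symmetric, OF measurable_seq_drop meas]) (simp add: distr_seq_drop)
  qed
  then have "AE b in P. \<forall>r. (\<lambda>n. (\<Sum>j<n. G (seq_drop (j * k + r) b)) / n) \<longlonglongrightarrow> P.expectation G"
    by (simp add: AE_all_countable)
  then show ?thesis
    using AE_space
  proof eventually_elim
    case (elim b)
    define f where "f i = G (seq_drop i b)" for i
    \<comment> \<open>The mean of the \<open>k\<close> class averages is the full average over the
      first \<open>q * k\<close> indices.\<close>
    have "(\<lambda>q. (\<Sum>r<k. (\<Sum>j<q. f (j * k + r)) / q) / k) \<longlonglongrightarrow> (\<Sum>r<k. P.expectation G) / k"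
      unfolding f_def using elim(1) k(1) by (intro tendsto_intros) auto
    moreover have "(\<Sum>r<k. (\<Sum>j<q. f (j * k + r)) / q) / k = (\<Sum>i<q * k. f i) / (q * k)" for q
    proof -
      have "(\<Sum>i<q * k. f i) = (\<Sum>j<q. \<Sum>i=j * k..<j * k + k. f i)"
        by (rule sum.nat_group[symmetric])
      also have "\<dots> = (\<Sum>j<q. \<Sum>r<k. f (j * k + r))"
      proof (rule sum.cong[OF refl])
        fix j
        show "(\<Sum>i=j * k..<j * k + k. f i) = (\<Sum>r<k. f (j * k + r))"
          by (rule sum.reindex_bij_witness[of _ "\<lambda>r. j * k + r" "\<lambda>i. i - j * k"]) auto
      qed
      also have "\<dots> = (\<Sum>r<k. \<Sum>j<q. f (j * k + r))"
        by (rule sum.swap)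
      finally show ?thesis
        by (simp add: sum_divide_distrib)
    qed
    ultimately have "(\<lambda>q. (\<Sum>i<q * k. f i) / (q * k)) \<longlonglongrightarrow> P.expectation G"
      using k(1) by simp
    then show ?case
      using average_along_multiples[OF k(1), of f] range digit_seqs_drop elim(2)
      by (auto simp: f_def space_P)
  qed
qed

end

subsection \<open>Frequency of the visits to \<open>S\<close>\<close>

context multinacci
begin

lemma borel_F [measurable]: "F \<beta> \<in> sets borel"
  by (intro borel_closed finite_imp_closed F_finite)

lemma prob_val_eq_step:
  "P.prob {b \<in> space P. val b = c} = (\<Sum>d\<le>N. P.prob {b \<in> space P. val b = T \<beta> d c}) / (N + 1)"
proof -
  have "P.prob {b \<in> space P. val b = c} = (\<Sum>d\<le>N. P.prob {b \<in> space P. b 0 = d \<and> val b = c})"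
    by (rule measure_split_first_digit) measurable
  also have "\<dots> = (\<Sum>d\<le>N. P.prob {b \<in> space P. val b = T \<beta> d c} / (N + 1))"
  proof (rule sum.cong[OF refl])
    fix d assume "d \<in> {..N}"
    have "val b = c \<longleftrightarrow> val (b \<circ> Suc) = T \<beta> d c" if "b \<in> space P" "b 0 = d" for b
      using that T_val[of b] beta_gt_1 by (auto simp: space_P T_def)
    then have "{b \<in> space P. b 0 = d \<and> val b = c} = {b \<in> space P. b 0 = d \<and> val (b \<circ> Suc) = T \<beta> d c}"
      by auto
    then show "P.prob {b \<in> space P. b 0 = d \<and> val b = c} = P.prob {b \<in> space P. val b = T \<beta> d c} / (N + 1)"
      using \<open>d \<in> {..N}\<close> measure_first_digit[of d "\<lambda>b. val b = T \<beta> d c"] by simp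
  qed
  finally show ?thesis
    by (simp add: sum_divide_distrib)
qed

text \<open>Every point has a word \<open>d d\<close> of digits leading out of \<open>I \<beta>\<close>, so each pair of steps loses a
  fixed proportion of the mass of an atom.\<close>

lemma prob_val_eq: "P.prob {b \<in> space P. val b = c} = 0"
proof -
  define q where "q c = P.prob {b \<in> space P. val b = c}" for c
  \<comment> \<open>The probability that the first two digits are not one particular word.\<close>
  define \<theta> where "\<theta> = 1 - 1 / (real N + 1)\<^sup>2"
  have \<theta>: "0 \<le> \<theta>" "\<theta> < 1"
    by (auto simp: \<theta>_def)
  have q_step: "q c = (\<Sum>d\<le>N. q (T \<beta> d c)) / (N + 1)" for c
    unfolding q_def by (rule prob_val_eq_step)
  have outside: "q c = 0" if "c \<notin> I \<beta>" for c
  proof -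
    have "{b \<in> space P. val b = c} = {}"
      using that val_mem_I by (auto simp: space_P)
    then show ?thesis
      by (simp only: q_def measure_empty)
  qed
  have omit: "q c \<le> (q (T \<beta> d c) + N * B) / (N + 1)" if "d \<le> N" "\<And>c. q c \<le> B" for c d and B :: real
  proof -
    have "(\<Sum>d\<le>N. q (T \<beta> d c)) = q (T \<beta> d c) + (\<Sum>d\<in>{..N} - {d}. q (T \<beta> d c))"
      using that(1) by (subst sum.remove[of _ d]) auto
    also have "(\<Sum>d\<in>{..N} - {d}. q (T \<beta> d c)) \<le> (\<Sum>d\<in>{..N} - {d}. B)"
      by (intro sum_mono that(2))
    also have "\<dots> = N * B"
      using that(1) by simp
    finally show ?thesis
      by (simp add: q_step[of c] divide_right_mono)
  qed
  have "q c \<le> \<theta> ^ j" for j c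
  proof (induction j arbitrary: c)
    case 0
    then show ?case by (simp add: q_def)
  next
    case (Suc j)
    \<comment> \<open>In the right half of \<open>I \<beta>\<close>, two digits 0 multiply
      \<open>c\<close> by \<open>\<beta>\<^sup>2 > 2\<close> and push it beyond \<open>R\<close>;
      the left half is its mirror image with digits \<open>N\<close>.\<close>
    define d where "d = (if R / 2 \<le> c then 0 else N)"
    have 2: "2 < \<beta>\<^sup>2"
    proof -
      have "1 * \<beta> \<le> N * \<beta>"
        by (rule mult_right_mono) (use beta_gt_1 N_ge_1 in auto)
      then show ?thesis
        using beta_sq beta_gt_1 by linarith
    qed
    have d: "d \<le> N" "T \<beta> d (T \<beta> d c) \<notin> I \<beta>"
    proof -
      show "d \<le> N" by (simp add: d_def)
      show "T \<beta> d (T \<beta> d c) \<notin> I \<beta>"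
      proof (cases "R / 2 \<le> c")
        case True
        then have "0 < c" "R \<le> 2 * c"
          using R_gt_1 by auto
        then have "R < \<beta>\<^sup>2 * c"
          using mult_strict_right_mono[OF 2, of c] by linarith
        then show ?thesis
          using True by (simp add: d_def T_def mem_I power2_eq_square)
      next
        case False
        then have "0 < R - c" "R < 2 * (R - c)"
          using R_gt_1 by auto
        then have "R < \<beta>\<^sup>2 * (R - c)"
          using mult_strict_right_mono[OF 2, of "R - c"] by linarith
        moreover have "T \<beta> N (T \<beta> N c) = R - \<beta>\<^sup>2 * (R - c)"
          using T_reflect[of N "R - c"] T_reflect[of N "T \<beta> 0 (R - c)"] T_reflect[of N "\<beta> * (R - c)"]
          by (simp add: T_def power2_eq_square)
        ultimately show ?thesis
          using False by (simp add: d_def mem_I)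
      qed
    qed
    have "q (T \<beta> d c) \<le> N * \<theta> ^ j / (N + 1)"
      using omit[OF d(1) Suc, of "T \<beta> d c"] outside[OF d(2)] by simp
    then have "q c \<le> (N * \<theta> ^ j / (N + 1) + N * \<theta> ^ j) / (N + 1)"
      using omit[OF d(1) Suc, of c] by (smt (verit) divide_right_mono of_nat_0_le_iff)
    also have "\<dots> = \<theta> ^ j * (N / (N + 1)\<^sup>2 + N / (N + 1))"
      by (simp add: add_divide_distrib power2_eq_square algebra_simps)
    also have "N / (N + 1)\<^sup>2 + N / (N + 1) = \<theta>"
    proof -
      define n where "n = real N + 1"
      have n: "n > 0" "real (N + 1) = n" "real N = n - 1"
        by (simp_all add: n_def)
      have "(n - 1) / n = (n - 1) * n / n\<^sup>2"
        using n(1) by (simp add: power2_eq_square)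
      then have "(n - 1) / n\<^sup>2 + (n - 1) / n = (n\<^sup>2 - 1) / n\<^sup>2"
        by (simp add: add_divide_distrib[symmetric] algebra_simps power2_eq_square)
      then show ?thesis
        using n(1) by (simp add: \<theta>_def n(3) diff_divide_distrib)
    qed
    finally show ?case
      by (simp add: mult.commute)
  qed
  then have "q c \<le> 0"
    using \<theta> by (intro LIMSEQ_le_const[OF LIMSEQ_realpow_zero[of \<theta>]]) auto
  then show ?thesis
    by (simp add: q_def measure_le_0_iff)
qed

lemma AE_val_notin_F: "AE b in P. \<forall>n. val (seq_drop n b) \<notin> F \<beta>"
proof -
  have 1: "AE b in P. val b \<notin> F \<beta>"
  proof -
    have "AE b in P. val b \<noteq> c" for c
    proof -
      have "{b \<in> space P. val b = c} \<in> P.events"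
        by measurable
      then have "AE b in P. b \<notin> {b \<in> space P. val b = c}"
        using prob_val_eq[of c] P.prob_eq_0 by blast
      then show ?thesis
        using AE_space by eventually_elim auto
    qed
    then have "AE b in P. \<forall>c\<in>F \<beta>. val b \<noteq> c"
      using F_finite by (simp add: AE_finite_all)
    then show ?thesis
      by eventually_elim auto
  qed
  have "AE b in P. val (seq_drop n b) \<notin> F \<beta>" for n
  proof -
    have "AE b in distr P P (seq_drop n). val b \<notin> F \<beta>"
      using 1 by (simp only: distr_seq_drop)
    then show ?thesis
      by (rule AE_distrD[OF measurable_seq_drop])
  qed
  then show ?thesis
    by (simp add: AE_all_countable)
qed

definition val_upto :: "nat \<Rightarrow> (nat \<Rightarrow> nat) \<Rightarrow> real" where
  "val_upto l b = (\<Sum>i<l. b i / \<beta> ^ Suc i)"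

lemma measurable_val_upto [measurable]: "val_upto l \<in> borel_measurable P"
  unfolding val_upto_def by measurable

lemma val_eq_val_upto: "b \<in> digit_seqs \<Longrightarrow> val b = val_upto l b + val (seq_drop l b) / \<beta> ^ l"
proof (induction l arbitrary: b)
  case (Suc l)
  have "val b = val_upto l b + val (seq_drop l b) / \<beta> ^ l"
    by (rule Suc.IH[OF Suc.prems])
  also have "val (seq_drop l b) = (b l + val (seq_drop (Suc l) b)) / \<beta>"
    using T_val[OF digit_seqs_drop[OF Suc.prems, of l]] beta_gt_1
    by (simp add: T_def seq_drop_apply seq_drop_Suc' field_simps)
  finally show ?case
    using beta_gt_1 by (simp add: val_upto_def add_divide_distrib)
qed (simp add: val_upto_def)

lemma val_upto_bounds:
  assumes "b \<in> digit_seqs"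
  shows "val_upto l b \<le> val b" "val b \<le> val_upto l b + R / \<beta> ^ l"
  using val_eq_val_upto[OF assms, of l] val_mem_I[OF digit_seqs_drop[OF assms, of l]] beta_gt_1
  by (auto simp: mem_I divide_right_mono)

text \<open>Off \<open>F \<beta>\<close>, membership in \<open>S \<beta>\<close> depends only on the
  cell, so a change of membership needs a cut point in between.\<close>

lemma S_boundary:
  assumes "x \<in> S \<beta> \<longleftrightarrow> y \<notin> S \<beta>" "x \<le> y"
  shows "\<exists>c\<in>F \<beta>. x \<le> c \<and> c \<le> y"
proof (rule ccontr)
  assume *: "\<not> (\<exists>c\<in>F \<beta>. x \<le> c \<and> c \<le> y)"
  then have "same_cell x y" "x \<notin> F \<beta>" "y \<notin> F \<beta>"
    using assms(2) by (force simp: same_cell_def)+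
  then show False
    using same_cell_S assms(1) by blast
qed

lemma visit_frequency:
  "AE b in P. (\<lambda>n. card {i. i < n \<and> i \<in> visits b} / n) \<longlonglongrightarrow> P.prob {b \<in> space P. val b \<in> S \<beta>}"
proof -
  define f where "f b = indicat_real (S \<beta>) (val b)" for b
  define g where "g l b = indicat_real (S \<beta>) (val_upto l b)" for l b
  \<comment> \<open>The error indicator \<open>h l\<close> is built to depend on \<open>l\<close>
    digits only, like \<open>g l\<close>, and to dominate the difference of \<open>f\<close> and
    \<open>g l\<close>: truncation changes the value by at most \<open>R / \<beta> ^ l\<close>, so
    the two can differ only that close to a cut point.\<close>
  define near where "near r x \<longleftrightarrow> (\<exists>c\<in>F \<beta>. \<bar>x - c\<bar> \<le> r)" for r x :: real
  define h where "h l b = indicat_real {x. near (R / \<beta> ^ l) x} (val_upto l b)" for l b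
  have [measurable]: "Measurable.pred borel (near r)" for r
    unfolding near_def using F_finite by measurable
  have [measurable]: "f \<in> borel_measurable P" "g l \<in> borel_measurable P" "h l \<in> borel_measurable P" for l
    unfolding f_def[abs_def] g_def[abs_def] h_def[abs_def] by measurable
  have val_upto_cong: "val_upto l b = val_upto l b'" if "\<And>i. i < l \<Longrightarrow> b i = b' i" for l b b'
    unfolding val_upto_def using that by simp
  have approx: "\<bar>f b - g l b\<bar> \<le> h l b" if b: "b \<in> digit_seqs" for l b
  proof (cases "val b \<in> S \<beta> \<longleftrightarrow> val_upto l b \<in> S \<beta>")
    case False
    then obtain c where "c \<in> F \<beta>" "val_upto l b \<le> c" "c \<le> val b"
      using S_boundary[of "val_upto l b" "val b"] val_upto_bounds[OF b, of l] by blast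
    then have "near (R / \<beta> ^ l) (val_upto l b)"
      using val_upto_bounds[OF b, of l] by (force simp: near_def)
    then show ?thesis
      by (simp add: h_def f_def g_def indicator_def)
  qed (auto simp: f_def g_def h_def indicator_def)
  have int: "integrable P f" "integrable P (g l)" "integrable P (h l)" for l
    by (rule P.integrable_const_bound[where B = 1]; simp add: f_def g_def h_def)+
  \<comment> \<open>The radius is doubled because \<open>h l\<close> tests the truncated value,
    itself within \<open>R / \<beta> ^ l\<close> of \<open>val b\<close>. These neighbourhoods
    shrink to the finite set \<open>F \<beta>\<close>, which has mass 0.\<close>
  have lim: "(\<lambda>l. P.prob {b \<in> space P. near (2 * (R / \<beta> ^ l)) (val b)}) \<longlonglongrightarrow>
      P.prob (\<Inter>l. {b \<in> space P. near (2 * (R / \<beta> ^ l)) (val b)})"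
  proof (rule P.finite_Lim_measure_decseq)
    show "decseq (\<lambda>l. {b \<in> space P. near (2 * (R / \<beta> ^ l)) (val b)})"
    proof (rule decseq_SucI)
      fix l
      have "R / \<beta> ^ Suc l \<le> R / \<beta> ^ l"
        using R_gt_1 beta_gt_1 by (intro divide_left_mono) auto
      then show "{b \<in> space P. near (2 * (R / \<beta> ^ Suc l)) (val b)} \<subseteq> {b \<in> space P. near (2 * (R / \<beta> ^ l)) (val b)}"
        by (force simp: near_def)
    qed
  qed auto
  have sub: "(\<Inter>l. {b \<in> space P. near (2 * (R / \<beta> ^ l)) (val b)}) \<subseteq> {b \<in> space P. val b \<in> F \<beta>}"
  proof
    fix b assume b: "b \<in> (\<Inter>l. {b \<in> space P. near (2 * (R / \<beta> ^ l)) (val b)})"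
    define m where "m = Min ((\<lambda>c. \<bar>val b - c\<bar>) ` F \<beta>)"
    have ne: "F \<beta> \<noteq> {}" using special_in_F by auto
    have "m \<le> 2 * (R / \<beta> ^ l)" for l
    proof -
      obtain c where c: "c \<in> F \<beta>" "\<bar>val b - c\<bar> \<le> 2 * (R / \<beta> ^ l)"
        using b by (auto simp: near_def)
      have "m \<le> \<bar>val b - c\<bar>"
        unfolding m_def using F_finite c(1) by (intro Min_le) auto
      then show ?thesis
        using c(2) by simp
    qed
    moreover have "(\<lambda>l. 2 * (R * (1 / \<beta>) ^ l)) \<longlonglongrightarrow> 0"
      using beta_gt_1 by (intro tendsto_mult_right_zero LIMSEQ_realpow_zero) auto
    ultimately have "m \<le> 0"
      by (intro LIMSEQ_le_const[of _ 0]) (auto simp: power_divide)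
    moreover have "m \<in> (\<lambda>c. \<bar>val b - c\<bar>) ` F \<beta>"
      unfolding m_def using F_finite ne by (intro Min_in) auto
    ultimately show "b \<in> {b \<in> space P. val b \<in> F \<beta>}"
      using b by auto
  qed
  have F0: "P.prob {b \<in> space P. val b \<in> F \<beta>} = 0"
  proof -
    have "AE b in P. val b \<notin> F \<beta>"
      using AE_val_notin_F by eventually_elim (metis seq_drop_0)
    moreover have "{b \<in> space P. val b \<in> F \<beta>} \<in> P.events"
      by measurable
    ultimately show ?thesis
      by (subst P.prob_eq_0) auto
  qed
  have near0: "(\<lambda>l. P.prob {b \<in> space P. near (2 * (R / \<beta> ^ l)) (val b)}) \<longlonglongrightarrow> 0"
  proof -
    have "P.prob (\<Inter>l. {b \<in> space P. near (2 * (R / \<beta> ^ l)) (val b)}) \<le> 0"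
      unfolding F0[symmetric] by (rule P.finite_measure_mono[OF sub]) measurable
    then show ?thesis
      using lim by (simp add: measure_le_0_iff)
  qed
  have h0: "(\<lambda>l. P.expectation (h l)) \<longlonglongrightarrow> 0"
  proof (rule tendsto_sandwich[OF _ _ tendsto_const near0])
    show "\<forall>\<^sub>F l in sequentially. 0 \<le> P.expectation (h l)"
      by (auto simp: h_def)
    have "P.expectation (h l) \<le> P.prob {b \<in> space P. near (2 * (R / \<beta> ^ l)) (val b)}" for l
    proof -
      have "P.expectation (h l) \<le> P.expectation (indicat_real {b \<in> space P. near (2 * (R / \<beta> ^ l)) (val b)})"
      proof (rule integral_mono[OF int(3)])
        fix b assume "b \<in> space P"
        then show "h l b \<le> indicat_real {b \<in> space P. near (2 * (R / \<beta> ^ l)) (val b)} b"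
          using val_upto_bounds[of b l] by (force simp: h_def near_def space_P indicator_def)
      next
        show "integrable P (indicat_real {b \<in> space P. near (2 * (R / \<beta> ^ l)) (val b)})"
          by (rule P.integrable_const_bound[where B = 1]) (simp, measurable)
      qed
      then show ?thesis
        by simp
    qed
    then show "\<forall>\<^sub>F l in sequentially. P.expectation (h l) \<le> P.prob {b \<in> space P. near (2 * (R / \<beta> ^ l)) (val b)}"
      by simp
  qed
  have "AE b in P. \<forall>l. (\<lambda>n. (\<Sum>i<n. g l (seq_drop i b)) / n) \<longlonglongrightarrow> P.expectation (g l)"
    unfolding AE_all_countable
  proof
    fix l
    show "AE b in P. (\<lambda>n. (\<Sum>i<n. g l (seq_drop i b)) / n) \<longlonglongrightarrow> P.expectation (g l)"
    proof (rule average_cylinder_function[where l = l])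
      fix b b' :: "nat \<Rightarrow> nat" assume "\<And>i. i < l \<Longrightarrow> b i = b' i"
      then have "val_upto l b = val_upto l b'"
        by (rule val_upto_cong)
      then show "g l b = g l b'"
        by (simp only: g_def)
    qed (auto simp: g_def)
  qed
  moreover have "AE b in P. \<forall>l. (\<lambda>n. (\<Sum>i<n. h l (seq_drop i b)) / n) \<longlonglongrightarrow> P.expectation (h l)"
    unfolding AE_all_countable
  proof
    fix l
    show "AE b in P. (\<lambda>n. (\<Sum>i<n. h l (seq_drop i b)) / n) \<longlonglongrightarrow> P.expectation (h l)"
    proof (rule average_cylinder_function[where l = l])
      fix b b' :: "nat \<Rightarrow> nat" assume "\<And>i. i < l \<Longrightarrow> b i = b' i"
      then have "val_upto l b = val_upto l b'"
        by (rule val_upto_cong)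
      then show "h l b = h l b'"
        by (simp only: h_def)
    qed (auto simp: h_def)
  qed
  ultimately show ?thesis
    using AE_space
  proof eventually_elim
    case (elim b)
    have b: "b \<in> digit_seqs"
      using elim(3) by (simp add: space_P)
    have "(\<lambda>n. (\<Sum>i<n. f (seq_drop i b)) / n) \<longlonglongrightarrow> P.expectation f"
    proof (rule tendstoI)
      fix e :: real assume "e > 0"
      then have "\<forall>\<^sub>F l in sequentially. P.expectation (h l) < e / 4"
        by (intro order_tendstoD(2)[OF h0]) simp
      then obtain l where l: "P.expectation (h l) < e / 4"
        by (meson eventually_happens sequentially_bot)
      have fg: "\<bar>P.expectation f - P.expectation (g l)\<bar> \<le> P.expectation (h l)"
      proof -
        have "\<bar>P.expectation f - P.expectation (g l)\<bar> = \<bar>P.expectation (\<lambda>b. f b - g l b)\<bar>"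
          using int by simp
        also have "\<dots> \<le> P.expectation (\<lambda>b. \<bar>f b - g l b\<bar>)"
          by (rule integral_abs_bound)
        also have "\<dots> \<le> P.expectation (h l)"
          using int approx by (intro integral_mono) (auto simp: space_P)
        finally show ?thesis .
      qed
      have avg: "\<bar>(\<Sum>i<n. f (seq_drop i b)) / n - (\<Sum>i<n. g l (seq_drop i b)) / n\<bar> \<le> (\<Sum>i<n. h l (seq_drop i b)) / n" for n :: nat
      proof -
        have "\<bar>(\<Sum>i<n. f (seq_drop i b) - g l (seq_drop i b))\<bar> \<le> (\<Sum>i<n. h l (seq_drop i b))"
          using approx digit_seqs_drop[OF b] by (intro order_trans[OF sum_abs] sum_mono) auto
        then have "\<bar>(\<Sum>i<n. f (seq_drop i b) - g l (seq_drop i b)) / n\<bar> \<le> (\<Sum>i<n. h l (seq_drop i b)) / n"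
          by (simp add: divide_right_mono)
        then show ?thesis
          by (simp add: sum_subtractf diff_divide_distrib)
      qed
      have "\<forall>\<^sub>F n in sequentially. dist ((\<Sum>i<n. g l (seq_drop i b)) / n) (P.expectation (g l)) < e / 4"
        using elim(1) \<open>e > 0\<close> by (intro tendstoD) auto
      moreover have "\<forall>\<^sub>F n in sequentially. (\<Sum>i<n. h l (seq_drop i b)) / n < e / 4"
        using elim(2) l by (intro order_tendstoD(2)[of _ "P.expectation (h l)"]) auto
      ultimately show "\<forall>\<^sub>F n in sequentially. dist ((\<Sum>i<n. f (seq_drop i b)) / n) (P.expectation f) < e"
      proof eventually_elim
        case (elim n)
        show ?case
          using elim avg[of n] fg l unfolding dist_real_def by linarith
      qed
    qed
    moreover have "(\<Sum>i<n. f (seq_drop i b)) = card {i. i < n \<and> i \<in> visits b}" for n :: nat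
    proof -
      have "(\<Sum>i<n. f (seq_drop i b)) = (\<Sum>i<n. (of_bool (i \<in> visits b) :: real))"
        by (intro sum.cong) (auto simp: f_def visits_def indicator_def)
      also have "\<dots> = card ({..<n} \<inter> {i. i \<in> visits b})"
        using finite_lessThan[of n] by (simp add: sum_of_bool_eq)
      finally show ?thesis
        by (simp add: Int_def)
    qed
    moreover have "P.expectation f = P.prob {b \<in> space P. val b \<in> S \<beta>}"
    proof -
      have "P.expectation f = P.expectation (indicat_real {b \<in> space P. val b \<in> S \<beta>})"
        by (intro Bochner_Integration.integral_cong) (auto simp: f_def indicator_def)
      then show ?thesis
        by simp
    qed
    ultimately show ?case
      by simp
  qed
qed

end

subsection \<open>The measure \<open>nu\<close>\<close>

context multinacci
begin

text \<open>A leading digit 0 divides the value by \<open>\<beta>\<close> and costs a factor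
  \<open>N + 1\<close>; after \<open>l\<close> of them with \<open>R \<le> \<beta> ^ l * r\<close>
  every tail is allowed.\<close>

lemma prob_val_small: "r > 0 \<Longrightarrow> P.prob {b \<in> space P. val b \<le> r} > 0"
proof -
  assume r: "r > 0"
  have step: "P.prob {b \<in> space P. val b \<le> \<beta> * r} / (N + 1) \<le> P.prob {b \<in> space P. val b \<le> r}" for r
  proof -
    have "P.prob {b \<in> space P. val b \<le> \<beta> * r} / (N + 1)
        = P.prob {b \<in> space P. b 0 = 0 \<and> val (b \<circ> Suc) \<le> \<beta> * r}"
      by (subst measure_first_digit) auto
    also have "\<dots> \<le> P.prob {b \<in> space P. val b \<le> r}"
    proof (rule P.finite_measure_mono)
      show "{b \<in> space P. b 0 = 0 \<and> val (b \<circ> Suc) \<le> \<beta> * r} \<subseteq> {b \<in> space P. val b \<le> r}"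
      proof
        fix b assume b: "b \<in> {b \<in> space P. b 0 = 0 \<and> val (b \<circ> Suc) \<le> \<beta> * r}"
        then have "val (b \<circ> Suc) = \<beta> * val b"
          using T_val[of b] by (simp add: T_def space_P)
        then show "b \<in> {b \<in> space P. val b \<le> r}"
          using b beta_gt_1 by auto
      qed
    qed measurable
    finally show ?thesis .
  qed
  have iter: "P.prob {b \<in> space P. val b \<le> \<beta> ^ l * r} / (N + 1) ^ l \<le> P.prob {b \<in> space P. val b \<le> r}" for l
  proof (induction l)
    case (Suc l)
    have "P.prob {b \<in> space P. val b \<le> \<beta> ^ Suc l * r} / (N + 1) ^ Suc l
        = P.prob {b \<in> space P. val b \<le> \<beta> * (\<beta> ^ l * r)} / (N + 1) / (N + 1) ^ l"
      by (simp add: mult.assoc distrib_right)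
    also have "\<dots> \<le> P.prob {b \<in> space P. val b \<le> \<beta> ^ l * r} / (N + 1) ^ l"
      by (intro divide_right_mono step) simp
    finally show ?case
      using Suc by linarith
  qed simp
  obtain l where "R / r < \<beta> ^ l"
    using beta_gt_1 real_arch_pow by blast
  then have "R \<le> \<beta> ^ l * r"
    using r by (simp add: field_simps)
  then have "val b \<le> \<beta> ^ l * r" if "b \<in> space P" for b
    using val_mem_I[of b] that by (auto simp: space_P mem_I)
  then have "{b \<in> space P. val b \<le> \<beta> ^ l * r} = space P"
    by auto
  then show ?thesis
    using iter[of l] P.prob_space by (smt (verit) divide_pos_pos of_nat_0_less_iff zero_less_Suc zero_less_power Suc_eq_plus1)
qed

text \<open>A digit 1 followed by a tail of value at most \<open>R - 1\<close> gives a point of the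
  first switch region.\<close>

lemma prob_S_pos: "P.prob {b \<in> space P. val b \<in> S \<beta>} > 0"
proof -
  have "0 < P.prob {b \<in> space P. val b \<le> R - 1} / (N + 1)"
    using prob_val_small[of "R - 1"] R_gt_1 by simp
  also have "\<dots> = P.prob {b \<in> space P. b 0 = 1 \<and> val (b \<circ> Suc) \<le> R - 1}"
    using N_ge_1 by (subst measure_first_digit) auto
  also have "\<dots> \<le> P.prob {b \<in> space P. val b \<in> S \<beta>}"
  proof (rule P.finite_measure_mono)
    show "{b \<in> space P. b 0 = 1 \<and> val (b \<circ> Suc) \<le> R - 1} \<subseteq> {b \<in> space P. val b \<in> S \<beta>}"
    proof
      fix b assume b: "b \<in> {b \<in> space P. b 0 = 1 \<and> val (b \<circ> Suc) \<le> R - 1}"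
      then have "val (b \<circ> Suc) = \<beta> * val b - 1" "0 \<le> val (b \<circ> Suc)"
        using T_val[of b] val_mem_I[OF digit_seqs_Suc, of b] by (auto simp: T_def space_P mem_I)
      then have "val b \<in> S_part \<beta> 1"
        using b by (simp add: mem_S_part)
      then show "b \<in> {b \<in> space P. val b \<in> S \<beta>}"
        using b N_ge_1 by (auto simp: S_def N_def)
    qed
  qed measurable
  finally show ?thesis .
qed

text \<open>On this set of full measure every orbit point lies inside an open cell and all tosses
  are defined; \<open>psi\<close> maps it into \<open>X \<beta>\<close>.\<close>

definition generic_seqs :: "(nat \<Rightarrow> nat) set" where
  "generic_seqs = {b \<in> recurrent_seqs. \<forall>n. val (seq_drop n b) \<notin> F \<beta>}"

lemma generic_recurrent: "b \<in> generic_seqs \<Longrightarrow> b \<in> recurrent_seqs"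
  and generic_digit_seqs: "b \<in> generic_seqs \<Longrightarrow> b \<in> digit_seqs"
  and generic_notin_F: "b \<in> generic_seqs \<Longrightarrow> val (seq_drop n b) \<notin> F \<beta>"
  by (auto simp: generic_seqs_def recurrent_seqs_def)

lemma generic_val_notin_F: "b \<in> generic_seqs \<Longrightarrow> val b \<notin> F \<beta>"
  using generic_notin_F[of b 0] by simp

lemma generic_Suc: "b \<in> generic_seqs \<Longrightarrow> b \<circ> Suc \<in> generic_seqs"
proof -
  assume b: "b \<in> generic_seqs"
  have "val (seq_drop n (b \<circ> Suc)) \<notin> F \<beta>" for n
    using generic_notin_F[OF b, of "Suc n"] unfolding seq_drop_Suc .
  then show ?thesis
    using recurrent_seqs_Suc[OF generic_recurrent[OF b]] by (simp add: generic_seqs_def)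
qed

text \<open>With finitely many visits the frequency would tend to 0, but its almost sure limit is
  positive by \<open>prob_S_pos\<close>.\<close>

lemma AE_recurrent: "AE b in P. b \<in> recurrent_seqs"
  using visit_frequency AE_space
proof eventually_elim
  case (elim b)
  have "infinite (visits b)"
  proof
    assume fin: "finite (visits b)"
    have "(\<lambda>n. card {i. i < n \<and> i \<in> visits b} / n) \<longlonglongrightarrow> 0"
    proof (rule tendsto_sandwich[OF _ _ tendsto_const lim_const_over_n[of "real (card (visits b))"]])
      show "\<forall>\<^sub>F n in sequentially. card {i. i < n \<and> i \<in> visits b} / n \<le> card (visits b) / n"
        using fin by (intro always_eventually allI divide_right_mono of_nat_mono card_mono) auto
    qed auto
    then show False
      using LIMSEQ_unique[OF elim(1)] prob_S_pos by auto
  qed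
  then show ?case
    using elim(2) by (simp add: recurrent_seqs_def space_P)
qed

lemma AE_generic: "AE b in P. b \<in> generic_seqs"
  using AE_recurrent AE_val_notin_F by eventually_elim (simp add: generic_seqs_def)

lemma pred_recurrent [measurable]: "Measurable.pred P (\<lambda>b. b \<in> recurrent_seqs)"
proof -
  have "{b \<in> space P. b \<in> recurrent_seqs} = {b \<in> space P. \<forall>m. \<exists>n. m \<le> n \<and> n \<in> visits b}"
    by (auto simp: recurrent_seqs_def space_P infinite_nat_iff_unbounded_le)
  also have "\<dots> \<in> sets P"
    by measurable
  finally show ?thesis
    by (simp add: pred_def)
qed

text \<open>By \<open>phi_image\<close> the two set functions agree up to the null set of
  nonrecurrent sequences. In particular the one in the definition is countably additive, so
  \<open>measure_of\<close> does not fall back to the zero measure.\<close>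

lemma nu_eq: "nu \<beta> = distr P (Omega_I \<beta>) psi"
proof -
  have "emeasure P (phi \<beta> ` (A \<inter> Z \<beta>)) = emeasure (distr P (Omega_I \<beta>) psi) A"
    if A: "A \<in> sets (Omega_I \<beta>)" for A
  proof -
    have "phi \<beta> ` (A \<inter> Z \<beta>) = {b \<in> space P. b \<in> recurrent_seqs \<and> psi b \<in> A}"
      unfolding phi_image by (auto simp: space_P recurrent_digit_seqs)
    also have "emeasure P \<dots> = emeasure P (psi -` A \<inter> space P)"
    proof (rule emeasure_eq_AE)
      show "AE b in P. b \<in> {b \<in> space P. b \<in> recurrent_seqs \<and> psi b \<in> A} \<longleftrightarrow> b \<in> psi -` A \<inter> space P"
        using AE_recurrent by eventually_elim auto
      show "{b \<in> space P. b \<in> recurrent_seqs \<and> psi b \<in> A} \<in> sets P"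
        using A by measurable
      show "psi -` A \<inter> space P \<in> sets P"
        using A by measurable
    qed
    finally show ?thesis
      using A by (simp add: emeasure_distr)
  qed
  then have "nu \<beta> = measure_of (space (Omega_I \<beta>)) (sets (Omega_I \<beta>)) (emeasure (distr P (Omega_I \<beta>) psi))"
    unfolding nu_def
    by (intro measure_of_eq) (auto simp: sets.sigma_sets_eq sets.sets_into_space dest: sets.sets_into_space)
  also have "\<dots> = distr P (Omega_I \<beta>) psi"
    using measure_of_of_measure[of "distr P (Omega_I \<beta>) psi"] by simp
  finally show ?thesis .
qed

lemma measure_nu: "A \<in> sets (Omega_I \<beta>) \<Longrightarrow> measure (nu \<beta>) A = P.prob {b \<in> space P. psi b \<in> A}"
  by (simp add: nu_eq measure_distr vimage_def Int_def conj_commute)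

lemma measure_mu_S: "measure (mu \<beta>) (S \<beta>) = P.prob {b \<in> space P. val b \<in> S \<beta>}"
proof -
  have S: "S \<beta> \<in> sets (restrict_space borel (I \<beta>))"
    using S_subset_I by (auto simp: sets_restrict_space intro!: image_eqI[of _ _ "S \<beta>"])
  have snd: "snd \<in> measurable (Omega_I \<beta>) (restrict_space borel (I \<beta>))"
    by (simp add: Omega_I_def)
  have "measure (mu \<beta>) (S \<beta>) = measure (nu \<beta>) (snd -` S \<beta> \<inter> space (nu \<beta>))"
    unfolding mu_def by (rule measure_distr[OF _ S]) (simp add: nu_eq snd)
  also have "\<dots> = P.prob {b \<in> space P. psi b \<in> snd -` S \<beta> \<inter> space (nu \<beta>)}"
    using measurable_sets[OF snd S] by (intro measure_nu) (simp add: nu_eq)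
  also have "{b \<in> space P. psi b \<in> snd -` S \<beta> \<inter> space (nu \<beta>)} = {b \<in> space P. val b \<in> S \<beta>}"
    using measurable_space[OF measurable_psi] by (auto simp: nu_eq psi_def)
  finally show ?thesis .
qed

text \<open>The digit reversal permutes the alphabet, hence preserves the uniform measure and,
  coordinatewise, the product.\<close>

lemma distr_complement: "distr P P (\<lambda>b i. N - b i) = P"
proof -
  let ?U = "uniform_count_measure {0..N}"
  have U: "distr P ?U (\<lambda>b. b i) = ?U" for i
    unfolding P_eq by (rule distr_PiM_component) (auto intro: prob_space_uniform_count_measure)
  have meas: "(\<lambda>d. N - d) \<in> measurable ?U ?U"
    by (simp add: measurable_cong_sets[OF sets_uniform_count_measure_count_space sets_uniform_count_measure_count_space])
  have UU: "distr ?U ?U (\<lambda>d. N - d) = ?U"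
  proof (rule measure_eqI)
    fix A assume "A \<in> sets (distr ?U ?U (\<lambda>d. N - d))"
    then have A: "A \<subseteq> {0..N}" "A \<in> sets ?U"
      by (auto simp: sets_uniform_count_measure)
    have "(\<lambda>d. N - d) -` A \<inter> space ?U = (\<lambda>d. N - d) ` A"
      using A(1) by (force simp: space_uniform_count_measure image_iff)
    moreover have "inj_on (\<lambda>d. N - d) A"
      using A(1) by (intro inj_onI) (metis atLeastAtMost_iff diff_diff_cancel subsetD)
    ultimately have "card ((\<lambda>d. N - d) -` A \<inter> space ?U) = card A"
      by (simp add: card_image)
    moreover have "(\<lambda>d. N - d) -` A \<inter> space ?U \<subseteq> {0..N}"
      by (auto simp: space_uniform_count_measure)
    ultimately show "emeasure (distr ?U ?U (\<lambda>d. N - d)) A = emeasure ?U A"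
      using A meas by (simp add: emeasure_distr emeasure_uniform_count_measure)
  qed simp
  have "P.indep_vars (\<lambda>_. ?U) (\<lambda>i b. N - b i) (UNIV :: nat set)"
    by (rule P.indep_vars_compose2[OF indep_digits meas])
  moreover have "P.random_variable ?U (\<lambda>b. N - b i)" for i
    by (rule measurable_compose[OF measurable_digit_U meas])
  ultimately have "distr P (\<Pi>\<^sub>M i\<in>UNIV. ?U) (\<lambda>b. \<lambda>i\<in>UNIV. N - b i) = (\<Pi>\<^sub>M i\<in>UNIV. distr P ?U (\<lambda>b. N - b i))"
    by (subst (asm) P.indep_vars_iff_distr_eq_PiM') auto
  moreover have "distr P ?U (\<lambda>b. N - b i) = ?U" for i
    using distr_distr[OF meas measurable_digit_U, of i] by (simp add: U UU comp_def)
  ultimately show ?thesis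
    by (simp add: P_eq[symmetric] restrict_def)
qed

lemma val_complement:
  assumes "b \<in> digit_seqs"
  shows "val (\<lambda>i. N - b i) = R - val b"
proof -
  have "(\<lambda>i. N / \<beta> ^ Suc i - b i / \<beta> ^ Suc i) sums (R - val b)"
    unfolding val_def by (intro sums_diff sums_R summable_sums summable_digits assms)
  moreover have "N / \<beta> ^ Suc i - b i / \<beta> ^ Suc i = real (N - b i) / \<beta> ^ Suc i" for i
    using digit_seqs_le[OF assms, of i] by (simp add: diff_divide_distrib)
  ultimately show ?thesis
    by (simp add: val_def sums_iff)
qed

lemma prob_val_symmetric: "P.prob {b \<in> space P. 1 \<le> val b} = P.prob {b \<in> space P. val b \<le> R - 1}"
proof -
  have meas: "(\<lambda>b i. N - b i) \<in> measurable P P"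
  proof -
    have "(\<lambda>d. N - d) \<in> measurable (uniform_count_measure {0..N}) (uniform_count_measure {0..N})"
      by (simp add: measurable_cong_sets[OF sets_uniform_count_measure_count_space sets_uniform_count_measure_count_space])
    from measurable_compose[OF measurable_digit_U this] show ?thesis
      by (subst (2) P_eq, intro measurable_PiM_single') (auto simp: space_uniform_count_measure)
  qed
  have "P.prob {b \<in> space P. 1 \<le> val b} = measure (distr P P (\<lambda>b i. N - b i)) {b \<in> space P. 1 \<le> val b}"
    by (simp only: distr_complement)
  also have "\<dots> = P.prob ((\<lambda>b i. N - b i) -` {b \<in> space P. 1 \<le> val b} \<inter> space P)"
    by (rule measure_distr[OF meas]) measurable
  also have "(\<lambda>b i. N - b i) -` {b \<in> space P. 1 \<le> val b} \<inter> space P = {b \<in> space P. val b \<le> R - 1}"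
    using val_complement by (auto simp: space_P digit_seqs_def)
  finally show ?thesis .
qed

end

subsection \<open>The measure of cylinders\<close>

context multinacci
begin

abbreviation Pr :: "((nat \<Rightarrow> nat) \<Rightarrow> bool) \<Rightarrow> real" where
  "Pr Q \<equiv> P.prob {b \<in> space P. Q b}"

lemma Pr_cong:
  assumes "\<And>b. b \<in> generic_seqs \<Longrightarrow> Q b \<longleftrightarrow> Q' b" "Measurable.pred P Q" "Measurable.pred P Q'"
  shows "Pr Q = Pr Q'"
proof (rule P.finite_measure_eq_AE)
  show "AE b in P. b \<in> {b \<in> space P. Q b} \<longleftrightarrow> b \<in> {b \<in> space P. Q' b}"
    using AE_generic by eventually_elim (use assms(1) in auto)
  show "{b \<in> space P. Q b} \<in> P.events" "{b \<in> space P. Q' b} \<in> P.events"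
    using assms(2,3) unfolding pred_def by this+
qed

text \<open>Unions of cells of \<open>I \<beta>\<close>, up to points of \<open>F \<beta>\<close>. A
  single cell would not do for the inductions below, because its image under a branch is in general
  a union of several.\<close>

definition saturated :: "real set \<Rightarrow> bool" where
  "saturated A \<longleftrightarrow> (\<forall>x\<in>A. \<forall>y. x \<in> I \<beta> \<longrightarrow> x \<notin> F \<beta> \<longrightarrow> y \<notin> F \<beta> \<longrightarrow> same_cell x y \<longrightarrow> y \<in> A)"

text \<open>This is the forward image of \<open>A\<close> under the branch
  \<open>T \<beta> d\<close>, cut down to \<open>I \<beta>\<close>; writing it through the inverse
  branch makes it a preimage, hence measurable.\<close>

definition preim :: "nat \<Rightarrow> real set \<Rightarrow> real set" where
  "preim d A = {y \<in> I \<beta>. (y + d) / \<beta> \<in> A}"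

lemma saturatedD: "saturated A \<Longrightarrow> x \<in> A \<Longrightarrow> x \<in> I \<beta> \<Longrightarrow> x \<notin> F \<beta> \<Longrightarrow> y \<notin> F \<beta> \<Longrightarrow> same_cell x y \<Longrightarrow> y \<in> A"
  by (auto simp: saturated_def)

lemma same_cell_mem_I: "same_cell x y \<Longrightarrow> x \<in> I \<beta> \<Longrightarrow> x \<notin> F \<beta> \<Longrightarrow> y \<in> I \<beta>"
proof -
  assume *: "same_cell x y" "x \<in> I \<beta>" "x \<notin> F \<beta>"
  then have "0 < x" "x < R"
    using special_in_F(1,2) by (auto simp: mem_I less_le)
  then have "0 < y" "\<not> R < y"
    using *(1) special_in_F(1,2) unfolding same_cell_def by auto
  then show ?thesis
    by (simp add: mem_I)
qed

lemma saturated_cell: "saturated {x. same_cell x y}"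
  unfolding saturated_def using same_cell_sym same_cell_trans by blast

text \<open>The inverse branch sends points of one cell into one cell by
  \<open>same_cell_preimage\<close>, and points outside \<open>F \<beta>\<close> to points outside
  \<open>F \<beta>\<close> by \<open>F_invariant\<close>.\<close>

lemma saturated_preim:
  assumes "saturated A" "d \<le> N"
  shows "saturated (preim d A)"
  unfolding saturated_def
proof (intro ballI allI impI)
  fix x y assume x: "x \<in> preim d A" "x \<in> I \<beta>" "x \<notin> F \<beta>" "y \<notin> F \<beta>" "same_cell x y"
  have y: "y \<in> I \<beta>"
    using same_cell_mem_I x by blast
  have T: "T \<beta> d ((z + d) / \<beta>) = z" for z :: real
    using beta_gt_1 by (simp add: T_def)
  have notin: "(z + d) / \<beta> \<notin> F \<beta>" if "z \<in> I \<beta>" "z \<notin> F \<beta>" for z :: real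
    using F_invariant[OF _ assms(2), of "(z + d) / \<beta>"] that by (auto simp: T)
  have "same_cell ((x + d) / \<beta>) ((y + d) / \<beta>)"
    using same_cell_preimage[OF assms(2), of "(x + d) / \<beta>" "(y + d) / \<beta>"] x y by (simp add: T)
  moreover have "(x + d) / \<beta> \<in> A"
    using x(1) by (simp add: preim_def)
  moreover have "(x + d) / \<beta> \<in> I \<beta>"
    by (rule T_mem_I_imp[OF assms(2)]) (simp add: T x(2))
  ultimately have "(y + d) / \<beta> \<in> A"
    using saturatedD[OF assms(1) _ _ notin notin] x(2-4) y by blast
  then show "y \<in> preim d A"
    using y by (simp add: preim_def)
qed

text \<open>Covers the digit 0 too: no point of \<open>S \<beta>\<close> belongs to the interval
  that the formula gives for \<open>S_part \<beta> 0\<close>.\<close>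

lemma same_cell_S_part':
  assumes "same_cell x y" "x \<notin> F \<beta>" "y \<notin> F \<beta>" "x \<in> S \<beta>" "d \<le> N"
  shows "x \<in> S_part \<beta> d \<longleftrightarrow> y \<in> S_part \<beta> d"
proof (cases "d = 0")
  case True
  have "z \<notin> S_part \<beta> 0" if "z \<in> S \<beta>" for z
    using that R_less_2 by (auto simp: mem_S mem_S_part)
  then show ?thesis
    using True assms same_cell_S by blast
next
  case False
  then show ?thesis
    using same_cell_S_part[OF assms(1-3)] assms(5) by simp
qed

lemma saturated_S_diff: "saturated A \<Longrightarrow> saturated (A - S \<beta>)"
  using same_cell_S unfolding saturated_def by blast

lemma saturated_S_part:
  assumes "saturated A" "d \<le> N"
  shows "saturated {x \<in> A \<inter> S \<beta>. x \<in> S_part \<beta> d \<longleftrightarrow> v}"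
  unfolding saturated_def
proof (intro ballI allI impI)
  fix x y assume x: "x \<in> {x \<in> A \<inter> S \<beta>. x \<in> S_part \<beta> d \<longleftrightarrow> v}" "x \<in> I \<beta>" "x \<notin> F \<beta>" "y \<notin> F \<beta>" "same_cell x y"
  then show "y \<in> {x \<in> A \<inter> S \<beta>. x \<in> S_part \<beta> d \<longleftrightarrow> v}"
    using saturatedD[OF assms(1), of x y] same_cell_S[of x y] same_cell_S_part'[of x y d] assms(2)
    by blast
qed

lemma borel_I [measurable]: "I \<beta> \<in> sets borel"
  by (simp add: I_def)

lemma borel_preim [measurable (raw)]: "A \<in> sets borel \<Longrightarrow> preim d A \<in> sets borel"
proof -
  assume [measurable]: "A \<in> sets borel"
  have "preim d A = I \<beta> \<inter> {y \<in> space borel. (y + d) / \<beta> \<in> A}"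
    by (auto simp: preim_def)
  also have "\<dots> \<in> sets borel"
    by measurable
  finally show ?thesis .
qed

lemma Pr_first_digit:
  assumes "d \<le> N" and [measurable]: "A \<in> sets borel" "Measurable.pred P Q"
  shows "Pr (\<lambda>b. b 0 = d \<and> val b \<in> A \<and> Q (b \<circ> Suc)) = Pr (\<lambda>b. val b \<in> preim d A \<and> Q b) / (N + 1)"
proof -
  have "val b \<in> A \<longleftrightarrow> val (b \<circ> Suc) \<in> preim d A" if "b \<in> space P" "b 0 = d" for b
  proof -
    have "val b = (val (b \<circ> Suc) + d) / \<beta>"
      using T_val[of b] that beta_gt_1 by (simp add: T_def space_P field_simps)
    then show ?thesis
      using val_mem_I[OF digit_seqs_Suc, of b] that by (simp add: preim_def space_P)
  qed
  then have "{b \<in> space P. b 0 = d \<and> val b \<in> A \<and> Q (b \<circ> Suc)}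
      = {b \<in> space P. b 0 = d \<and> val (b \<circ> Suc) \<in> preim d A \<and> Q (b \<circ> Suc)}"
    by auto
  moreover have "Measurable.pred P (\<lambda>b. val b \<in> preim d A \<and> Q b)"
  proof -
    note borel_preim[OF assms(2), measurable]
    show ?thesis
      by measurable
  qed
  ultimately show ?thesis
    using measure_first_digit[OF assms(1), of "\<lambda>b. val b \<in> preim d A \<and> Q b"] by simp
qed

text \<open>In the region of index \<open>k\<close>, digit \<open>k\<close> leaves a tail of value
  at most \<open>R - 1\<close> and digit \<open>k - 1\<close> one of value at least 1; these tails
  have equal probability by \<open>prob_val_symmetric\<close>.\<close>

lemma Pr_S_part_digits:
  assumes "k \<in> {1..N}"
  shows "Pr (\<lambda>b. b 0 = k \<and> val b \<in> S_part \<beta> k) = Pr (\<lambda>b. val b \<le> R - 1) / (N + 1)"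
    and "Pr (\<lambda>b. b 0 = k - 1 \<and> val b \<in> S_part \<beta> k) = Pr (\<lambda>b. val b \<le> R - 1) / (N + 1)"
proof -
  have k: "real (k - Suc 0) = real k - 1" "k - 1 \<le> N"
    using assms by auto
  have y: "0 \<le> val (b \<circ> Suc)" "val (b \<circ> Suc) \<le> R" "\<beta> * val b = b 0 + val (b \<circ> Suc)" if "b \<in> space P" for b
    using val_mem_I[OF digit_seqs_Suc, of b] T_val[of b] that by (auto simp: space_P mem_I T_def)
  have 1: "{b \<in> space P. b 0 = k \<and> val b \<in> S_part \<beta> k} = {b \<in> space P. b 0 = k \<and> val (b \<circ> Suc) \<le> R - 1}"
    using y by (auto simp: mem_S_part)
  show "Pr (\<lambda>b. b 0 = k \<and> val b \<in> S_part \<beta> k) = Pr (\<lambda>b. val b \<le> R - 1) / (N + 1)"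
    unfolding 1 using assms by (subst measure_first_digit) auto
  have 2: "{b \<in> space P. b 0 = k - 1 \<and> val b \<in> S_part \<beta> k} = {b \<in> space P. b 0 = k - 1 \<and> 1 \<le> val (b \<circ> Suc)}"
    using y by (auto simp: mem_S_part k(1))
  show "Pr (\<lambda>b. b 0 = k - 1 \<and> val b \<in> S_part \<beta> k) = Pr (\<lambda>b. val b \<le> R - 1) / (N + 1)"
    unfolding 2 prob_val_symmetric[symmetric] using k(2) by (subst measure_first_digit) auto
qed

text \<open>Up to points of \<open>F \<beta>\<close>, a saturated subset of \<open>S \<beta>\<close> is a union of intervals
  \<open>S_part \<beta> k\<close>, each of which is mapped by its two branches onto \<open>[0, R - 1]\<close> and \<open>[1, R]\<close>.\<close>

lemma Pr_fair_first_coin: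
  assumes "saturated A" and [measurable]: "A \<in> sets borel"
  shows "Pr (\<lambda>b. val b \<in> A \<inter> S \<beta> \<and> (val b \<in> S_part \<beta> (b 0) \<longleftrightarrow> v)) = Pr (\<lambda>b. val b \<in> A \<inter> S \<beta>) / 2"
proof -
  have [measurable]: "Measurable.pred P (\<lambda>b. val b \<in> S_part \<beta> (b 0))"
  proof -
    have "Measurable.pred P (\<lambda>b. val b \<in> S_part \<beta> k)" for k
      by measurable
    then show ?thesis
      by (rule measurable_compose_countable[where g = "\<lambda>b. b 0"]) measurable
  qed
  define M where "M = {k \<in> {1..N}. S_part \<beta> k - F \<beta> \<subseteq> A}"
  define q where "q = Pr (\<lambda>b. val b \<le> R - 1) / (N + 1)"
  have cell: "val b \<in> A \<longleftrightarrow> k \<in> M" if "b \<in> generic_seqs" "k \<in> {1..N}" "val b \<in> S_part \<beta> k" for b k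
  proof
    assume "val b \<in> A"
    moreover have "same_cell (val b) y" if "y \<in> S_part \<beta> k - F \<beta>" for y
      using that \<open>k \<in> {1..N}\<close> \<open>val b \<in> S_part \<beta> k\<close> generic_val_notin_F[OF \<open>b \<in> generic_seqs\<close>]
      by (intro same_cell_S_partI[of _ _ k]) auto
    ultimately show "k \<in> M"
      using that(1,2) generic_val_notin_F[OF that(1)] val_mem_I[OF generic_digit_seqs[OF that(1)]]
        saturatedD[OF assms(1)] unfolding M_def by blast
  next
    assume "k \<in> M"
    then show "val b \<in> A"
      using that generic_val_notin_F[OF that(1)] by (auto simp: M_def)
  qed
  have digit: "b 0 = k \<or> b 0 = k - 1" if "b \<in> digit_seqs" "k \<in> {1..N}" "val b \<in> S_part \<beta> k" for b k
  proof -
    have "real (b 0) < k + 1" "real k < b 0 + 2"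
      using T_val_mem_I[OF that(1)] that(2,3) R_less_2 by (auto simp: T_mem_I mem_S_part)
    then show ?thesis
      using that(2) by auto
  qed
  have disj: "j = k" if "x \<in> S_part \<beta> j" "x \<in> S_part \<beta> k" for x j k
    using that R_less_2 by (auto simp: mem_S_part)
  have fin: "finite M"
    by (simp add: M_def)
  \<comment> \<open>The outcomes of the toss correspond to the digits \<open>k\<close> and
    \<open>k - 1\<close> on each region, and the result no longer contains \<open>v\<close>.\<close>
  have half: "Pr (\<lambda>b. val b \<in> A \<inter> S \<beta> \<and> (val b \<in> S_part \<beta> (b 0) \<longleftrightarrow> v)) = card M * q" for v
  proof -
    define d where "d k = (if v then k else k - 1)" for k :: nat
    have "Pr (\<lambda>b. val b \<in> A \<inter> S \<beta> \<and> (val b \<in> S_part \<beta> (b 0) \<longleftrightarrow> v))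
        = Pr (\<lambda>b. \<exists>k\<in>M. b 0 = d k \<and> val b \<in> S_part \<beta> k)"
    proof (rule Pr_cong)
      fix b assume b: "b \<in> generic_seqs"
      have dig: "(val b \<in> S_part \<beta> (b 0) \<longleftrightarrow> v) \<longleftrightarrow> b 0 = d k" if "k \<in> {1..N}" "val b \<in> S_part \<beta> k" for k
        using digit[OF generic_digit_seqs[OF b] that] disj[OF that(2), of "k - 1"] that
        by (cases v) (auto simp: d_def)
      have "val b \<in> S \<beta> \<longleftrightarrow> (\<exists>k\<in>{1..N}. val b \<in> S_part \<beta> k)"
        by (simp add: S_def N_def)
      then show "val b \<in> A \<inter> S \<beta> \<and> (val b \<in> S_part \<beta> (b 0) \<longleftrightarrow> v) \<longleftrightarrow> (\<exists>k\<in>M. b 0 = d k \<and> val b \<in> S_part \<beta> k)"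
        using cell[OF b] dig unfolding M_def by blast
    qed (use fin in measurable)
    also have "{b \<in> space P. \<exists>k\<in>M. b 0 = d k \<and> val b \<in> S_part \<beta> k}
        = (\<Union>k\<in>M. {b \<in> space P. b 0 = d k \<and> val b \<in> S_part \<beta> k})"
      by auto
    also have "P.prob \<dots> = (\<Sum>k\<in>M. Pr (\<lambda>b. b 0 = d k \<and> val b \<in> S_part \<beta> k))"
      using fin disj by (intro P.finite_measure_finite_Union) (auto simp: disjoint_family_on_def)
    also have "\<dots> = (\<Sum>k\<in>M. q)"
      unfolding q_def d_def by (intro sum.cong refl) (use Pr_S_part_digits in \<open>auto simp: M_def\<close>)
    finally show ?thesis
      by simp
  qed
  have "Pr (\<lambda>b. val b \<in> A \<inter> S \<beta>)
      = Pr (\<lambda>b. val b \<in> A \<inter> S \<beta> \<and> (val b \<in> S_part \<beta> (b 0) \<longleftrightarrow> True))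
      + Pr (\<lambda>b. val b \<in> A \<inter> S \<beta> \<and> (val b \<in> S_part \<beta> (b 0) \<longleftrightarrow> False))"
    by (subst P.finite_measure_Union[symmetric]) (auto intro!: arg_cong[of _ _ P.prob])
  then show ?thesis
    unfolding half by simp
qed

section \<open>Joint law of the tosses and the starting cell\<close>

definition agree :: "nat \<Rightarrow> (nat \<Rightarrow> bool) \<Rightarrow> (nat \<Rightarrow> nat) \<Rightarrow> bool" where
  "agree m w b \<longleftrightarrow> (\<forall>j<m. coin j b = w j)"

definition hits :: "nat \<Rightarrow> (nat \<Rightarrow> nat) \<Rightarrow> bool" where
  "hits l b \<longleftrightarrow> l \<in> visits b \<and> (\<forall>i<l. i \<notin> visits b)"

lemma pred_agree [measurable]: "Measurable.pred P (agree m w)"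
  unfolding agree_def[abs_def] by measurable

lemma pred_hits [measurable]: "Measurable.pred P (hits l)"
  unfolding hits_def[abs_def] by measurable

lemma hits_0: "hits 0 b \<longleftrightarrow> val b \<in> S \<beta>"
  by (simp add: hits_def visits_0)

lemma hits_Suc: "hits (Suc l) b \<longleftrightarrow> val b \<notin> S \<beta> \<and> hits l (b \<circ> Suc)"
  by (auto simp: hits_def visits_Suc[symmetric] visits_0[symmetric] less_Suc_eq_0_disj)

lemma all_less_Suc: "(\<forall>j<Suc m. Q j) \<longleftrightarrow> Q 0 \<and> (\<forall>j<m. Q (Suc j))"
  by (auto simp: less_Suc_eq_0_disj)

lemma agree_S: "val b \<in> S \<beta> \<Longrightarrow> agree (Suc m) w b \<longleftrightarrow> (val b \<in> S_part \<beta> (b 0) \<longleftrightarrow> w 0) \<and> agree m (w \<circ> Suc) (b \<circ> Suc)"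
  by (simp add: agree_def all_less_Suc coin_0_S coin_Suc_S)

lemma agree_not_S: "val b \<notin> S \<beta> \<Longrightarrow> visits b \<noteq> {} \<Longrightarrow> agree m w b \<longleftrightarrow> agree m w (b \<circ> Suc)"
  by (simp add: agree_def coin_not_S)

text \<open>Before the visit no toss is read, and each digit only moves the saturated set
  \<open>A\<close> along its branch. At the visit the first toss is fair, and whatever digit it
  produces, the image set is again saturated, so the assumption \<open>IH\<close> gives the same
  factor \<open>1 / 2 ^ m\<close> for the rest.\<close>

lemma Pr_agree_hits:
  assumes IH: "\<And>w A. saturated A \<Longrightarrow> A \<in> sets borel \<Longrightarrow>
      Pr (\<lambda>b. agree m w b \<and> val b \<in> A) = Pr (\<lambda>b. val b \<in> A) / 2 ^ m"
    and "saturated A" "A \<in> sets borel"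
  shows "Pr (\<lambda>b. agree (Suc m) w b \<and> hits l b \<and> val b \<in> A) = Pr (\<lambda>b. hits l b \<and> val b \<in> A) / 2 ^ Suc m"
  using assms(2,3)
proof (induction l arbitrary: A)
  case (0 A)
  note [measurable] = \<open>A \<in> sets borel\<close>
  \<comment> \<open>The points of \<open>A\<close> in \<open>S \<beta>\<close> at which choosing
    digit \<open>d\<close> means the toss \<open>w 0\<close>; its dependence on \<open>d\<close> is
    the reason for splitting by the first digit.\<close>
  define B where "B d = {x \<in> A \<inter> S \<beta>. x \<in> S_part \<beta> d \<longleftrightarrow> w 0}" for d
  have B [measurable]: "B d \<in> sets borel" for d
  proof -
    have "B d = {x \<in> space borel. x \<in> A \<inter> S \<beta> \<and> (x \<in> S_part \<beta> d \<longleftrightarrow> w 0)}"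
      by (auto simp: B_def)
    also have "\<dots> \<in> sets borel"
      by measurable
    finally show ?thesis .
  qed
  have [measurable]: "Measurable.pred P (\<lambda>b. val b \<in> B (b 0))"
  proof -
    have "Measurable.pred P (\<lambda>b. val b \<in> B k)" for k
      by measurable
    then show ?thesis
      by (rule measurable_compose_countable[where g = "\<lambda>b. b 0"]) measurable
  qed
  have digit: "Pr (\<lambda>b. b 0 = d \<and> val b \<in> B (b 0) \<and> agree m (w \<circ> Suc) (b \<circ> Suc))
      = Pr (\<lambda>b. b 0 = d \<and> val b \<in> B (b 0)) / 2 ^ m" if "d \<in> {..N}" for d
  proof -
    have d: "d \<le> N" using that by simp
    have sat: "saturated (preim d (B d))"
      unfolding B_def using d by (intro saturated_preim saturated_S_part 0)
    have "Pr (\<lambda>b. b 0 = d \<and> val b \<in> B (b 0) \<and> agree m (w \<circ> Suc) (b \<circ> Suc))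
        = Pr (\<lambda>b. b 0 = d \<and> val b \<in> B d \<and> agree m (w \<circ> Suc) (b \<circ> Suc))"
      by (rule arg_cong[of _ _ P.prob]) auto
    also have "\<dots> = Pr (\<lambda>b. val b \<in> preim d (B d) \<and> agree m (w \<circ> Suc) b) / (N + 1)"
      by (rule Pr_first_digit[OF d]) measurable
    also have "\<dots> = Pr (\<lambda>b. val b \<in> preim d (B d)) / 2 ^ m / (N + 1)"
      using IH[OF sat, of "w \<circ> Suc"] by (simp add: conj_commute)
    also have "Pr (\<lambda>b. val b \<in> preim d (B d)) / 2 ^ m / (N + 1) = Pr (\<lambda>b. val b \<in> preim d (B d) \<and> True) / (N + 1) / 2 ^ m"
      by simp
    also have "Pr (\<lambda>b. val b \<in> preim d (B d) \<and> True) / (N + 1) = Pr (\<lambda>b. b 0 = d \<and> val b \<in> B d \<and> True)"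
      by (rule Pr_first_digit[OF d, symmetric]) measurable
    also have "\<dots> = Pr (\<lambda>b. b 0 = d \<and> val b \<in> B (b 0))"
      by (rule arg_cong[of _ _ P.prob]) auto
    finally show ?thesis .
  qed
  have "Pr (\<lambda>b. agree (Suc m) w b \<and> hits 0 b \<and> val b \<in> A)
      = Pr (\<lambda>b. val b \<in> B (b 0) \<and> agree m (w \<circ> Suc) (b \<circ> Suc))"
    by (rule arg_cong[of _ _ P.prob]) (auto simp: hits_0 agree_S B_def)
  also have "\<dots> = (\<Sum>d\<le>N. Pr (\<lambda>b. b 0 = d \<and> val b \<in> B (b 0)) / 2 ^ m)"
    by (subst measure_split_first_digit) (use digit in auto)
  also have "\<dots> = Pr (\<lambda>b. val b \<in> B (b 0)) / 2 ^ m"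
    by (subst measure_split_first_digit) (auto simp: sum_divide_distrib)
  also have "Pr (\<lambda>b. val b \<in> B (b 0)) = Pr (\<lambda>b. val b \<in> A \<inter> S \<beta> \<and> (val b \<in> S_part \<beta> (b 0) \<longleftrightarrow> w 0))"
    by (rule arg_cong[of _ _ P.prob]) (auto simp: B_def)
  also have "\<dots> = Pr (\<lambda>b. val b \<in> A \<inter> S \<beta>) / 2"
    by (rule Pr_fair_first_coin) (use 0 in auto)
  also have "Pr (\<lambda>b. val b \<in> A \<inter> S \<beta>) = Pr (\<lambda>b. hits 0 b \<and> val b \<in> A)"
    by (rule arg_cong[of _ _ P.prob]) (auto simp: hits_0)
  finally show ?case
    by simp
next
  case (Suc l A)
  note [measurable] = \<open>A \<in> sets borel\<close>
  have digit: "Pr (\<lambda>b. b 0 = d \<and> val b \<in> A - S \<beta> \<and> agree (Suc m) w (b \<circ> Suc) \<and> hits l (b \<circ> Suc))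
      = Pr (\<lambda>b. b 0 = d \<and> hits (Suc l) b \<and> val b \<in> A) / 2 ^ Suc m" if "d \<in> {..N}" for d
  proof -
    have d: "d \<le> N" using that by simp
    have sat: "saturated (preim d (A - S \<beta>))"
      using d by (intro saturated_preim saturated_S_diff Suc.prems)
    have "Pr (\<lambda>b. b 0 = d \<and> val b \<in> A - S \<beta> \<and> agree (Suc m) w (b \<circ> Suc) \<and> hits l (b \<circ> Suc))
        = Pr (\<lambda>b. val b \<in> preim d (A - S \<beta>) \<and> agree (Suc m) w b \<and> hits l b) / (N + 1)"
      by (rule Pr_first_digit[OF d]) measurable
    also have "Pr (\<lambda>b. val b \<in> preim d (A - S \<beta>) \<and> agree (Suc m) w b \<and> hits l b)
        = Pr (\<lambda>b. agree (Suc m) w b \<and> hits l b \<and> val b \<in> preim d (A - S \<beta>))"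
      by (rule arg_cong[of _ _ P.prob]) auto
    also have "\<dots> = Pr (\<lambda>b. hits l b \<and> val b \<in> preim d (A - S \<beta>)) / 2 ^ Suc m"
      by (rule Suc.IH[OF sat]) measurable
    also have "Pr (\<lambda>b. hits l b \<and> val b \<in> preim d (A - S \<beta>)) = Pr (\<lambda>b. val b \<in> preim d (A - S \<beta>) \<and> hits l b)"
      by (rule arg_cong[of _ _ P.prob]) auto
    also have "Pr (\<lambda>b. val b \<in> preim d (A - S \<beta>) \<and> hits l b) / 2 ^ Suc m / (N + 1)
        = Pr (\<lambda>b. val b \<in> preim d (A - S \<beta>) \<and> hits l b) / (N + 1) / 2 ^ Suc m"
      by simp
    also have "Pr (\<lambda>b. val b \<in> preim d (A - S \<beta>) \<and> hits l b) / (N + 1) = Pr (\<lambda>b. b 0 = d \<and> val b \<in> A - S \<beta> \<and> hits l (b \<circ> Suc))"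
      by (rule Pr_first_digit[OF d, symmetric]) measurable
    also have "\<dots> = Pr (\<lambda>b. b 0 = d \<and> hits (Suc l) b \<and> val b \<in> A)"
      by (rule arg_cong[of _ _ P.prob]) (auto simp: hits_Suc)
    finally show ?thesis .
  qed
  have "Pr (\<lambda>b. agree (Suc m) w b \<and> hits (Suc l) b \<and> val b \<in> A)
      = Pr (\<lambda>b. val b \<in> A - S \<beta> \<and> agree (Suc m) w (b \<circ> Suc) \<and> hits l (b \<circ> Suc))"
  proof -
    have "visits b \<noteq> {}" if "hits (Suc l) b" for b
      using that by (auto simp: hits_def)
    then have "agree (Suc m) w b \<and> hits (Suc l) b \<and> val b \<in> A \<longleftrightarrow>
        val b \<in> A - S \<beta> \<and> agree (Suc m) w (b \<circ> Suc) \<and> hits l (b \<circ> Suc)" for b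
      using agree_not_S[of b "Suc m" w] hits_Suc[of l b] by blast
    then show ?thesis
      by simp
  qed
  also have "\<dots> = (\<Sum>d\<le>N. Pr (\<lambda>b. b 0 = d \<and> hits (Suc l) b \<and> val b \<in> A) / 2 ^ Suc m)"
    by (subst measure_split_first_digit) (use digit in auto)
  also have "\<dots> = Pr (\<lambda>b. hits (Suc l) b \<and> val b \<in> A) / 2 ^ Suc m"
    by (subst measure_split_first_digit[of "\<lambda>b. hits (Suc l) b \<and> val b \<in> A"]) (auto simp: sum_divide_distrib)
  finally show ?case .
qed

text \<open>Almost every sequence has exactly one time of first visit, so the events partition the
  space up to a null set.\<close>

lemma Pr_sums_hits:
  assumes [measurable]: "Measurable.pred P Q"
  shows "(\<lambda>l. Pr (\<lambda>b. hits l b \<and> Q b)) sums Pr Q"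
proof -
  have "(\<lambda>l. P.prob {b \<in> space P. hits l b \<and> Q b}) sums P.prob (\<Union>l. {b \<in> space P. hits l b \<and> Q b})"
  proof (rule P.finite_measure_UNION)
    show "disjoint_family (\<lambda>l. {b \<in> space P. hits l b \<and> Q b})"
      unfolding disjoint_family_on_def hits_def using linorder_less_linear by blast
  qed (use assms in auto)
  also have "(\<Union>l. {b \<in> space P. hits l b \<and> Q b}) = {b \<in> space P. (\<exists>l. hits l b) \<and> Q b}"
    by auto
  also have "P.prob \<dots> = Pr Q"
  proof (rule Pr_cong)
    fix b assume b: "b \<in> generic_seqs"
    have "hits (first_visit b) b"
      using recurrent_visits_ne[OF generic_recurrent[OF b]] unfolding hits_def first_visit_def
      by (auto intro: LeastI dest: not_less_Least)
    then show "(\<exists>l. hits l b) \<and> Q b \<longleftrightarrow> Q b"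
      by blast
  qed measurable
  finally show ?thesis .
qed

lemma Pr_agree:
  assumes "saturated A" "A \<in> sets borel"
  shows "Pr (\<lambda>b. agree m w b \<and> val b \<in> A) = Pr (\<lambda>b. val b \<in> A) / 2 ^ m"
  using assms
proof (induction m arbitrary: w A)
  case 0
  then show ?case
    by (simp add: agree_def)
next
  case (Suc m)
  note [measurable] = \<open>A \<in> sets borel\<close>
  have "(\<lambda>l. Pr (\<lambda>b. hits l b \<and> agree (Suc m) w b \<and> val b \<in> A)) sums Pr (\<lambda>b. agree (Suc m) w b \<and> val b \<in> A)"
    by (rule Pr_sums_hits) measurable
  moreover have "Pr (\<lambda>b. hits l b \<and> agree (Suc m) w b \<and> val b \<in> A) = Pr (\<lambda>b. hits l b \<and> val b \<in> A) / 2 ^ Suc m" for l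
  proof -
    have "Pr (\<lambda>b. hits l b \<and> agree (Suc m) w b \<and> val b \<in> A) = Pr (\<lambda>b. agree (Suc m) w b \<and> hits l b \<and> val b \<in> A)"
      by (rule arg_cong[of _ _ P.prob]) auto
    also have "\<dots> = Pr (\<lambda>b. hits l b \<and> val b \<in> A) / 2 ^ Suc m"
      by (rule Pr_agree_hits[OF Suc.IH Suc.prems])
    finally show ?thesis .
  qed
  moreover have "(\<lambda>l. Pr (\<lambda>b. hits l b \<and> val b \<in> A) / 2 ^ Suc m) sums (Pr (\<lambda>b. val b \<in> A) / 2 ^ Suc m)"
    by (rule sums_divide[OF Pr_sums_hits]) measurable
  ultimately show ?case
    by (simp only: sums_unique2)
qed

text \<open>The numbers of tosses and of cells are kept separate because a visit to
  \<open>S \<beta>\<close> lowers both and any other step only the second; balls have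
  \<open>m = n\<close>.\<close>

definition cylinder :: "nat \<Rightarrow> nat \<Rightarrow> (nat \<Rightarrow> nat) \<Rightarrow> (nat \<Rightarrow> nat) \<Rightarrow> bool" where
  "cylinder m n c b \<longleftrightarrow> agree m (\<lambda>j. coin j c) b \<and> (\<forall>i<n. same_cell (val (seq_drop i b)) (val (seq_drop i c)))"

lemma pred_same_cell [measurable]: "Measurable.pred borel (\<lambda>x. same_cell x y)"
  unfolding same_cell_def using F_finite by measurable

lemma pred_cylinder [measurable]: "Measurable.pred P (cylinder m n c)"
  unfolding cylinder_def[abs_def] by measurable

text \<open>Cell and first toss determine the first digit; \<open>n < m\<close> guarantees that a
  toss is prescribed. Conversely the digit and the cell of the tail determine the first cell by the
  Markov property, which is why at least two cells are required.\<close>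

lemma cylinder_step:
  assumes b: "b \<in> generic_seqs" and c: "c \<in> generic_seqs" and m: "n < m"
  shows "cylinder m (Suc (Suc n)) c b \<longleftrightarrow>
    b 0 = c 0 \<and> cylinder (if val c \<in> S \<beta> then m - 1 else m) (Suc n) (c \<circ> Suc) (b \<circ> Suc)"
proof -
  have same: "cylinder m' (Suc k) c' b' \<longleftrightarrow> agree m' (\<lambda>j. coin j c') b' \<and> same_cell (val b') (val c') \<and>
      (\<forall>i<k. same_cell (val (seq_drop i (b' \<circ> Suc))) (val (seq_drop i (c' \<circ> Suc))))" for m' k c' b'
    by (simp add: cylinder_def all_less_Suc seq_drop_Suc)
  note F = generic_val_notin_F[OF b] generic_val_notin_F[OF c]
  note D = generic_digit_seqs[OF b] generic_digit_seqs[OF c]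
  have ne: "visits b \<noteq> {}" "visits c \<noteq> {}"
    using b c generic_recurrent recurrent_visits_ne by blast+
  obtain m' where m': "m = Suc m'"
    using m by (cases m) auto
  have dig: "b 0 = c 0" if "agree m (\<lambda>j. coin j c) b" "same_cell (val b) (val c)"
  proof -
    have "rand_digit \<beta> (psi b) = rand_digit \<beta> (psi c)"
      unfolding psi_def using that(1)
      by (intro same_cell_rand_digit[OF that(2)] F val_mem_I D) (auto simp: agree_def m')
    then show ?thesis
      by (simp add: rand_digit_psi D)
  qed
  have pull: "same_cell (val b) (val c)" if "b 0 = c 0" "same_cell (val (b \<circ> Suc)) (val (c \<circ> Suc))"
    using same_cell_preimage[OF digit_seqs_le[OF D(1), of 0], of "val b" "val c"] that
      T_val[OF D(1)] T_val[OF D(2)] val_mem_I[OF digit_seqs_Suc[OF D(1)]] val_mem_I[OF digit_seqs_Suc[OF D(2)]]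
    by simp
  have agree: "agree m (\<lambda>j. coin j c) b \<longleftrightarrow>
      agree (if val c \<in> S \<beta> then m - 1 else m) (\<lambda>j. coin j (c \<circ> Suc)) (b \<circ> Suc)"
    if "b 0 = c 0" "same_cell (val b) (val c)"
  proof (cases "val c \<in> S \<beta>")
    case True
    then have "val b \<in> S \<beta>"
      using same_cell_S[OF that(2) F] by simp
    moreover have "val b \<in> S_part \<beta> (b 0) \<longleftrightarrow> val c \<in> S_part \<beta> (c 0)"
      using same_cell_S_part'[OF that(2) F \<open>val b \<in> S \<beta>\<close> digit_seqs_le[OF D(1), of 0]] that(1) by simp
    ultimately show ?thesis
      using True unfolding m' by (subst agree_S) (auto simp: coin_0_S coin_Suc_S comp_def)
  next
    case False
    then have "val b \<notin> S \<beta>"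
      using same_cell_S[OF that(2) F] by simp
    then show ?thesis
      using False agree_not_S[of b m] ne by (simp add: coin_not_S)
  qed
  have "cylinder m (Suc (Suc n)) c b \<longleftrightarrow> agree m (\<lambda>j. coin j c) b \<and> same_cell (val b) (val c) \<and>
      (\<forall>i<Suc n. same_cell (val (seq_drop i (b \<circ> Suc))) (val (seq_drop i (c \<circ> Suc))))"
    by (rule same)
  moreover have "(\<forall>i<Suc n. same_cell (val (seq_drop i (b \<circ> Suc))) (val (seq_drop i (c \<circ> Suc))))
      \<Longrightarrow> same_cell (val (b \<circ> Suc)) (val (c \<circ> Suc))"
    by (auto simp: all_less_Suc)
  ultimately show ?thesis
    using dig pull agree unfolding cylinder_def by blast
qed

lemma card_visits_Suc:
  "card {i. i < Suc n \<and> i \<in> visits c} = of_bool (val c \<in> S \<beta>) + card {i. i < n \<and> i \<in> visits (c \<circ> Suc)}"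
proof -
  have "{i. i < Suc n \<and> i \<in> visits c} = {i. i = 0 \<and> val c \<in> S \<beta>} \<union> Suc ` {i. i < n \<and> i \<in> visits (c \<circ> Suc)}"
  proof (intro set_eqI)
    fix i show "i \<in> {i. i < Suc n \<and> i \<in> visits c} \<longleftrightarrow>
        i \<in> {i. i = 0 \<and> val c \<in> S \<beta>} \<union> Suc ` {i. i < n \<and> i \<in> visits (c \<circ> Suc)}"
      by (cases i) (auto simp: visits_0 visits_Suc)
  qed
  then have "card {i. i < Suc n \<and> i \<in> visits c}
      = card {i::nat. i = 0 \<and> val c \<in> S \<beta>} + card (Suc ` {i. i < n \<and> i \<in> visits (c \<circ> Suc)})"
    by (simp only:) (rule card_Un_disjoint, auto)
  moreover have "card {i::nat. i = 0 \<and> val c \<in> S \<beta>} = of_bool (val c \<in> S \<beta>)"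
    by simp
  moreover have "card (Suc ` {i. i < n \<and> i \<in> visits (c \<circ> Suc)}) = card {i. i < n \<and> i \<in> visits (c \<circ> Suc)}"
    by (rule card_image) simp
  ultimately show ?thesis
    by (simp only:)
qed

text \<open>Each of the \<open>n\<close> steps trades one cell for one digit, at cost
  \<open>N + 1\<close>, and a visit also uses up a toss. The last cell and the leftover tosses are
  independent by \<open>Pr_agree\<close>.\<close>

lemma Pr_cylinder:
  assumes "c \<in> generic_seqs" "n \<le> m"
  shows "Pr (cylinder m (Suc n) c) =
    Pr (\<lambda>b. same_cell (val b) (val (seq_drop n c))) / ((N + 1) ^ n * 2 ^ (m - card {i. i < n \<and> i \<in> visits c}))"
  using assms
proof (induction n arbitrary: c m)
  case 0
  have "Pr (cylinder m (Suc 0) c) = Pr (\<lambda>b. agree m (\<lambda>j. coin j c) b \<and> val b \<in> {x. same_cell x (val c)})"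
    by (rule arg_cong[of _ _ P.prob]) (auto simp: cylinder_def)
  also have "\<dots> = Pr (\<lambda>b. val b \<in> {x. same_cell x (val c)}) / 2 ^ m"
  proof (rule Pr_agree[OF saturated_cell])
    show "{x. same_cell x (val c)} \<in> sets borel"
      using pred_same_cell[of "val c"] by (simp add: pred_def)
  qed
  finally show ?case
    by simp
next
  case (Suc n)
  define m' where "m' = (if val c \<in> S \<beta> then m - 1 else m)"
  have "Pr (cylinder m (Suc (Suc n)) c) = Pr (\<lambda>b. b 0 = c 0 \<and> cylinder m' (Suc n) (c \<circ> Suc) (b \<circ> Suc))"
    unfolding m'_def using Suc.prems by (intro Pr_cong cylinder_step) auto
  also have "\<dots> = Pr (cylinder m' (Suc n) (c \<circ> Suc)) / (N + 1)"
    using digit_seqs_le[OF generic_digit_seqs[OF Suc.prems(1)]] by (rule measure_first_digit) measurable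
  also have "Pr (cylinder m' (Suc n) (c \<circ> Suc)) = Pr (\<lambda>b. same_cell (val b) (val (seq_drop n (c \<circ> Suc)))) /
      ((N + 1) ^ n * 2 ^ (m' - card {i. i < n \<and> i \<in> visits (c \<circ> Suc)}))"
    using Suc.prems by (intro Suc.IH generic_Suc) (auto simp: m'_def)
  also have "m' - card {i. i < n \<and> i \<in> visits (c \<circ> Suc)} = m - card {i. i < Suc n \<and> i \<in> visits c}"
    by (simp add: card_visits_Suc m'_def)
  finally show ?case
    by (simp add: seq_drop_Suc comp_def algebra_simps)
qed

end

subsection \<open>Balls and local dimension\<close>

context multinacci
begin

section \<open>Measurability of the random map and transfer of null sets\<close>

lemma space_Omega_I: "space (Omega_I \<beta>) = UNIV \<times> I \<beta>"
  by (auto simp: Omega_I_def space_pair_measure space_PiM)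

lemma measurable_snd_Omega_I [measurable]: "snd \<in> borel_measurable (Omega_I \<beta>)"
proof -
  have "(\<lambda>x. x) \<in> borel_measurable (restrict_space borel (I \<beta>))"
    by (rule measurable_restrict_space1) simp
  then show ?thesis
    unfolding Omega_I_def by (rule measurable_compose[OF measurable_snd])
qed

lemma measurable_fst_Omega_I [measurable]: "(\<lambda>p. fst p i) \<in> measurable (Omega_I \<beta>) (count_space UNIV)"
  unfolding Omega_I_def by (rule measurable_compose[OF measurable_fst measurable_component_singleton]) simp

text \<open>Replaces the definite descriptions by comparisons whose measurability is
  evident.\<close>

lemma rand_digit_eq_iff:
  assumes "x \<in> I \<beta>"
  shows "rand_digit \<beta> (\<omega>, x) = d \<longleftrightarrow>
    d \<le> N \<and> d \<le> \<beta> * x \<and> \<beta> * x \<le> d + R \<and> (x \<in> S \<beta> \<longrightarrow> \<omega> 0 = (x \<in> S_part \<beta> d))"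
  using rand_digit_le[OF assms, of \<omega>] T_rand_digit_mem_I[OF assms, of \<omega>] T_mem_I[of d x]
    admissible_digit_S[of d x \<omega>] admissible_digit_notin_S[of d x \<omega>] by auto

lemma measurable_rand_digit [measurable]: "rand_digit \<beta> \<in> measurable (Omega_I \<beta>) (count_space UNIV)"
proof -
  have "rand_digit \<beta> -` {d} \<inter> space (Omega_I \<beta>) \<in> sets (Omega_I \<beta>)" for d
  proof -
    have "rand_digit \<beta> -` {d} \<inter> space (Omega_I \<beta>) = {p \<in> space (Omega_I \<beta>).
        d \<le> N \<and> d \<le> \<beta> * snd p \<and> \<beta> * snd p \<le> d + R \<and> (snd p \<in> S \<beta> \<longrightarrow> fst p 0 = (snd p \<in> S_part \<beta> d))}"
    proof -
      have "rand_digit \<beta> p = d \<longleftrightarrow> d \<le> N \<and> d \<le> \<beta> * snd p \<and> \<beta> * snd p \<le> d + R \<and>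
          (snd p \<in> S \<beta> \<longrightarrow> fst p 0 = (snd p \<in> S_part \<beta> d))" if "p \<in> space (Omega_I \<beta>)" for p
        using that rand_digit_eq_iff[of "snd p" "fst p" d] by (simp add: space_Omega_I mem_Times_iff)
      then show ?thesis
        by blast
    qed
    also have "\<dots> \<in> sets (Omega_I \<beta>)"
      by measurable
    finally show ?thesis .
  qed
  then show ?thesis
    by (subst measurable_count_space_eq2_countable) auto
qed

lemma measurable_K [measurable]: "K \<beta> \<in> measurable (Omega_I \<beta>) (Omega_I \<beta>)"
proof -
  have "(\<lambda>p. ((\<lambda>i. if snd p \<in> S \<beta> then fst p (Suc i) else fst p i), \<beta> * snd p - rand_digit \<beta> p))
      \<in> measurable (Omega_I \<beta>) ((\<Pi>\<^sub>M i\<in>UNIV. count_space UNIV) \<Otimes>\<^sub>M restrict_space borel (I \<beta>))"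
  proof (rule measurable_Pair)
    show "(\<lambda>p i. if snd p \<in> S \<beta> then fst p (Suc i) else fst p i) \<in> measurable (Omega_I \<beta>) (\<Pi>\<^sub>M i\<in>UNIV. count_space UNIV)"
      by (rule measurable_PiM_single') (auto simp: PiE_UNIV_domain)
    show "(\<lambda>p. \<beta> * snd p - rand_digit \<beta> p) \<in> measurable (Omega_I \<beta>) (restrict_space borel (I \<beta>))"
    proof (rule measurable_restrict_space2)
      show "(\<lambda>p. \<beta> * snd p - rand_digit \<beta> p) \<in> space (Omega_I \<beta>) \<rightarrow> I \<beta>"
        using T_rand_digit_mem_I by (auto simp: space_Omega_I T_def)
    qed measurable
  qed
  moreover have "K \<beta> = (\<lambda>p. ((\<lambda>i. if snd p \<in> S \<beta> then fst p (Suc i) else fst p i), \<beta> * snd p - rand_digit \<beta> p))"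
    by (auto simp: K_def T_def fun_eq_iff)
  ultimately show ?thesis
    by (simp add: Omega_I_def)
qed

lemma measurable_K_funpow [measurable]: "(K \<beta> ^^ n) \<in> measurable (Omega_I \<beta>) (Omega_I \<beta>)"
proof (induction n)
  case (Suc n)
  then show ?case
    using measurable_compose[OF Suc measurable_K] by (simp add: comp_def)
qed simp

lemma measurable_phi [measurable]: "phi \<beta> \<in> measurable (Omega_I \<beta>) P"
proof -
  have "(\<lambda>p n. rand_digit \<beta> ((K \<beta> ^^ n) p)) \<in> measurable (Omega_I \<beta>) (\<Pi>\<^sub>M i\<in>UNIV. uniform_count_measure {0..N})"
  proof (rule measurable_PiM_single')
    fix n
    have le: "rand_digit \<beta> ((K \<beta> ^^ n) p) \<le> N" if "p \<in> space (Omega_I \<beta>)" for p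
      using rand_digit_le[of "snd ((K \<beta> ^^ n) p)" "fst ((K \<beta> ^^ n) p)"] snd_K_funpow_mem_I[of p n] that
      by (auto simp: space_Omega_I)
    have "(\<lambda>p. rand_digit \<beta> ((K \<beta> ^^ n) p)) \<in> measurable (Omega_I \<beta>) (count_space {0..N})"
    proof (subst measurable_count_space_eq2_countable)
      show "(\<lambda>p. rand_digit \<beta> ((K \<beta> ^^ n) p)) \<in> space (Omega_I \<beta>) \<rightarrow> {0..N} \<and>
          (\<forall>d\<in>{0..N}. (\<lambda>p. rand_digit \<beta> ((K \<beta> ^^ n) p)) -` {d} \<inter> space (Omega_I \<beta>) \<in> sets (Omega_I \<beta>))"
        using le by auto
    qed
    then show "(\<lambda>p. rand_digit \<beta> ((K \<beta> ^^ n) p)) \<in> measurable (Omega_I \<beta>) (uniform_count_measure {0..N})"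
      by (simp add: measurable_cong_sets[OF refl sets_uniform_count_measure_count_space])
  next
    show "(\<lambda>p n. rand_digit \<beta> ((K \<beta> ^^ n) p))
        \<in> space (Omega_I \<beta>) \<rightarrow> (\<Pi>\<^sub>E i\<in>UNIV. space (uniform_count_measure {0..N}))"
      using phi_digit_seqs
      by (auto simp: space_Omega_I space_uniform_count_measure phi_def rand_digits_def digit_seqs_def)
  qed
  then show ?thesis
    by (simp add: P_eq phi_def[abs_def] rand_digits_def)
qed

text \<open>No measurability of \<open>Q'\<close> is available, so the exceptional set is covered by
  a measurable null set \<open>B\<close>, which is carried over through \<open>phi\<close>; on
  \<open>Z \<beta>\<close> the point is recovered as \<open>psi (phi \<beta> p)\<close>.\<close>

lemma AE_nuI:
  assumes "AE b in P. Q b" and Q: "\<And>b. b \<in> recurrent_seqs \<Longrightarrow> Q b \<Longrightarrow> Q' (psi b)"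
  shows "AE p in nu \<beta>. Q' p"
proof -
  obtain B where B: "B \<in> null_sets P" "{b \<in> space P. \<not> Q b} \<subseteq> B"
    using assms(1) by (auto simp: eventually_ae_filter)
  have [measurable]: "B \<in> sets P"
    using B(1) by auto
  have "AE b in P. b \<notin> B"
    using B(1) by (rule AE_not_in)
  then have "AE b in P. phi \<beta> (psi b) \<in> recurrent_seqs \<and> phi \<beta> (psi b) \<notin> B"
    using AE_recurrent by eventually_elim (simp add: phi_psi)
  moreover have "{p \<in> space (Omega_I \<beta>). phi \<beta> p \<in> recurrent_seqs \<and> phi \<beta> p \<notin> B} \<in> sets (Omega_I \<beta>)"
    by measurable
  ultimately have "AE p in nu \<beta>. phi \<beta> p \<in> recurrent_seqs \<and> phi \<beta> p \<notin> B"
    unfolding nu_eq by (subst AE_distr_iff) auto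
  then show ?thesis
    using AE_space
  proof eventually_elim
    case (elim p)
    then have I: "snd p \<in> I \<beta>"
      by (auto simp: nu_eq space_Omega_I)
    have "infinite {n. snd ((K \<beta> ^^ n) p) \<in> S \<beta>}"
      using elim(1) visits_phi[OF I] by (simp add: recurrent_seqs_def)
    then have "p \<in> Z \<beta>"
      using I by (cases p) (auto simp: Z_def)
    moreover have "Q (phi \<beta> p)"
      using elim(1) B(2) recurrent_digit_seqs by (auto simp: space_P)
    ultimately show ?case
      using Q[of "phi \<beta> p"] elim(1) by (simp add: psi_phi)
  qed
qed

definition cyl :: "nat \<Rightarrow> (nat \<Rightarrow> bool) \<times> real \<Rightarrow> ((nat \<Rightarrow> bool) \<times> real) set" where
  "cyl n p = {q \<in> X \<beta>. \<forall>j<n. fst q j = fst p j \<and> same_cell (snd ((K \<beta> ^^ j) q)) (snd ((K \<beta> ^^ j) p))}"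

lemma mem_X: "q \<in> X \<beta> \<longleftrightarrow> snd q \<in> I \<beta> \<and> (\<forall>n. snd ((K \<beta> ^^ n) q) \<notin> F \<beta>)"
  by (auto simp: X_def mem_Times_iff)

lemma cyl_sets: "cyl n p \<in> sets (Omega_I \<beta>)"
proof -
  have "cyl n p = {q \<in> space (Omega_I \<beta>). (\<forall>n. snd ((K \<beta> ^^ n) q) \<notin> F \<beta>) \<and>
      (\<forall>j<n. fst q j = fst p j \<and> same_cell (snd ((K \<beta> ^^ j) q)) (snd ((K \<beta> ^^ j) p)))}"
    by (auto simp: cyl_def mem_X space_Omega_I)
  also have "\<dots> \<in> sets (Omega_I \<beta>)"
    by measurable
  finally show ?thesis .
qed

lemma alpha_eq_iff:
  assumes "p \<in> X \<beta>" "q \<in> X \<beta>"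
  shows "alpha \<beta> (Suc j) p = alpha \<beta> (Suc j) q \<longleftrightarrow>
    same_cell (snd ((K \<beta> ^^ j) q)) (snd ((K \<beta> ^^ j) p))"
proof -
  have "alpha \<beta> (Suc j) p = card {c \<in> F \<beta>. c < snd ((K \<beta> ^^ j) p)}" if "p \<in> X \<beta>" for p
    using that snd_K_funpow_mem_I[of p j] cell_index[of "snd ((K \<beta> ^^ j) p)"]
    by (simp add: alpha_def mem_X)
  then show ?thesis
    using assms by (auto simp: same_cell_iff_card)
qed

text \<open>This makes \<open>rho\<close> separate the points of \<open>X\<close>: the \<open>LEAST\<close> in its definition ranges over a
  nonempty set for distinct points.\<close>

lemma X_separated:
  assumes "p \<in> X \<beta>" "q \<in> X \<beta>" "\<And>n. q \<in> cyl n p"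
  shows "p = q"
proof -
  have same: "same_cell (snd ((K \<beta> ^^ j) q)) (snd ((K \<beta> ^^ j) p))" and "fst q j = fst p j" for j
    using assms(3)[of "Suc j"] by (auto simp: cyl_def)
  then have fst: "fst q = fst p"
    by auto
  \<comment> \<open>If the unread tosses agree, equal cells give equal digits and simultaneous
    visits, so the unread tosses agree after the step too; equal digit sequences then give equal
    points by \<open>val_phi\<close>.\<close>
  have step: "rand_digit \<beta> ((K \<beta> ^^ n) q) = rand_digit \<beta> ((K \<beta> ^^ n) p) \<and>
      (snd ((K \<beta> ^^ n) q) \<in> S \<beta> \<longleftrightarrow> snd ((K \<beta> ^^ n) p) \<in> S \<beta>)"
    if "fst ((K \<beta> ^^ n) q) = fst ((K \<beta> ^^ n) p)" for n
  proof
    have "rand_digit \<beta> (fst ((K \<beta> ^^ n) q), snd ((K \<beta> ^^ n) q)) = rand_digit \<beta> (fst ((K \<beta> ^^ n) p), snd ((K \<beta> ^^ n) p))"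
      by (rule same_cell_rand_digit[OF same])
        (use assms(1,2) that snd_K_funpow_mem_I[of p n] snd_K_funpow_mem_I[of q n] in \<open>simp_all add: mem_X\<close>)
    then show "rand_digit \<beta> ((K \<beta> ^^ n) q) = rand_digit \<beta> ((K \<beta> ^^ n) p)"
      by simp
    show "snd ((K \<beta> ^^ n) q) \<in> S \<beta> \<longleftrightarrow> snd ((K \<beta> ^^ n) p) \<in> S \<beta>"
      using same_cell_S[OF same[of n]] assms(1,2) by (simp add: mem_X)
  qed
  have "fst ((K \<beta> ^^ n) q) = fst ((K \<beta> ^^ n) p)" for n
  proof (induction n)
    case (Suc n)
    have "fst (K \<beta> z) = (if snd z \<in> S \<beta> then fst z \<circ> Suc else fst z)" for z
      by (cases z) (simp add: K_eq)
    then show ?case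
      using Suc step[OF Suc] by (simp add: comp_def)
  qed (use fst in simp)
  then have "phi \<beta> q = phi \<beta> p"
    using step by (simp add: phi_def rand_digits_def)
  then have "snd q = snd p"
    using val_phi assms(1,2) by (metis mem_X)
  then show ?thesis
    using fst by (simp add: prod_eq_iff)
qed

text \<open>Ultrametric argument: where \<open>p\<close> and \<open>r\<close> first differ,
  \<open>q\<close> differs from one of them.\<close>

lemma Metric_space_rho: "Metric_space (X \<beta>) (rho \<beta>)"
proof
  define D where "D p q k \<longleftrightarrow> fst p k \<noteq> fst q k \<or> alpha \<beta> (k + 1) p \<noteq> alpha \<beta> (k + 1) q" for p q k
  have rho: "rho \<beta> p q = (if p = q then 0 else \<beta> powr - real (LEAST k. D p q k))" for p q
    by (simp add: rho_def D_def)
  show "0 \<le> rho \<beta> p q" for p q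
    by (simp add: rho)
  have "D p q k \<longleftrightarrow> D q p k" for p q k
    by (auto simp: D_def)
  then show "rho \<beta> p q = rho \<beta> q p" for p q
    by (simp add: rho)
  show "rho \<beta> p q = 0 \<longleftrightarrow> p = q" for p q
    using beta_gt_1 by (simp add: rho)
  fix p q r assume X: "p \<in> X \<beta>" "q \<in> X \<beta>" "r \<in> X \<beta>"
  show "rho \<beta> p r \<le> rho \<beta> p q + rho \<beta> q r"
  proof (cases "p = r \<or> p = q \<or> q = r")
    case False
    define k where "k = (LEAST k. D p r k)"
    have "\<exists>k. D p r k"
      using X_separated[OF X(1,3)] alpha_eq_iff[OF X(1,3)] X False by (auto simp: D_def cyl_def)
    then have "D p r k"
      unfolding k_def by (rule LeastI_ex)
    then have "D p q k \<or> D q r k"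
      by (auto simp: D_def)
    then have "(LEAST k. D p q k) \<le> k \<or> (LEAST k. D q r k) \<le> k"
      by (auto intro: Least_le)
    then have "\<beta> powr - real k \<le> \<beta> powr - real (LEAST k. D p q k) \<or>
        \<beta> powr - real k \<le> \<beta> powr - real (LEAST k. D q r k)"
      using beta_gt_1 by auto
    moreover have "0 \<le> \<beta> powr - real (LEAST k. D p q k)" "0 \<le> \<beta> powr - real (LEAST k. D q r k)"
      by auto
    ultimately have "\<beta> powr - real k \<le> \<beta> powr - real (LEAST k. D p q k) + \<beta> powr - real (LEAST k. D q r k)"
      by linarith
    then show ?thesis
      using False by (simp add: rho k_def)
  qed (auto simp: rho)
qed

text \<open>For an integer \<open>k\<close>, \<open>\<beta> powr - k < r\<close> means
  \<open>k > - log \<beta> r\<close>, and the smallest such integer is the floor plus 1. For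
  \<open>r > 1\<close>, \<open>nat\<close> truncates it to 0 and the ball is all of
  \<open>X \<beta>\<close>.\<close>

lemma mball_eq_cyl:
  assumes p: "p \<in> X \<beta>" and r: "r > 0"
  shows "Metric_space.mball (X \<beta>) (rho \<beta>) p r = cyl (nat (\<lfloor>- log \<beta> r\<rfloor> + 1)) p"
proof -
  define n where "n = nat (\<lfloor>- log \<beta> r\<rfloor> + 1)"
  have rho: "rho \<beta> p q < r \<longleftrightarrow> q \<in> cyl n p" if q: "q \<in> X \<beta>" for q
  proof (cases "p = q")
    case True
    then show ?thesis
      using p r by (simp add: rho_def cyl_def same_cell_refl)
  next
    case False
    define D where "D k \<longleftrightarrow> fst p k \<noteq> fst q k \<or> alpha \<beta> (k + 1) p \<noteq> alpha \<beta> (k + 1) q" for k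
    have cyl: "q \<in> cyl m p \<longleftrightarrow> (\<forall>k<m. \<not> D k)" for m
      using p q alpha_eq_iff[OF p q] by (auto simp: cyl_def D_def)
    obtain k where "D k"
      using X_separated[OF p q] False cyl by blast
    have "rho \<beta> p q = \<beta> powr - real (LEAST k. D k)"
      using False by (simp add: rho_def D_def)
    then have "rho \<beta> p q < r \<longleftrightarrow> - log \<beta> r < real (LEAST k. D k)"
      using beta_gt_1 r by (simp add: powr_less_iff) linarith
    also have "\<dots> \<longleftrightarrow> n \<le> (LEAST k. D k)"
      unfolding n_def by linarith
    also have "\<dots> \<longleftrightarrow> (\<forall>k<n. \<not> D k)"
      using LeastI[of D, OF \<open>D k\<close>] not_less_Least[of _ D] by (meson leI less_le_trans)
    finally show ?thesis
      by (simp add: cyl)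
  qed
  then have "Metric_space.mball (X \<beta>) (rho \<beta>) p r = cyl n p"
    using p by (auto simp: Metric_space.in_mball[OF Metric_space_rho] cyl_def)
  then show ?thesis
    by (simp add: n_def)
qed

lemma fst_psi: "fst (psi b) j = coin j b" and snd_psi: "snd (psi b) = val b"
  by (simp_all add: psi_def)

lemma psi_mem_X: "b \<in> generic_seqs \<Longrightarrow> psi b \<in> X \<beta>"
  by (simp add: mem_X K_funpow_psi generic_recurrent)
    (simp add: psi_def val_mem_I generic_digit_seqs generic_notin_F)

lemma measure_cyl:
  assumes c: "c \<in> generic_seqs"
  shows "measure (nu \<beta>) (cyl n (psi c)) = Pr (cylinder n n c)"
proof -
  have "{b \<in> space P. psi b \<in> cyl n (psi c)} \<in> sets P"
    using cyl_sets[of n "psi c"] by measurable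
  then have meas: "Measurable.pred P (\<lambda>b. psi b \<in> cyl n (psi c))"
    by (simp add: pred_def)
  have "measure (nu \<beta>) (cyl n (psi c)) = Pr (\<lambda>b. psi b \<in> cyl n (psi c))"
    by (rule measure_nu[OF cyl_sets])
  also have "\<dots> = Pr (cylinder n n c)"
  proof (rule Pr_cong[OF _ meas pred_cylinder])
    fix b assume "b \<in> generic_seqs"
    then show "psi b \<in> cyl n (psi c) \<longleftrightarrow> cylinder n n c b"
      using c by (auto simp: cyl_def psi_mem_X K_funpow_psi generic_recurrent cylinder_def agree_def fst_psi snd_psi)
  qed
  finally show ?thesis .
qed

section \<open>Masses of the cells\<close>

definition cell_mass :: "real \<Rightarrow> real" where
  "cell_mass y = Pr (\<lambda>b. same_cell (val b) y)"

lemma cell_mass_cong: "same_cell x y \<Longrightarrow> cell_mass x = cell_mass y"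
  unfolding cell_mass_def using same_cell_sym same_cell_trans by metis

text \<open>The mass depends only on the index of the cell, and there are finitely many indices. The
  bound makes the last cell negligible in the exponential rate.\<close>

lemma cell_mass_lower_bound: "\<exists>\<epsilon>>0. \<forall>y. cell_mass y > 0 \<longrightarrow> \<epsilon> \<le> cell_mass y"
proof -
  \<comment> \<open>The entry 1 keeps the set nonempty, so that \<open>Min\<close> is
    meaningful.\<close>
  define V where "V = insert 1 {v \<in> range cell_mass. v > 0}"
  define idx where "idx y = card {c \<in> F \<beta>. c < y}" for y
  have "range cell_mass = (\<lambda>i. cell_mass (SOME y. idx y = i)) ` range idx"
  proof -
    have "cell_mass (SOME z. idx z = idx y) = cell_mass y" for y
      using someI[of "\<lambda>z. idx z = idx y" y] by (intro cell_mass_cong) (simp add: same_cell_iff_card idx_def)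
    then show ?thesis
      by (auto simp: image_image)
  qed
  moreover have "range idx \<subseteq> {..card (F \<beta>)}"
    using F_finite by (auto simp: idx_def intro!: card_mono)
  ultimately have "finite (range cell_mass)"
    by (simp add: finite_subset)
  then have fin: "finite V"
    by (simp add: V_def)
  then have "0 < Min V"
    by (subst Min_gr_iff) (auto simp: V_def)
  moreover have "Min V \<le> cell_mass y" if "cell_mass y > 0" for y
    using fin that by (intro Min_le) (auto simp: V_def)
  ultimately show ?thesis
    by blast
qed

text \<open>Rather than showing that every cell has positive mass, the null cells are discarded:
  they have countably many indices, and shift invariance extends this to every time.\<close>

lemma AE_cell_mass_pos: "AE b in P. \<forall>n. cell_mass (val (seq_drop n b)) > 0"
proof -
  define idx where "idx y = card {c \<in> F \<beta>. c < y}" for y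
  have [measurable]: "Measurable.pred borel (\<lambda>y. idx y = i)" for i
  proof (cases "\<exists>z. idx z = i")
    case True
    then obtain z where "idx z = i" by blast
    then have "(\<lambda>y. idx y = i) = (\<lambda>y. same_cell y z)"
      by (auto simp: same_cell_iff_card idx_def)
    then show ?thesis
      by simp
  qed simp
  have mass: "cell_mass y = Pr (\<lambda>b. idx (val b) = idx y)" for y
    by (simp add: cell_mass_def same_cell_iff_card idx_def)
  have "AE b in P. idx (val b) = i \<longrightarrow> Pr (\<lambda>b. idx (val b) = i) > 0" for i
  proof (cases "Pr (\<lambda>b. idx (val b) = i) = 0")
    case True
    have "{b \<in> space P. idx (val b) = i} \<in> P.events"
      by measurable
    then have "AE b in P. b \<notin> {b \<in> space P. idx (val b) = i}"
      using True P.prob_eq_0 by blast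
    then show ?thesis
      using AE_space by eventually_elim auto
  next
    case False
    then have "Pr (\<lambda>b. idx (val b) = i) > 0"
      by (simp add: less_le)
    then show ?thesis
      by simp
  qed
  then have "AE b in P. \<forall>i. idx (val b) = i \<longrightarrow> Pr (\<lambda>b. idx (val b) = i) > 0"
    unfolding AE_all_countable by blast
  then have "AE b in P. cell_mass (val b) > 0"
    by eventually_elim (simp add: mass)
  then have "AE b in distr P P (seq_drop n). cell_mass (val b) > 0" for n
    by (simp only: distr_seq_drop)
  then have "AE b in P. cell_mass (val (seq_drop n b)) > 0" for n
    by (rule AE_distrD[OF measurable_seq_drop])
  then show ?thesis
    by (simp add: AE_all_countable)
qed

end

text \<open>The ball of radius \<open>r\<close> is a cylinder of length \<open>n r\<close>, and
  \<open>n r\<close> divided by \<open>- log \<beta> r\<close> tends to 1, so a rate per step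
  becomes a rate in \<open>ln r\<close> after division by \<open>ln \<beta>\<close>.\<close>

lemma ball_exponent:
  fixes M :: "nat \<Rightarrow> real"
  assumes \<beta>: "\<beta> > 1" and lim: "(\<lambda>n. ln (M n) / n) \<longlonglongrightarrow> - h"
  shows "((\<lambda>r. ln (M (nat (\<lfloor>- log \<beta> r\<rfloor> + 1))) / ln r) \<longlongrightarrow> h / ln \<beta>) (at_right 0)"
proof -
  define y where "y r = - log \<beta> r" for r
  define n where "n r = nat (\<lfloor>y r\<rfloor> + 1)" for r
  have ln: "ln \<beta> > 0" using \<beta> by simp
  have y: "filterlim y at_top (at_right 0)"
  proof -
    have "filterlim (\<lambda>r. (1 / ln \<beta>) * (- ln r)) at_top (at_right 0)"
      using ln ln_at_0 by (intro filterlim_tendsto_pos_mult_at_top[OF tendsto_const])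
        (auto simp: filterlim_uminus_at_top)
    then show ?thesis
      by (simp add: y_def[abs_def] log_def)
  qed
  have pos: "\<forall>\<^sub>F r in at_right 0. y r > 0"
    using y by (simp add: filterlim_at_top_dense)
  have bounds: "y r \<le> n r" "n r \<le> y r + 1" if "y r > 0" for r
    using that unfolding n_def by linarith+
  have n: "filterlim n sequentially (at_right 0)"
  proof -
    have "filterlim (\<lambda>r. real (n r)) at_top (at_right 0)"
      using pos bounds(1) by (intro filterlim_at_top_mono[OF y]) (auto elim: eventually_mono)
    then show ?thesis
      using filterlim_sequentially_iff_filterlim_real by blast
  qed
  have ratio: "((\<lambda>r. n r / y r) \<longlongrightarrow> 1) (at_right 0)"
  proof (rule tendsto_sandwich[OF _ _ tendsto_const])
    show "\<forall>\<^sub>F r in at_right 0. 1 \<le> n r / y r"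
      using pos by eventually_elim (use bounds(1) in \<open>simp add: le_divide_eq\<close>)
    show "\<forall>\<^sub>F r in at_right 0. n r / y r \<le> 1 + 1 / y r"
      using pos
    proof eventually_elim
      case (elim r)
      then have "n r / y r \<le> (y r + 1) / y r"
        using bounds(2) by (intro divide_right_mono) auto
      then show ?case
        using elim by (simp add: add_divide_distrib)
    qed
    have "((\<lambda>r. 1 / y r) \<longlongrightarrow> 0) (at_right 0)"
      by (rule tendsto_divide_0[OF tendsto_const filterlim_at_top_imp_at_infinity[OF y]])
    from tendsto_add[OF tendsto_const this, of 1]
    show "((\<lambda>r. 1 + 1 / y r) \<longlongrightarrow> 1) (at_right 0)" by simp
  qed
  have "((\<lambda>r. ln (M (n r)) / n r * (n r / y r) * (- 1 / ln \<beta>)) \<longlongrightarrow> - h * 1 * (- 1 / ln \<beta>)) (at_right 0)"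
    using ln by (intro tendsto_intros ratio filterlim_compose[OF lim n]) auto
  then have "((\<lambda>r. ln (M (n r)) / n r * (n r / y r) * (- 1 / ln \<beta>)) \<longlongrightarrow> h / ln \<beta>) (at_right 0)"
    by simp
  moreover have "\<forall>\<^sub>F r in at_right 0. ln (M (n r)) / n r * (n r / y r) * (- 1 / ln \<beta>) = ln (M (n r)) / ln r"
    using pos
  proof eventually_elim
    case (elim r)
    have "ln r = - y r * ln \<beta>"
      using ln by (simp add: y_def log_def)
    moreover have "n r > 0"
      using bounds(1)[OF elim] elim by simp
    ultimately show ?case
      using elim ln by simp
  qed
  ultimately show ?thesis
    unfolding n_def y_def by (rule Lim_transform_eventually)
qed

context multinacci
begin

lemma cyl_exponent:
  assumes c: "c \<in> generic_seqs" and pos: "\<And>n. cell_mass (val (seq_drop n c)) > 0"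
    and freq: "(\<lambda>n. card {i. i < n \<and> i \<in> visits c} / n) \<longlonglongrightarrow> s"
  shows "Pr (cylinder n n c) > 0"
    and "(\<lambda>n. ln (Pr (cylinder n n c)) / n) \<longlonglongrightarrow> - (ln (N + 1) + (1 - s) * ln 2)"
proof -
  define v where "v n = card {i. i < n \<and> i \<in> visits c}" for n
  define w where "w n = cell_mass (val (seq_drop n c))" for n
  have v: "v n \<le> n" for n
  proof -
    have "v n \<le> card {..<n}"
      unfolding v_def by (intro card_mono) auto
    then show ?thesis by simp
  qed
  \<comment> \<open>\<open>Suc n\<close> cells amount to \<open>n\<close> digits and a last cell,
    whereas all \<open>Suc n\<close> tosses are prescribed.\<close>
  have eq: "Pr (cylinder (Suc n) (Suc n) c) = w n / ((N + 1) ^ n * 2 ^ (Suc n - v n))" for n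
    using Pr_cylinder[OF c, of n "Suc n"] by (simp add: w_def cell_mass_def v_def)
  have w: "0 < w n" "w n \<le> 1" for n
    using pos by (auto simp: w_def cell_mass_def)
  show "Pr (cylinder n n c) > 0"
  proof (cases n)
    case 0
    then show ?thesis
      using P.prob_space by (simp add: cylinder_def agree_def)
  next
    case (Suc m)
    then show ?thesis
      using w by (simp add: eq)
  qed
  obtain \<epsilon> where \<epsilon>: "\<epsilon> > 0" "\<And>y. cell_mass y > 0 \<Longrightarrow> \<epsilon> \<le> cell_mass y"
    using cell_mass_lower_bound by blast
  have ln_w: "(\<lambda>n. ln (w n) / n) \<longlonglongrightarrow> 0"
  proof (rule tendsto_sandwich[OF _ _ lim_const_over_n[of "ln \<epsilon>"] tendsto_const])
    have "ln \<epsilon> \<le> ln (w n)" "ln (w n) \<le> 0" for n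
      using \<epsilon> pos w[of n] by (auto simp: w_def)
    then show "\<forall>\<^sub>F n in sequentially. ln \<epsilon> / n \<le> ln (w n) / n" "\<forall>\<^sub>F n in sequentially. ln (w n) / n \<le> 0"
      by (auto intro!: always_eventually divide_right_mono simp: divide_nonpos_nonneg)
  qed
  \<comment> \<open>The logarithm normalised by \<open>n\<close> instead of \<open>Suc n\<close>;
    the term \<open>1 / n\<close> is the extra toss, and the factor \<open>n / Suc n\<close> below
    corrects the normalisation.\<close>
  define u where "u n = ln (w n) / n - ln (N + 1) - (1 + 1 / n - v n / n) * ln 2" for n :: nat
  have "u \<longlonglongrightarrow> 0 - ln (N + 1) - (1 + 0 - s) * ln 2"
    unfolding u_def[abs_def] v_def
    by (intro tendsto_intros ln_w freq lim_const_over_n[of 1, simplified])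
  moreover have "(\<lambda>n. real n / Suc n) \<longlonglongrightarrow> 1"
    using LIMSEQ_n_over_Suc_n by simp
  ultimately have "(\<lambda>n. u n * (real n / Suc n)) \<longlonglongrightarrow> (0 - ln (N + 1) - (1 + 0 - s) * ln 2) * 1"
    by (intro tendsto_mult)
  moreover have "\<forall>\<^sub>F n in sequentially. u n * (real n / Suc n) = ln (Pr (cylinder (Suc n) (Suc n) c)) / Suc n"
    using eventually_gt_at_top[of 0]
  proof eventually_elim
    case (elim n)
    have "ln (Pr (cylinder (Suc n) (Suc n) c)) = ln (w n) - (n * ln (N + 1) + (Suc n - v n) * ln 2)"
      unfolding eq using w(1)[of n] by (simp add: ln_div ln_mult ln_realpow)
    also have "real (Suc n - v n) = 1 + real n - real (v n)"
      using v[of n] by simp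
    finally have "ln (Pr (cylinder (Suc n) (Suc n) c)) = ln (w n) - n * ln (N + 1) - (1 + real n - real (v n)) * ln 2"
      by simp
    also have "1 + real n - real (v n) = n * (1 + 1 / n - v n / n)"
      using elim by (simp add: field_simps)
    also have "ln (w n) - n * ln (N + 1) - n * (1 + 1 / n - v n / n) * ln 2 = n * u n"
      using elim by (simp add: u_def right_diff_distrib mult.assoc)
    finally show ?case
      by (simp add: mult.commute)
  qed
  ultimately have "(\<lambda>n. ln (Pr (cylinder (Suc n) (Suc n) c)) / Suc n) \<longlonglongrightarrow> (0 - ln (N + 1) - (1 + 0 - s) * ln 2) * 1"
    by (rule Lim_transform_eventually)
  then have "(\<lambda>n. ln (Pr (cylinder n n c)) / n) \<longlonglongrightarrow> (0 - ln (N + 1) - (1 + 0 - s) * ln 2) * 1"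
    by (rule LIMSEQ_imp_Suc)
  then show "(\<lambda>n. ln (Pr (cylinder n n c)) / n) \<longlonglongrightarrow> - (ln (N + 1) + (1 - s) * ln 2)"
    by (simp add: algebra_simps)
qed

lemma local_dimension:
  "AE p in nu \<beta>. has_local_dim (nu \<beta>) (X \<beta>) (rho \<beta>) p
     (ln \<lceil>\<beta>\<rceil> / ln \<beta> + ln 2 / ln \<beta> * (1 - measure (mu \<beta>) (S \<beta>)))"
proof (rule AE_nuI)
  let ?s = "measure (mu \<beta>) (S \<beta>)"
  define good where "good b \<longleftrightarrow> b \<in> generic_seqs \<and> (\<forall>n. cell_mass (val (seq_drop n b)) > 0) \<and>
      (\<lambda>n. card {i. i < n \<and> i \<in> visits b} / n) \<longlonglongrightarrow> ?s" for b
  show "AE b in P. good b"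
    using AE_generic AE_cell_mass_pos visit_frequency
    by eventually_elim (simp add: good_def measure_mu_S)
  fix b assume "good b"
  then have b: "b \<in> generic_seqs" "\<And>n. cell_mass (val (seq_drop n b)) > 0"
    "(\<lambda>n. card {i. i < n \<and> i \<in> visits b} / n) \<longlonglongrightarrow> ?s"
    by (auto simp: good_def)
  have ball: "measure (nu \<beta>) (Metric_space.mball (X \<beta>) (rho \<beta>) (psi b) r) =
      Pr (cylinder (nat (\<lfloor>- log \<beta> r\<rfloor> + 1)) (nat (\<lfloor>- log \<beta> r\<rfloor> + 1)) b)" if "r > 0" for r
    using that by (simp only: mball_eq_cyl psi_mem_X[OF b(1)] measure_cyl[OF b(1)])
  \<comment> \<open>An integer \<open>\<beta> = N\<close> would contradict
    \<open>N * \<beta> + 1 \<le> \<beta>\<^sup>2\<close>, so the ceiling is the number of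
    digits.\<close>
  have "\<lceil>\<beta>\<rceil> = int (N + 1)"
  proof -
    have "real N \<noteq> \<beta>"
      using beta_sq by (auto simp: power2_eq_square)
    then show ?thesis
      using N_le_beta beta_less by linarith
  qed
  then have D: "(ln (N + 1) + (1 - ?s) * ln 2) / ln \<beta> = ln \<lceil>\<beta>\<rceil> / ln \<beta> + ln 2 / ln \<beta> * (1 - ?s)"
    by (simp add: add_divide_distrib)
  have "((\<lambda>r. ln (Pr (cylinder (nat (\<lfloor>- log \<beta> r\<rfloor> + 1)) (nat (\<lfloor>- log \<beta> r\<rfloor> + 1)) b)) / ln r) \<longlongrightarrow>
      (ln (N + 1) + (1 - ?s) * ln 2) / ln \<beta>) (at_right 0)"
    by (rule ball_exponent[OF beta_gt_1 cyl_exponent(2)[OF b]])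
  moreover have "\<forall>\<^sub>F r in at_right 0.
      ln (Pr (cylinder (nat (\<lfloor>- log \<beta> r\<rfloor> + 1)) (nat (\<lfloor>- log \<beta> r\<rfloor> + 1)) b)) / ln r =
      ln (measure (nu \<beta>) (Metric_space.mball (X \<beta>) (rho \<beta>) (psi b) r)) / ln r"
    using eventually_at_right_less[of 0] by eventually_elim (simp add: ball)
  ultimately have "((\<lambda>r. ln (measure (nu \<beta>) (Metric_space.mball (X \<beta>) (rho \<beta>) (psi b) r)) / ln r) \<longlongrightarrow>
      ln \<lceil>\<beta>\<rceil> / ln \<beta> + ln 2 / ln \<beta> * (1 - ?s)) (at_right 0)"
    unfolding D by (rule Lim_transform_eventually)
  moreover have "\<forall>r>0. measure (nu \<beta>) (Metric_space.mball (X \<beta>) (rho \<beta>) (psi b) r) > 0"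
    using cyl_exponent(1)[OF b] by (simp add: ball)
  ultimately show "has_local_dim (nu \<beta>) (X \<beta>) (rho \<beta>) (psi b) (ln \<lceil>\<beta>\<rceil> / ln \<beta> + ln 2 / ln \<beta> * (1 - ?s))"
    by (simp add: has_local_dim_def)
qed

end

theorem corollary3p3:
  fixes \<beta> :: real
  assumes "generalised_multinacci \<beta>"
  shows "AE p in nu \<beta>. has_local_dim (nu \<beta>) (X \<beta>) (rho \<beta>) p
           (ln \<lceil>\<beta>\<rceil> / ln \<beta> + ln 2 / ln \<beta> * (1 - measure (mu \<beta>) (S \<beta>)))"
proof -
  interpret multinacci \<beta>
    by unfold_locales (rule assms)
  show ?thesis
    by (rule local_dimension)
qed

end
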